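(* Assume the model is time homogeneous, $(E_n,G_n,H_n,M_n,\lambda_n)=(E,G,H,M,\lambda)$, and that for some $m\ge1$ and some $(\delta,\rho)\in[1,\infty)^2$ $$\forall (x,x')\in E^2:\quad G(x)\le\delta\,G(x')\quad\text{and}\quad M^m(x,dy)\le\rho\,M^m(x',dy).$$ Then for any $n\ge0$, any measurable $F_n$ on $E^{n+1}$ with $\|F_n\|\le1$, and any $N>(n+1)\rho\delta^m$, $$\mathbb E\big(\overline W_n^{\Gamma,N}(F_n)\big)=0,\qquad \mathbb E\big(\overline W_n^{\Gamma,N}(F_n)^2\big)\le(\delta^m\rho)^2(n+1)\Big(1+\frac2N\,\rho\delta^m(n+2)\Big).$$ In addition, $$N\,\mathbb E\Big(\big[\mathbb Q_n^N(F_n)-\mathbb Q_n(F_n)\big]^2\Big)\le2(n+1)\rho\delta^m\Big(4+\rho\delta^m\Big[1+\frac2N(n+2)\Big]\Big)$$ and $$N\,\big|\mathbb E\big(\mathbb Q_n^N(F_n)\big)-\mathbb Q_n(F_n)\big|\le2\sqrt2\,(n+1)\rho\delta^m\Big(4+\rho\delta^m\Big[1+\frac2N(n+2)\Big]\Big)^{1/2}.$$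
   Context: General notation. $\|\cdot\|$ is the sup norm; $\mathcal P(E)$: probability measures on $E$; $\mu(f)=\int f\,d\mu$; $M^m$ is the $m$-th iterate of the Markov transition $M$. Feynman-Kac model (time homogeneous). $E$ is a measurable space, $(X_n)_{n\ge0}$ is an $E$-valued Markov chain with initial law $\eta_0$ and Markov transition $M$; $G:E\to(0,1]$ is measurable; $M(x,dy)=H(x,y)\lambda(dy)$ for some ($\sigma$-finite) measure $\lambda$ and measurable $H>0$. $\gamma_n(1)=\mathbb E\big(\prod_{0\le p<n}G(X_p)\big)$ and $\mathbb Q_n(F_n)=\mathbb E\big(F_n(X_0,\dots,X_n)\prod_{0\le p<n}G(X_p)\big)/\gamma_n(1)$, a probability on $E^{n+1}$. For $\eta\in\mathcal P(E)$, $\Phi(\eta)=\Psi_G(\eta)M$ with $\Psi_G(\eta)(dx)=G(x)\eta(dx)/\eta(G)$. Backward transitions. For $\eta\in\mathcal P(E)$, $\overleftarrow M_{\eta}(x,dy)=\dfrac{G(y)H(y,x)\,\eta(dy)}{\eta(GH(\cdot,x))}$. Particle model. Fix constants $\epsilon_n\ge0$ with $\epsilon_nG\le1$, and let $K_{n+1,\eta}(x,dy)=\epsilon_nG(x)M(x,dy)+(1-\epsilon_nG(x))\,\Phi(\eta)(dy)$. The $N$-particle system $\xi_n=(\xi_n^1,\dots,\xi_n^N)\in E^N$ is the Markov chain with $\xi_0^i$ i.i.d. of law $\eta_0$ and, given $\xi_0,\dots,\xi_n$, the $\xi_{n+1}^i$ independent with $\xi_{n+1}^i\sim K_{n+1,\eta_n^N}(\xi_n^i,\cdot)$,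 where $\eta_n^N=\frac1N\sum_{j}\delta_{\xi_n^j}$. The particle approximation of $\mathbb Q_n$ is $\mathbb Q_n^N(d(x_0,\dots,x_n))=\eta_n^N(dx_n)\prod_{q=1}^n\overleftarrow M_{\eta_{q-1}^N}(x_q,dx_{q-1})$. Set $\gamma_n^N(1)=\prod_{0\le p<n}\eta_p^N(G)$, $\overline\gamma_n^N(1)=\gamma_n^N(1)/\gamma_n(1)$ and $$\overline W_n^{\Gamma,N}(F_n)=\sqrt N\,\big(\overline\gamma_n^N(1)\,\mathbb Q_n^N-\mathbb Q_n\big)(F_n).$$ *)

theory Defs
  imports "HOL-Probability.Probability"
begin

(* Conditionally on (X 0, ..., X n), the state X (Suc n) has law P n (X n); the conditional law is
   expressed by its defining integral identity against the events of the past. *)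
definition markov_chain ::
  "'w measure \<Rightarrow> 's measure \<Rightarrow> 's measure \<Rightarrow> (nat \<Rightarrow> 's \<Rightarrow> 's measure) \<Rightarrow> (nat \<Rightarrow> 'w \<Rightarrow> 's) \<Rightarrow> bool"
  where
  "markov_chain \<Omega> S \<mu> P X \<longleftrightarrow>
     prob_space \<Omega> \<and>
     (\<forall>n. X n \<in> \<Omega> \<rightarrow>\<^sub>M S) \<and>
     distr \<Omega> S (X 0) = \<mu> \<and>
     (\<forall>n. \<forall>A \<in> sets (PiM {..n} (\<lambda>_. S)). \<forall>B \<in> sets S.
        emeasure \<Omega> {\<omega> \<in> space \<Omega>. (\<lambda>i\<in>{..n}. X i \<omega>) \<in> A \<and> X (Suc n) \<omega> \<in> B} =
        (\<integral>\<^sup>+ \<omega>. indicator A (\<lambda>i\<in>{..n}. X i \<omega>) * emeasure (P n (X n \<omega>)) B \<partial>\<Omega>))"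

primrec kernel_iterate :: "'a measure \<Rightarrow> ('a \<Rightarrow> 'a measure) \<Rightarrow> nat \<Rightarrow> 'a \<Rightarrow> 'a measure" where
  "kernel_iterate E M 0 x = return E x"
| "kernel_iterate E M (Suc k) x = M x \<bind> kernel_iterate E M k"

definition fk_gamma :: "'w measure \<Rightarrow> (nat \<Rightarrow> 'w \<Rightarrow> 'a) \<Rightarrow> ('a \<Rightarrow> real) \<Rightarrow> nat \<Rightarrow> real" where
  "fk_gamma \<Omega> X G n = (\<integral>\<omega>. (\<Prod>p<n. G (X p \<omega>)) \<partial>\<Omega>)"

(* The value Q_n(F) of the Feynman-Kac path measure; a point of E^(n+1) is an extensional function
   on {..n}. *)
definition fk_path ::
  "'w measure \<Rightarrow> (nat \<Rightarrow> 'w \<Rightarrow> 'a) \<Rightarrow> ('a \<Rightarrow> real) \<Rightarrow> nat \<Rightarrow> ((nat \<Rightarrow> 'a) \<Rightarrow> real) \<Rightarrow> real" where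
  "fk_path \<Omega> X G n F =
     (\<integral>\<omega>. F (\<lambda>i\<in>{..n}. X i \<omega>) * (\<Prod>p<n. G (X p \<omega>)) \<partial>\<Omega>) / fk_gamma \<Omega> X G n"

definition boltzmann_gibbs :: "('a \<Rightarrow> real) \<Rightarrow> 'a measure \<Rightarrow> 'a measure" where
  "boltzmann_gibbs G \<eta> = density \<eta> (\<lambda>x. ennreal (G x / (\<integral>z. G z \<partial>\<eta>)))"

definition fk_map :: "('a \<Rightarrow> real) \<Rightarrow> ('a \<Rightarrow> 'a measure) \<Rightarrow> 'a measure \<Rightarrow> 'a measure" where
  "fk_map G M \<eta> = boltzmann_gibbs G \<eta> \<bind> M"

definition backward_kernel ::
  "('a \<Rightarrow> real) \<Rightarrow> ('a \<Rightarrow> 'a \<Rightarrow> real) \<Rightarrow> 'a measure \<Rightarrow> 'a \<Rightarrow> 'a measure" where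
  "backward_kernel G H \<eta> x =
     density \<eta> (\<lambda>y. ennreal (G y * H y x) / (\<integral>\<^sup>+ z. ennreal (G z * H z x) \<partial>\<eta>))"

(* p * \<mu> + (1 - p) * \<nu> *)
definition mixture :: "real \<Rightarrow> 'a measure \<Rightarrow> 'a measure \<Rightarrow> 'a measure" where
  "mixture p \<mu> \<nu> = measure_of (space \<mu>) (sets \<mu>)
     (\<lambda>A. ennreal p * emeasure \<mu> A + ennreal (1 - p) * emeasure \<nu> A)"

lemma emeasure_mixture:
  assumes "sets \<nu> = sets \<mu>" "A \<in> sets \<mu>"
  shows "emeasure (mixture p \<mu> \<nu>) A = ennreal p * emeasure \<mu> A + ennreal (1 - p) * emeasure \<nu> A"
proof (rule emeasure_measure_of[OF mixture_def[of p \<mu> \<nu>]])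
  show "sets \<mu> \<subseteq> Pow (space \<mu>)"
    by (rule sets.space_closed)
  show "A \<in> sets (mixture p \<mu> \<nu>)"
    using assms by (simp add: mixture_def)
  show "positive (sets (mixture p \<mu> \<nu>)) (\<lambda>A. ennreal p * emeasure \<mu> A + ennreal (1 - p) * emeasure \<nu> A)"
    by (simp add: positive_def)
  show "countably_additive (sets (mixture p \<mu> \<nu>))
    (\<lambda>A. ennreal p * emeasure \<mu> A + ennreal (1 - p) * emeasure \<nu> A)"
  proof (rule countably_additiveI)
    fix B :: "nat \<Rightarrow> 'a set"
    assume B: "range B \<subseteq> sets (mixture p \<mu> \<nu>)" "disjoint_family B"
    then have "range B \<subseteq> sets \<mu>" "range B \<subseteq> sets \<nu>"
      using assms(1) by (simp_all add: mixture_def)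
    with B(2) show "(\<Sum>i. ennreal p * emeasure \<mu> (B i) + ennreal (1 - p) * emeasure \<nu> (B i)) =
      ennreal p * emeasure \<mu> (\<Union>i. B i) + ennreal (1 - p) * emeasure \<nu> (\<Union>i. B i)"
      by (simp add: suminf_add[symmetric] suminf_emeasure)
  qed
qed

(* The kernel K_(n+1,\<eta>), with e in the role of \<epsilon>_n. *)
definition particle_kernel ::
  "('a \<Rightarrow> real) \<Rightarrow> ('a \<Rightarrow> 'a measure) \<Rightarrow> real \<Rightarrow> 'a measure \<Rightarrow> 'a \<Rightarrow> 'a measure" where
  "particle_kernel G M e \<eta> x = mixture (e * G x) (M x) (fk_map G M \<eta>)"

(* The empirical measure of x 0, ..., x (N - 1), as the law of x J with J uniform on {..<N}. *)
definition empirical :: "'a measure \<Rightarrow> nat \<Rightarrow> (nat \<Rightarrow> 'a) \<Rightarrow> 'a measure" where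
  "empirical E N x = distr (uniform_count_measure {..<N}) E x"

lemma emeasure_empirical:
  assumes "0 < N" "\<And>j. j < N \<Longrightarrow> x j \<in> space E" "A \<in> sets E"
  shows "emeasure (empirical E N x) A = (\<Sum>j<N. emeasure (return E (x j)) A) / of_nat N"
proof -
  have "emeasure (empirical E N x) A = ennreal (card {j \<in> {..<N}. x j \<in> A} / real N)"
    using assms unfolding empirical_def
    by (subst emeasure_distr)
       (auto simp: measurable_def space_uniform_count_measure sets_uniform_count_measure
         emeasure_uniform_count_measure intro!: arg_cong[where f = card] ennreal_cong
         arg_cong2[where f = "(/)"])
  also have "\<dots> = of_nat (card {j \<in> {..<N}. x j \<in> A}) / of_nat N"
    using assms(1) by (simp add: divide_ennreal[symmetric] ennreal_of_nat_eq_real_of_nat)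
  also have "of_nat (card {j \<in> {..<N}. x j \<in> A}) = (\<Sum>j<N. emeasure (return E (x j)) A)"
    using assms(3) by (simp add: indicator_def sum.If_cases Int_def)
  finally show ?thesis .
qed

(* The N particles move independently given the current configuration x in E^N. *)
definition particle_transition ::
  "'a measure \<Rightarrow> ('a \<Rightarrow> real) \<Rightarrow> ('a \<Rightarrow> 'a measure) \<Rightarrow> (nat \<Rightarrow> real) \<Rightarrow> nat \<Rightarrow>
   nat \<Rightarrow> (nat \<Rightarrow> 'a) \<Rightarrow> (nat \<Rightarrow> 'a) measure" where
  "particle_transition E G M \<epsilon> N n x =
     PiM {..<N} (\<lambda>i. particle_kernel G M (\<epsilon> n) (empirical E N x) (x i))"

definition particle_system ::
  "'w measure \<Rightarrow> 'a measure \<Rightarrow> 'a measure \<Rightarrow> ('a \<Rightarrow> real) \<Rightarrow> ('a \<Rightarrow> 'a measure) \<Rightarrow>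
   (nat \<Rightarrow> real) \<Rightarrow> nat \<Rightarrow> (nat \<Rightarrow> 'w \<Rightarrow> (nat \<Rightarrow> 'a)) \<Rightarrow> bool" where
  "particle_system \<Omega> E \<eta>0 G M \<epsilon> N \<xi> \<longleftrightarrow>
     markov_chain \<Omega> (PiM {..<N} (\<lambda>_. E)) (PiM {..<N} (\<lambda>_. \<eta>0)) (particle_transition E G M \<epsilon> N) \<xi>"

(* backward_path E G H \<eta> n x is the law on E^(n+1) of a path that ends in x_n = x and has
   x_(q-1) drawn from backward_kernel G H (\<eta> (q-1)) x_q, for q = n, ..., 1. *)
primrec backward_path ::
  "'a measure \<Rightarrow> ('a \<Rightarrow> real) \<Rightarrow> ('a \<Rightarrow> 'a \<Rightarrow> real) \<Rightarrow> (nat \<Rightarrow> 'a measure) \<Rightarrow>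
   nat \<Rightarrow> 'a \<Rightarrow> (nat \<Rightarrow> 'a) measure" where
  "backward_path E G H \<eta> 0 x = return (PiM {..0} (\<lambda>_. E)) (\<lambda>i\<in>{..0}. x)"
| "backward_path E G H \<eta> (Suc n) x =
     backward_kernel G H (\<eta> n) x \<bind>
       (\<lambda>y. distr (backward_path E G H \<eta> n y) (PiM {..Suc n} (\<lambda>_. E)) (\<lambda>z. z(Suc n := x)))"

(* Q_n^N, for the realised trajectory x 0, x 1, ... of particle configurations. *)
definition particle_path_measure ::
  "'a measure \<Rightarrow> ('a \<Rightarrow> real) \<Rightarrow> ('a \<Rightarrow> 'a \<Rightarrow> real) \<Rightarrow> nat \<Rightarrow> (nat \<Rightarrow> nat \<Rightarrow> 'a) \<Rightarrow>
   nat \<Rightarrow> (nat \<Rightarrow> 'a) measure" where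
  "particle_path_measure E G H N x n =
     empirical E N (x n) \<bind> backward_path E G H (\<lambda>p. empirical E N (x p)) n"

definition particle_gamma ::
  "'a measure \<Rightarrow> ('a \<Rightarrow> real) \<Rightarrow> nat \<Rightarrow> (nat \<Rightarrow> nat \<Rightarrow> 'a) \<Rightarrow> nat \<Rightarrow> real" where
  "particle_gamma E G N x n = (\<Prod>p<n. \<integral>z. G z \<partial>(empirical E N (x p)))"

(* The fluctuation W_n^(Gamma,N)(F) along the trajectory x, where g and q stand for \<gamma>_n(1) and Q_n(F). *)
definition particle_fluctuation ::
  "'a measure \<Rightarrow> ('a \<Rightarrow> real) \<Rightarrow> ('a \<Rightarrow> 'a \<Rightarrow> real) \<Rightarrow> nat \<Rightarrow> (nat \<Rightarrow> nat \<Rightarrow> 'a) \<Rightarrow> nat \<Rightarrow>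
   ((nat \<Rightarrow> 'a) \<Rightarrow> real) \<Rightarrow> real \<Rightarrow> real \<Rightarrow> real" where
  "particle_fluctuation E G H N x n F g q =
     sqrt (real N) *
       (particle_gamma E G N x n / g * (\<integral>z. F z \<partial>(particle_path_measure E G H N x n)) - q)"

end

theory Submission
  imports Defs
begin

text \<open>
  Write \<open>\<gamma>(F)\<close> for the unnormalized path functional and \<open>\<gamma>\<^sup>N(F)\<close> for its particle approximation
  (the product of the normalizing averages times the backward path measure). The backward kernels are
  chosen such that conditionally on the past the mean of \<open>\<gamma>\<^sup>N\<close> at time \<open>n + 1\<close> applied to \<open>F\<close> is
  \<open>\<gamma>\<^sup>N\<close> at time \<open>n\<close> applied to the one-step Feynman-Kac operator of \<open>F\<close>; this gives unbiasedness.
  Conditional independence bounds the conditional variance by a multiple of \<open>1/N\<close> times a product of two values of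
  \<open>\<gamma>\<^sup>N\<close> at time \<open>n\<close>, both on functions of the terminal point. With
  \<open>r = \<rho> \<delta>\<^sup>m\<close>, the mixing condition makes all \<open>k\<close>-step weights \<open>w\<^sub>k(x)\<close>, the expected product of the next
  \<open>k\<close> potentials from \<open>x\<close>, comparable up to the factor \<open>r\<close>. Hence, by Cauchy-Schwarz, induction on \<open>n\<close> yields
  \<open>E[\<gamma>\<^sup>N(F)\<^sup>2] \<le> \<gamma>(F)\<^sup>2 + ((1 + r/N)\<^sup>n\<^sup>+\<^sup>1 - 1) \<gamma>(w\<^sub>k)\<^sup>2\<close> whenever \<open>|F| \<le> w\<^sub>k\<close> at the terminal point.
  The error of the normalized measure is controlled by those of \<open>\<gamma>\<^sup>N(F)\<close> and \<open>\<gamma>\<^sup>N(1)\<close>, and its bias is the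
  mean of the product of the error of \<open>\<gamma>\<^sup>N(1)/\<gamma>(1)\<close> with the error of the normalized measure.
\<close>

text \<open>Two devices make the induction close. First, randomness enters one step at a time:
  \<open>backward_sum\<close> and \<open>particle_sum\<close> turn the path measures into finite
  sums over a fixed array of points, and the chains are used only through the conditional integral
  of a single transition. Second, the test function is dominated by \<open>fk_weight k\<close> at
  its end point, with \<open>k\<close> free, and not by a constant. One Feynman-Kac step turns this
  domination into the one with \<open>k + 1\<close>, and the product in the variance bound involves
  only weights, so the same statement covers it. The prefactor of that product is an upper bound of
  a weight; comparing it with the ratio of two total masses, at the price of a single factor
  \<open>r\<close>, makes the surplus masses cancel, so that each time step multiplies the bound on
  the relative second moment of a weight by \<open>1 + r / N\<close>. The threshold on
  \<open>N\<close> says that \<open>(n + 1) * r / N\<close> is below 1, where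
  \<open>(1 + r / N) ^ (n + 1) - 1\<close> is at most twice that number.\<close>

section \<open>Integrals against probability measures and kernels\<close>

lemma integrable_prob_bounded:
  fixes f :: "'a \<Rightarrow> real"
  assumes "prob_space M" "f \<in> borel_measurable M" "\<And>x. x \<in> space M \<Longrightarrow> \<bar>f x\<bar> \<le> C"
  shows "integrable M f"
proof -
  interpret prob_space M by fact
  show ?thesis using assms by (intro integrable_const_bound[where B = C]) auto
qed

lemma abs_integral_prob_le:
  fixes f :: "'a \<Rightarrow> real"
  assumes "prob_space M" "f \<in> borel_measurable M" "\<And>x. x \<in> space M \<Longrightarrow> \<bar>f x\<bar> \<le> C"
  shows "\<bar>\<integral>x. f x \<partial>M\<bar> \<le> C"
proof -
  interpret prob_space M by fact
  have "\<bar>\<integral>x. f x \<partial>M\<bar> \<le> (\<integral>x. \<bar>f x\<bar> \<partial>M)" by (rule integral_abs_bound)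
  also have "\<dots> \<le> (\<integral>x. C \<partial>M)"
    using integrable_prob_bounded[OF assms] assms(3) by (intro integral_mono) auto
  finally show ?thesis by (simp add: prob_space)
qed

lemma Cauchy_Schwarz_integral:
  fixes f g :: "'a \<Rightarrow> real"
  assumes f: "integrable M (\<lambda>x. (f x)\<^sup>2)" and g: "integrable M (\<lambda>x. (g x)\<^sup>2)"
    and fg: "integrable M (\<lambda>x. f x * g x)"
  shows "(\<integral>x. f x * g x \<partial>M)\<^sup>2 \<le> (\<integral>x. (f x)\<^sup>2 \<partial>M) * (\<integral>x. (g x)\<^sup>2 \<partial>M)"
proof -
  define a b c where "a = (\<integral>x. (f x)\<^sup>2 \<partial>M)" "b = (\<integral>x. f x * g x \<partial>M)" "c = (\<integral>x. (g x)\<^sup>2 \<partial>M)"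
  \<comment> \<open>Two free coefficients avoid any division: \<open>s = c\<close> and
    \<open>t = b\<close> will give \<open>c * (a * c - b\<^sup>2)\<close>, which settles the case of
    positive \<open>c\<close>.\<close>
  have q: "0 \<le> s\<^sup>2 * a - 2 * s * t * b + t\<^sup>2 * c" for s t
  proof -
    have "0 \<le> (\<integral>x. (s * f x - t * g x)\<^sup>2 \<partial>M)" by simp
    also have "(\<lambda>x. (s * f x - t * g x)\<^sup>2)
        = (\<lambda>x. s\<^sup>2 * (f x)\<^sup>2 - 2 * s * t * (f x * g x) + t\<^sup>2 * (g x)\<^sup>2)"
      by (rule ext) (simp add: power2_eq_square algebra_simps)
    also have "(\<integral>x. s\<^sup>2 * (f x)\<^sup>2 - 2 * s * t * (f x * g x) + t\<^sup>2 * (g x)\<^sup>2 \<partial>M)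
        = s\<^sup>2 * a - 2 * s * t * b + t\<^sup>2 * c"
      using f g fg unfolding a_b_c_def by simp
    finally show ?thesis .
  qed
  have "0 \<le> a" "0 \<le> c" unfolding a_b_c_def by simp_all
  have "b\<^sup>2 \<le> a * c"
  proof (cases "c = 0")
    case True
    have "b = 0"
    proof (rule ccontr)
      assume "b \<noteq> 0"
      \<comment> \<open>With \<open>c = 0\<close> the form is affine in \<open>t\<close>; this value
        of \<open>t\<close> makes it equal to -1.\<close>
      have "0 \<le> a - 2 * ((a + 1) / (2 * b)) * b" using q[of 1 "(a + 1) / (2 * b)"] True by simp
      with \<open>b \<noteq> 0\<close> show False by simp
    qed
    then show ?thesis using \<open>0 \<le> a\<close> \<open>0 \<le> c\<close> by simp
  next
    case False
    then have "0 < c" using \<open>0 \<le> c\<close> by simp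
    have "0 \<le> c * (a * c - b\<^sup>2)" using q[of c b] by (simp add: power2_eq_square algebra_simps)
    then show ?thesis using \<open>0 < c\<close> by (simp add: zero_le_mult_iff)
  qed
  then show ?thesis by (simp add: a_b_c_def)
qed

text \<open>Transporting \<open>L x\<close> by \<open>Pair x\<close> moves the dependence on
  \<open>x\<close> from the integrand into the measure. The integrand is then one fixed function on
  the product, and its integral depends measurably on the measure.\<close>

lemma integral_kernel_measurable:
  fixes f :: "'a \<Rightarrow> 'b \<Rightarrow> real"
  assumes f[measurable]: "(\<lambda>(x, y). f x y) \<in> borel_measurable (M \<Otimes>\<^sub>M N)"
    and L: "L \<in> M \<rightarrow>\<^sub>M prob_algebra N"
  shows "(\<lambda>x. \<integral>y. f x y \<partial>L x) \<in> borel_measurable M"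
proof -
  note L' = measurable_prob_algebraD[OF L]
  have "(\<lambda>x. distr (L x) (M \<Otimes>\<^sub>M N) (Pair x)) \<in> M \<rightarrow>\<^sub>M subprob_algebra (M \<Otimes>\<^sub>M N)"
    by (rule measurable_distr2[OF _ L']) simp
  then have "(\<lambda>x. \<integral>z. (case z of (x, y) \<Rightarrow> f x y) \<partial>distr (L x) (M \<Otimes>\<^sub>M N) (Pair x)) \<in> borel_measurable M"
    by (rule measurable_compose[OF _ integral_measurable_subprob_algebra[OF f]])
  also have "?this \<longleftrightarrow> ?thesis"
  proof (rule measurable_cong)
    fix x assume x: "x \<in> space M"
    then have [measurable_cong]: "sets (L x) = sets N" by (rule sets_kernel[OF L'])
    show "(\<integral>z. (case z of (x, y) \<Rightarrow> f x y) \<partial>distr (L x) (M \<Otimes>\<^sub>M N) (Pair x)) = (\<integral>y. f x y \<partial>L x)"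
      using x by (subst integral_distr) auto
  qed
  finally show ?thesis .
qed

lemma prob_algebra_kernelD:
  assumes "L \<in> M \<rightarrow>\<^sub>M prob_algebra N" "x \<in> space M"
  shows "prob_space (L x)" "sets (L x) = sets N" "space (L x) = space N"
  using measurable_space[OF assms] sets_eq_imp_space_eq by (auto simp: space_prob_algebra)

lemma integral_bind_prob:
  fixes f :: "'b \<Rightarrow> real"
  assumes "prob_space M" "L \<in> M \<rightarrow>\<^sub>M prob_algebra N"
    "f \<in> borel_measurable N" "\<And>x. x \<in> space N \<Longrightarrow> \<bar>f x\<bar> \<le> C"
  shows "(\<integral>y. f y \<partial>(M \<bind> L)) = (\<integral>x. \<integral>y. f y \<partial>L x \<partial>M)"
proof (rule integral_bind[where K = N and B = C and B' = 1])
  show "AE x in M. emeasure (L x) (space (L x)) \<le> ennreal 1"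
    using prob_algebra_kernelD(1)[OF assms(2)] by (auto intro!: AE_I2 simp: prob_space.emeasure_space_1)
qed (use assms in \<open>auto intro: measurable_prob_algebraD prob_space.finite_measure\<close>)

lemma measure_eqI_pair_times:
  assumes "sets P = sets (A \<Otimes>\<^sub>M B)" "sets P' = sets (A \<Otimes>\<^sub>M B)" "finite_measure P"
    "\<And>a b. a \<in> sets A \<Longrightarrow> b \<in> sets B \<Longrightarrow> emeasure P (a \<times> b) = emeasure P' (a \<times> b)"
  shows "P = P'"
proof (rule measure_eqI_generator_eq[OF Int_stable_pair_measure_generator[of A B],
      where \<Omega> = "space A \<times> space B" and A = "\<lambda>_. space A \<times> space B"])
  interpret finite_measure P by fact
  show "emeasure P (space A \<times> space B) \<noteq> \<infinity>" for i by simp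
  show "{a \<times> b |a b. a \<in> sets A \<and> b \<in> sets B} \<subseteq> Pow (space A \<times> space B)"
    by (rule pair_measure_closed)
  show "sets P = sigma_sets (space A \<times> space B) {a \<times> b |a b. a \<in> sets A \<and> b \<in> sets B}"
    "sets P' = sigma_sets (space A \<times> space B) {a \<times> b |a b. a \<in> sets A \<and> b \<in> sets B}"
    unfolding assms(1,2) sets_pair_measure by (rule refl)+
  show "range (\<lambda>_. space A \<times> space B) \<subseteq> {a \<times> b |a b. a \<in> sets A \<and> b \<in> sets B}" by auto
  show "emeasure P X = emeasure P' X" if "X \<in> {a \<times> b |a b. a \<in> sets A \<and> b \<in> sets B}" for X
    using that assms(4) by auto
qed simp

section \<open>Conditional integrals along a Markov chain\<close>

text \<open>The defining identity of \<open>markov_chain\<close> speaks of an event of the past and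
  an event of the next state, that is, of rectangles. It says that two laws on the product of past
  and next state agree there, so they are equal and give the same integrals of functions that are
  not products.\<close>

lemma markov_chain_integral:
  fixes h :: "(nat \<Rightarrow> 's) \<Rightarrow> 's \<Rightarrow> real"
  assumes X: "markov_chain \<Omega> S \<mu> P X" and P: "P n \<in> S \<rightarrow>\<^sub>M prob_algebra S"
    and h: "(\<lambda>(z, y). h z y) \<in> borel_measurable (PiM {..n} (\<lambda>_. S) \<Otimes>\<^sub>M S)"
    and bound: "\<And>z y. z \<in> space (PiM {..n} (\<lambda>_. S)) \<Longrightarrow> y \<in> space S \<Longrightarrow> \<bar>h z y\<bar> \<le> C"
  shows "(\<integral>\<omega>. h (\<lambda>i\<in>{..n}. X i \<omega>) (X (Suc n) \<omega>) \<partial>\<Omega>)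
    = (\<integral>\<omega>. (\<integral>y. h (\<lambda>i\<in>{..n}. X i \<omega>) y \<partial>P n (X n \<omega>)) \<partial>\<Omega>)"
proof -
  interpret prob_space \<Omega> using X by (simp add: markov_chain_def)
  have X_meas[measurable]: "\<And>k. X k \<in> \<Omega> \<rightarrow>\<^sub>M S" using X by (simp add: markov_chain_def)
  note h[measurable]
  let ?A = "PiM {..n} (\<lambda>_. S)"
  define past where "past = (\<lambda>\<omega>. \<lambda>i\<in>{..n}. X i \<omega>)"
  have past[measurable]: "past \<in> \<Omega> \<rightarrow>\<^sub>M ?A" unfolding past_def by measurable
  have PX: "(\<lambda>\<omega>. P n (X n \<omega>)) \<in> \<Omega> \<rightarrow>\<^sub>M prob_algebra S" by (rule measurable_compose[OF X_meas P])
  \<comment> \<open>The conditional law of the pair: a point mass at the observed past, times the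
    transition from the current state.\<close>
  define L where "L = (\<lambda>\<omega>. distr (P n (X n \<omega>)) (?A \<Otimes>\<^sub>M S) (Pair (past \<omega>)))"
  have L: "L \<in> \<Omega> \<rightarrow>\<^sub>M prob_algebra (?A \<Otimes>\<^sub>M S)"
    unfolding L_def by (rule measurable_distr_prob_space2[OF PX]) measurable
  have eq: "distr \<Omega> (?A \<Otimes>\<^sub>M S) (\<lambda>\<omega>. (past \<omega>, X (Suc n) \<omega>)) = \<Omega> \<bind> L"
  proof (rule measure_eqI_pair_times[where A = ?A and B = S])
    show "sets (\<Omega> \<bind> L) = sets (?A \<Otimes>\<^sub>M S)"
      using prob_algebra_kernelD[OF L] by (intro sets_bind) (auto simp: not_empty)
    show "finite_measure (distr \<Omega> (?A \<Otimes>\<^sub>M S) (\<lambda>\<omega>. (past \<omega>, X (Suc n) \<omega>)))"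
      by (intro finite_measure_distr) measurable
    fix a b assume a[measurable]: "a \<in> sets ?A" and b[measurable]: "b \<in> sets S"
    have "emeasure (distr \<Omega> (?A \<Otimes>\<^sub>M S) (\<lambda>\<omega>. (past \<omega>, X (Suc n) \<omega>))) (a \<times> b)
        = emeasure \<Omega> {\<omega> \<in> space \<Omega>. past \<omega> \<in> a \<and> X (Suc n) \<omega> \<in> b}"
      by (subst emeasure_distr) (simp_all add: vimage_def Int_def conj_commute)
    also have "\<dots> = (\<integral>\<^sup>+ \<omega>. indicator a (past \<omega>) * emeasure (P n (X n \<omega>)) b \<partial>\<Omega>)"
      using X a b by (simp add: markov_chain_def past_def)
    also have "\<dots> = (\<integral>\<^sup>+ \<omega>. emeasure (L \<omega>) (a \<times> b) \<partial>\<Omega>)"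
    proof (rule nn_integral_cong)
      fix \<omega> assume w: "\<omega> \<in> space \<Omega>"
      have [measurable_cong]: "sets (P n (X n \<omega>)) = sets S" by (rule prob_algebra_kernelD[OF PX w])
      have "past \<omega> \<in> space ?A" using w by (rule measurable_space[OF past])
      moreover have "Pair (past \<omega>) -` (a \<times> b) \<inter> space (P n (X n \<omega>)) = (if past \<omega> \<in> a then b else {})"
        using sets.sets_into_space[OF b] prob_algebra_kernelD(3)[OF PX w] by auto
      ultimately show "indicator a (past \<omega>) * emeasure (P n (X n \<omega>)) b = emeasure (L \<omega>) (a \<times> b)"
        unfolding L_def by (subst emeasure_distr) auto
    qed
    also have "\<dots> = emeasure (\<Omega> \<bind> L) (a \<times> b)"
      by (rule emeasure_bind[OF not_empty measurable_prob_algebraD[OF L], symmetric]) simp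
    finally show "emeasure (distr \<Omega> (?A \<Otimes>\<^sub>M S) (\<lambda>\<omega>. (past \<omega>, X (Suc n) \<omega>))) (a \<times> b)
        = emeasure (\<Omega> \<bind> L) (a \<times> b)" .
  qed simp
  have "(\<integral>\<omega>. h (past \<omega>) (X (Suc n) \<omega>) \<partial>\<Omega>)
      = (\<integral>z. (case z of (z, y) \<Rightarrow> h z y) \<partial>distr \<Omega> (?A \<Otimes>\<^sub>M S) (\<lambda>\<omega>. (past \<omega>, X (Suc n) \<omega>)))"
    by (subst integral_distr) auto
  also have "\<dots> = (\<integral>\<omega>. (\<integral>z. (case z of (z, y) \<Rightarrow> h z y) \<partial>L \<omega>) \<partial>\<Omega>)"
    unfolding eq using bound
    by (intro integral_bind_prob[OF prob_space_axioms L, where C = C])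
      (auto simp: space_pair_measure)
  also have "\<dots> = (\<integral>\<omega>. (\<integral>y. h (past \<omega>) y \<partial>P n (X n \<omega>)) \<partial>\<Omega>)"
  proof (rule Bochner_Integration.integral_cong[OF refl])
    fix \<omega> assume w: "\<omega> \<in> space \<Omega>"
    have [measurable_cong]: "sets (P n (X n \<omega>)) = sets S" by (rule prob_algebra_kernelD[OF PX w])
    have [simp]: "past \<omega> \<in> space ?A" using w by (rule measurable_space[OF past])
    show "(\<integral>z. (case z of (z, y) \<Rightarrow> h z y) \<partial>L \<omega>) = (\<integral>y. h (past \<omega>) y \<partial>P n (X n \<omega>))"
      unfolding L_def by (subst integral_distr) auto
  qed
  finally show ?thesis by (simp add: past_def)
qed

section \<open>Products and mixtures of probability measures\<close>

text \<open>It suffices to test boxes, an intersection-stable generator, and the mass of a box is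
  the finite product of the masses of its sides.\<close>

lemma measurable_PiM_prob_algebra:
  assumes I: "finite I" and K: "\<And>i. i \<in> I \<Longrightarrow> K i \<in> A \<rightarrow>\<^sub>M prob_algebra (B i)"
  shows "(\<lambda>a. PiM I (\<lambda>i. K i a)) \<in> A \<rightarrow>\<^sub>M prob_algebra (PiM I B)"
proof (rule measurable_prob_algebra_generated[OF sets_PiM Int_stable_prod_algebra prod_algebra_sets_into_space])
  fix a assume a: "a \<in> space A"
  show "prob_space (PiM I (\<lambda>i. K i a))"
    by (rule prob_space_PiM) (use prob_algebra_kernelD[OF K a] in auto)
  show "sets (PiM I (\<lambda>i. K i a)) = sets (PiM I B)"
    by (rule sets_PiM_cong) (use prob_algebra_kernelD[OF K a] in auto)
next
  fix D assume "D \<in> prod_algebra I B"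
  then obtain F where F: "D = Pi\<^sub>E I F" "F \<in> (\<Pi> i\<in>I. sets (B i))" by (rule prod_algebraE_all)
  have "emeasure (PiM I (\<lambda>i. K i a)) D = (\<Prod>i\<in>I. emeasure (K i a) (F i))" if a: "a \<in> space A" for a
  proof -
    have F': "\<And>i. i \<in> I \<Longrightarrow> F i \<in> sets (K i a)" using F prob_algebra_kernelD(2)[OF K a] by auto
    have "D = prod_emb I (\<lambda>i. K i a) I (Pi\<^sub>E I F)"
      unfolding F(1) using F' by (intro prod_emb_PiE_same_index[symmetric] sets.sets_into_space)
    then show ?thesis
      using emeasure_PiM_emb[of I "\<lambda>i. K i a" I F] I F' prob_algebra_kernelD(1)[OF K a] by simp
  qed
  moreover have "(\<lambda>a. \<Prod>i\<in>I. emeasure (K i a) (F i)) \<in> borel_measurable A"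
  proof (rule borel_measurable_prod_ennreal)
    fix i assume "i \<in> I"
    then show "(\<lambda>a. emeasure (K i a) (F i)) \<in> borel_measurable A"
      using F(2) measurable_compose[OF measurable_prob_algebraD[OF K] measurable_emeasure_subprob_algebra]
      by auto
  qed
  ultimately show "(\<lambda>a. emeasure (PiM I (\<lambda>i. K i a)) D) \<in> borel_measurable A"
    by (simp cong: measurable_cong)
qed

text \<open>A mixture is a draw from \<open>\<mu>\<close> or \<open>\<nu>\<close> decided by a
  Bernoulli variable. Written as a \<open>bind\<close>, it inherits total mass one and the formula
  for integrals from the theory of kernels.\<close>

lemma
  fixes f :: "'a \<Rightarrow> real"
  assumes p: "0 \<le> p" "p \<le> 1" and \<mu>: "\<mu> \<in> space (prob_algebra E)" and \<nu>: "\<nu> \<in> space (prob_algebra E)"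
  shows mixture_in_prob_algebra: "mixture p \<mu> \<nu> \<in> space (prob_algebra E)"
    and integral_mixture: "f \<in> borel_measurable E \<Longrightarrow> (\<And>x. x \<in> space E \<Longrightarrow> \<bar>f x\<bar> \<le> C) \<Longrightarrow>
      (\<integral>x. f x \<partial>mixture p \<mu> \<nu>) = p * (\<integral>x. f x \<partial>\<mu>) + (1 - p) * (\<integral>x. f x \<partial>\<nu>)"
proof -
  let ?L = "\<lambda>b. if b then \<mu> else \<nu>"
  have sets: "sets \<mu> = sets E" "sets \<nu> = sets E" using \<mu> \<nu> by (auto simp: space_prob_algebra)
  have smix: "sets (mixture p \<mu> \<nu>) = sets \<mu>" by (simp add: mixture_def)
  have L: "?L \<in> measure_pmf (bernoulli_pmf p) \<rightarrow>\<^sub>M prob_algebra E"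
    using \<mu> \<nu> by (auto simp: measurable_def)
  have pmf: "measure_pmf (bernoulli_pmf p) \<in> space (prob_algebra (measure_pmf (bernoulli_pmf p)))"
    by (simp add: space_prob_algebra measure_pmf.prob_space_axioms)
  have eq: "mixture p \<mu> \<nu> = measure_pmf (bernoulli_pmf p) \<bind> ?L"
  proof (rule measure_eqI)
    show s: "sets (mixture p \<mu> \<nu>) = sets (measure_pmf (bernoulli_pmf p) \<bind> ?L)"
      unfolding smix using sets by (subst sets_bind[where N = E]) auto
    fix A assume "A \<in> sets (mixture p \<mu> \<nu>)"
    then have A: "A \<in> sets E" using smix sets by simp
    show "emeasure (mixture p \<mu> \<nu>) A = emeasure (measure_pmf (bernoulli_pmf p) \<bind> ?L) A"
      using p sets A
      by (simp add: emeasure_mixture emeasure_bind[OF _ measurable_prob_algebraD[OF L]] mult.commute)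
  qed
  show "mixture p \<mu> \<nu> \<in> space (prob_algebra E)"
    unfolding eq space_prob_algebra
    using prob_space_bind'[OF pmf L] sets_bind'[OF pmf L] by simp
  assume "f \<in> borel_measurable E" "\<And>x. x \<in> space E \<Longrightarrow> \<bar>f x\<bar> \<le> C"
  then show "(\<integral>x. f x \<partial>mixture p \<mu> \<nu>) = p * (\<integral>x. f x \<partial>\<mu>) + (1 - p) * (\<integral>x. f x \<partial>\<nu>)"
    unfolding eq using p
    by (subst integral_bind_prob[OF measure_pmf.prob_space_axioms L, where C = C]) simp_all
qed

lemma integral_PiM_component:
  fixes f :: "'a \<Rightarrow> real"
  assumes "\<And>i. prob_space (K i)" "finite I" "i \<in> I" "f \<in> borel_measurable (K i)"
  shows "(\<integral>x. f (x i) \<partial>PiM I K) = (\<integral>x. f x \<partial>K i)"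
proof -
  interpret product_prob_space K I by (rule product_prob_spaceI) fact
  have "(\<integral>x. f (x i) \<partial>PiM I K) = (\<integral>x. f x \<partial>distr (PiM I K) (K i) (\<lambda>x. x i))"
    using assms by (subst integral_distr) auto
  then show ?thesis using assms(3) by (simp add: PiM_component)
qed

lemma integral_PiM_two_components:
  fixes f :: "'a \<Rightarrow> real"
  assumes K: "\<And>i. prob_space (K i)" and I: "finite I" "i \<in> I" "j \<in> I" "i \<noteq> j"
    and f: "\<And>i. i \<in> I \<Longrightarrow> f \<in> borel_measurable (K i)" "\<And>i x. i \<in> I \<Longrightarrow> x \<in> space (K i) \<Longrightarrow> \<bar>f x\<bar> \<le> C"
  shows "(\<integral>x. f (x i) * f (x j) \<partial>PiM I K) = (\<integral>x. f x \<partial>K i) * (\<integral>x. f x \<partial>K j)"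
proof -
  interpret product_prob_space K I by (rule product_prob_spaceI) fact
  \<comment> \<open>The two factors are padded with the constant 1 in all other coordinates, so that
    the product formula over the whole of \<open>I\<close> applies.\<close>
  let ?g = "\<lambda>k x. if k = i \<or> k = j then f x else 1"
  have g: "(\<Prod>k\<in>I. h k) = h i * h j" if "\<And>k. k \<notin> {i, j} \<Longrightarrow> h k = 1" for h :: "_ \<Rightarrow> real"
    using I that by (subst prod.mono_neutral_right[of I "{i, j}"]) auto
  have "(\<integral>x. (\<Prod>k\<in>I. ?g k (x k)) \<partial>PiM I K) = (\<Prod>k\<in>I. \<integral>x. ?g k x \<partial>K k)"
  proof (rule product_integral_prod[OF I(1)])
    show "integrable (K k) (?g k)" if "k \<in> I" for k
      using integrable_prob_bounded[OF K f(1)[OF that] f(2)[OF that]] by (cases "k = i \<or> k = j") auto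
  qed
  moreover have "(\<Prod>k\<in>I. \<integral>x. ?g k x \<partial>K k) = (\<integral>x. ?g i x \<partial>K i) * (\<integral>x. ?g j x \<partial>K j)"
    using prob_space.prob_space[OF K] by (intro g) auto
  moreover have "(\<Prod>k\<in>I. ?g k (x k)) = f (x i) * f (x j)" for x
    by (subst g) auto
  ultimately show ?thesis by simp
qed

text \<open>Independence factorises the off-diagonal terms. The inequality comes from the diagonal,
  where the squares of the means are added without being present, so that the means complete to the
  square of their sum.\<close>

lemma second_moment_sum_PiM:
  fixes f :: "'a \<Rightarrow> real"
  assumes K: "\<And>i. prob_space (K i)" and I: "finite I"
    and f: "\<And>i. i \<in> I \<Longrightarrow> f \<in> borel_measurable (K i)" "\<And>i x. i \<in> I \<Longrightarrow> x \<in> space (K i) \<Longrightarrow> \<bar>f x\<bar> \<le> C"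
  shows "(\<integral>x. (\<Sum>i\<in>I. f (x i))\<^sup>2 \<partial>PiM I K)
    \<le> (\<Sum>i\<in>I. \<integral>x. f x \<partial>K i)\<^sup>2 + (\<Sum>i\<in>I. \<integral>x. (f x)\<^sup>2 \<partial>K i)"
proof -
  interpret product_prob_space K I by (rule product_prob_spaceI) fact
  let ?e = "\<lambda>i. \<integral>x. f x \<partial>K i" and ?s = "\<lambda>i. \<integral>x. (f x)\<^sup>2 \<partial>K i"
  have meas[measurable]: "(\<lambda>x. f (x i)) \<in> borel_measurable (PiM I K)" if "i \<in> I" for i
    using f(1)[OF that] that by measurable
  have bnd: "\<bar>f (x i)\<bar> \<le> C" if "i \<in> I" "x \<in> space (PiM I K)" for i x
    using that by (intro f(2)[OF that(1)]) (auto simp: space_PiM)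
  have int: "integrable (PiM I K) (\<lambda>x. f (x i) * f (x j))" if "i \<in> I" "j \<in> I" for i j
  proof (rule integrable_prob_bounded[OF P.prob_space_axioms, where C = "C * C"])
    show "\<bar>f (x i) * f (x j)\<bar> \<le> C * C" if "x \<in> space (PiM I K)" for x
      unfolding abs_mult using bnd[OF \<open>i \<in> I\<close> that] bnd[OF \<open>j \<in> I\<close> that] by (intro mult_mono) auto
  qed (use that in measurable)
  have "(\<integral>x. (\<Sum>i\<in>I. f (x i))\<^sup>2 \<partial>PiM I K) = (\<Sum>i\<in>I. \<Sum>j\<in>I. \<integral>x. f (x i) * f (x j) \<partial>PiM I K)"
    using int by (simp add: power2_eq_square sum_product)
  also have "\<dots> \<le> (\<Sum>i\<in>I. \<Sum>j\<in>I. ?e i * ?e j + (if i = j then ?s i else 0))"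
  proof (intro sum_mono)
    fix i j assume ij: "i \<in> I" "j \<in> I"
    show "(\<integral>x. f (x i) * f (x j) \<partial>PiM I K) \<le> ?e i * ?e j + (if i = j then ?s i else 0)"
    proof (cases "i = j")
      case True
      have "(\<integral>x. f (x i) * f (x i) \<partial>PiM I K) = ?s i"
        using integral_PiM_component[OF K I ij(1), of "\<lambda>x. f x * f x"] f(1)[OF ij(1)]
        by (simp add: power2_eq_square)
      then show ?thesis using True by simp
    next
      case False
      then show ?thesis using integral_PiM_two_components[OF K I ij False f] by simp
    qed
  qed
  also have "\<dots> = (\<Sum>i\<in>I. ?e i)\<^sup>2 + (\<Sum>i\<in>I. ?s i)"
    using I by (simp add: sum.distrib power2_eq_square sum_product)
  finally show ?thesis .
qed

text \<open>Measurability is reduced to real integrals of indicators because the kernels of the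
  particle model come with closed formulas for such integrals, which are visibly measurable in the
  parameter.\<close>

lemma measurable_prob_algebra_integral:
  assumes K: "\<And>x. x \<in> space A \<Longrightarrow> K x \<in> space (prob_algebra E)"
    and meas: "\<And>B. B \<in> sets E \<Longrightarrow> (\<lambda>x. \<integral>y. indicator B y \<partial>K x :: real) \<in> borel_measurable A"
  shows "K \<in> A \<rightarrow>\<^sub>M prob_algebra E"
proof (rule measurable_prob_algebraI)
  show "prob_space (K x)" if "x \<in> space A" for x using K[OF that] by (simp add: space_prob_algebra)
  show "K \<in> A \<rightarrow>\<^sub>M subprob_algebra E"
  proof (rule measurable_subprob_algebra)
    fix x assume x: "x \<in> space A"
    show "subprob_space (K x)" "sets (K x) = sets E"
      using K[OF x] by (auto simp: space_prob_algebra intro: prob_space_imp_subprob_space)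
  next
    fix B assume B: "B \<in> sets E"
    have "emeasure (K x) B = ennreal (\<integral>y. indicator B y \<partial>K x)" if "x \<in> space A" for x
    proof -
      interpret prob_space "K x" using K[OF that] by (simp add: space_prob_algebra)
      show ?thesis using K[OF that] B by (simp add: space_prob_algebra emeasure_eq_measure)
    qed
    then show "(\<lambda>x. emeasure (K x) B) \<in> borel_measurable A"
      using meas[OF B] by (simp cong: measurable_cong)
  qed
qed

section \<open>Empirical measures and their reweightings\<close>

lemma measurable_empirical_index:
  assumes "\<And>j. j < N \<Longrightarrow> x j \<in> space E"
  shows "x \<in> uniform_count_measure {..<N} \<rightarrow>\<^sub>M E"
  using assms by (auto simp: measurable_def space_uniform_count_measure sets_uniform_count_measure)

lemma empirical_in_prob_algebra:
  assumes "0 < N" "\<And>j. j < N \<Longrightarrow> x j \<in> space E"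
  shows "empirical E N x \<in> space (prob_algebra E)"
proof -
  interpret prob_space "uniform_count_measure {..<N}"
    using assms(1) by (intro prob_space_uniform_count_measure) auto
  show ?thesis
    using prob_space_distr[OF measurable_empirical_index[OF assms(2)]]
    by (simp add: empirical_def space_prob_algebra)
qed

lemma integral_empirical:
  fixes f :: "'a \<Rightarrow> real"
  assumes "\<And>j. j < N \<Longrightarrow> x j \<in> space E" "f \<in> borel_measurable E"
  shows "(\<integral>z. f z \<partial>empirical E N x) = (\<Sum>j<N. f (x j)) / N"
  unfolding empirical_def
  using assms(2) measurable_empirical_index[OF assms(1)]
  by (subst integral_distr) (auto simp: integral_uniform_count_measure)

lemma integrable_empirical:
  fixes f :: "'a \<Rightarrow> real"
  assumes "\<And>j. j < N \<Longrightarrow> x j \<in> space E" "f \<in> borel_measurable E"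
  shows "integrable (empirical E N x) f"
proof -
  have x: "x \<in> uniform_count_measure {..<N} \<rightarrow>\<^sub>M E"
    by (rule measurable_empirical_index) (rule assms(1))
  show ?thesis
    unfolding empirical_def integrable_distr_eq[OF x assms(2)]
    by (simp add: uniform_count_measure_def integrable_point_measure_finite)
qed

lemma nn_integral_empirical:
  assumes "\<And>j. j < N \<Longrightarrow> x j \<in> space E" "f \<in> borel_measurable E" "\<And>z. z \<in> space E \<Longrightarrow> 0 \<le> f z"
  shows "(\<integral>\<^sup>+z. ennreal (f z) \<partial>empirical E N x) = ennreal ((\<Sum>j<N. f (x j)) / N)"
proof -
  have "(\<integral>\<^sup>+z. ennreal (f z) \<partial>empirical E N x) = ennreal (\<integral>z. f z \<partial>empirical E N x)"
    using assms by (intro nn_integral_eq_integral integrable_empirical AE_I2) (auto simp: empirical_def)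
  also have "(\<integral>z. f z \<partial>empirical E N x) = (\<Sum>j<N. f (x j)) / N"
    using assms(1,2) by (rule integral_empirical)
  finally show ?thesis .
qed

text \<open>Serves two reweightings of the empirical measure: \<open>w z = G z * H z y\<close> for
  the backward kernel at \<open>y\<close>, and \<open>w = G\<close> for the Boltzmann-Gibbs
  transform. The normalising constant is the mean of \<open>w\<close>, hence the inner division by
  \<open>N\<close>, which cancels in the integral.\<close>

lemma
  fixes w f :: "'a \<Rightarrow> real"
  assumes N: "0 < N" and x: "\<And>j. j < N \<Longrightarrow> x j \<in> space E"
    and [measurable]: "w \<in> borel_measurable E" and w: "\<And>z. z \<in> space E \<Longrightarrow> 0 \<le> w z"
    and pos: "0 < (\<Sum>j<N. w (x j))"
  shows density_empirical_in_prob_algebra: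
      "density (empirical E N x) (\<lambda>z. ennreal (w z / ((\<Sum>j<N. w (x j)) / N))) \<in> space (prob_algebra E)"
    and integral_density_empirical: "f \<in> borel_measurable E \<Longrightarrow>
      (\<integral>z. f z \<partial>density (empirical E N x) (\<lambda>z. ennreal (w z / ((\<Sum>j<N. w (x j)) / N)))) =
      (\<Sum>j<N. w (x j) * f (x j)) / (\<Sum>j<N. w (x j))"
proof -
  define c where "c = (\<Sum>j<N. w (x j)) / N"
  have c: "0 < c" using pos N by (simp add: c_def)
  have [measurable_cong]: "sets (empirical E N x) = sets E" by (simp add: empirical_def)
  have [simp]: "space (empirical E N x) = space E" by (simp add: empirical_def)
  have "emeasure (density (empirical E N x) (\<lambda>z. ennreal (w z / c))) (space E)
      = (\<integral>\<^sup>+z. ennreal (w z / c) \<partial>empirical E N x)"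
    by (subst emeasure_density) (auto intro!: nn_integral_cong)
  also have "\<dots> = ennreal ((\<Sum>j<N. w (x j) / c) / N)"
    using w c by (intro nn_integral_empirical[OF x]) auto
  also have "(\<Sum>j<N. w (x j) / c) / N = 1"
    unfolding sum_divide_distrib[symmetric] using N pos by (simp add: c_def)
  finally show "density (empirical E N x) (\<lambda>z. ennreal (w z / ((\<Sum>j<N. w (x j)) / N))) \<in> space (prob_algebra E)"
    by (auto simp: space_prob_algebra empirical_def c_def[symmetric] intro!: prob_spaceI)
  assume [measurable]: "f \<in> borel_measurable E"
  have "(\<integral>z. f z \<partial>density (empirical E N x) (\<lambda>z. ennreal (w z / c))) = (\<integral>z. w z / c * f z \<partial>empirical E N x)"
    using c w by (subst integral_density) (auto intro!: AE_I2)
  also have "\<dots> = (\<Sum>j<N. w (x j) / c * f (x j)) / N"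
    by (intro integral_empirical[OF x]) auto
  also have "\<dots> = (\<Sum>j<N. w (x j) * f (x j)) / c / N"
    by (simp add: sum_divide_distrib)
  also have "\<dots> = (\<Sum>j<N. w (x j) * f (x j)) / (\<Sum>j<N. w (x j))"
    using N by (simp add: c_def)
  finally show "(\<integral>z. f z \<partial>density (empirical E N x) (\<lambda>z. ennreal (w z / ((\<Sum>j<N. w (x j)) / N)))) =
      (\<Sum>j<N. w (x j) * f (x j)) / (\<Sum>j<N. w (x j))"
    by (simp add: c_def)
qed

section \<open>Path functionals as finite sums\<close>

text \<open>The integral of \<open>F\<close> under \<open>backward_path\<close> for empirical
  measures, with the ancestor of each point chosen among the \<open>N\<close> points one time
  earlier. As a finite sum it makes sense for every \<open>F\<close>, so its algebra carries no
  measurability conditions. The visited end point is stored in \<open>F\<close>, which is why the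
  inductions below generalise over \<open>F\<close>.\<close>

primrec backward_sum ::
  "('a \<Rightarrow> real) \<Rightarrow> ('a \<Rightarrow> 'a \<Rightarrow> real) \<Rightarrow> nat \<Rightarrow> (nat \<Rightarrow> nat \<Rightarrow> 'a) \<Rightarrow>
   nat \<Rightarrow> ((nat \<Rightarrow> 'a) \<Rightarrow> real) \<Rightarrow> 'a \<Rightarrow> real" where
  "backward_sum G H N x 0 F y = F (\<lambda>i\<in>{..0}. y)"
| "backward_sum G H N x (Suc n) F y =
     (\<Sum>j<N. G (x n j) * H (x n j) y * backward_sum G H N x n (\<lambda>z. F (z(Suc n := y))) (x n j)) /
     (\<Sum>j<N. G (x n j) * H (x n j) y)"

definition particle_sum ::
  "('a \<Rightarrow> real) \<Rightarrow> ('a \<Rightarrow> 'a \<Rightarrow> real) \<Rightarrow> nat \<Rightarrow> (nat \<Rightarrow> nat \<Rightarrow> 'a) \<Rightarrow>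
   nat \<Rightarrow> ((nat \<Rightarrow> 'a) \<Rightarrow> real) \<Rightarrow> real" where
  "particle_sum G H N x n F =
     (\<Prod>p<n. (\<Sum>j<N. G (x p j)) / N) * ((\<Sum>j<N. backward_sum G H N x n F (x n j)) / N)"

text \<open>Only rows strictly below \<open>n\<close> enter, since \<open>y\<close> stands for the
  point at time \<open>n\<close>. This allows the newest row to be resampled, and a trajectory to be
  cut down to its past.\<close>

lemma backward_sum_cong:
  assumes "\<And>p. p < n \<Longrightarrow> x p = x' p"
  shows "backward_sum G H N x n F y = backward_sum G H N x' n F y"
  using assms
proof (induction n arbitrary: F y)
  case (Suc n)
  then have "backward_sum G H N x n F y = backward_sum G H N x' n F y" for F y by simp
  then show ?case using Suc.prems[of n] by simp
qed simp

lemma particle_sum_cong: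
  assumes "\<And>p. p \<le> n \<Longrightarrow> x p = x' p"
  shows "particle_sum G H N x n F = particle_sum G H N x' n F"
  using assms backward_sum_cong[of n x x'] by (simp add: particle_sum_def)

lemma space_PiM_fun_upd:
  assumes "z \<in> space (PiM {..n} (\<lambda>_. E))" "y \<in> space E"
  shows "z(Suc n := y) \<in> space (PiM {..Suc n} (\<lambda>_. E))"
  using assms by (auto simp: space_PiM PiE_iff extensional_def)

lemma measurable_path_fun_upd:
  assumes "f \<in> A \<rightarrow>\<^sub>M PiM {..n} (\<lambda>_. E)" "h \<in> A \<rightarrow>\<^sub>M E"
  shows "(\<lambda>a. (f a)(Suc n := h a)) \<in> A \<rightarrow>\<^sub>M PiM {..Suc n} (\<lambda>_. E)"
  using assms by (intro measurable_fun_upd[where J = "{..n}"]) auto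

section \<open>Backward kernels and backward paths\<close>

locale fk_model =
  fixes E lam :: "'a measure" and G :: "'a \<Rightarrow> real" and H :: "'a \<Rightarrow> 'a \<Rightarrow> real"
    and M :: "'a \<Rightarrow> 'a measure"
  assumes G_meas[measurable]: "G \<in> borel_measurable E"
    and G_range: "\<And>x. x \<in> space E \<Longrightarrow> 0 < G x \<and> G x \<le> 1"
    and sets_lam[measurable_cong]: "sets lam = sets E"
    and H_meas[measurable]: "(\<lambda>(x, y). H x y) \<in> borel_measurable (E \<Otimes>\<^sub>M E)"
    and H_pos: "\<And>x y. x \<in> space E \<Longrightarrow> y \<in> space E \<Longrightarrow> 0 < H x y"
    and M: "M \<in> E \<rightarrow>\<^sub>M prob_algebra E"
    and M_density: "\<And>x. x \<in> space E \<Longrightarrow> M x = density lam (\<lambda>y. ennreal (H x y))"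
begin

lemma M_simps:
  assumes "x \<in> space E"
  shows "prob_space (M x)" "sets (M x) = sets E" "space (M x) = space E"
  using prob_algebra_kernelD[OF M assms] .

lemma integral_M:
  fixes f :: "'a \<Rightarrow> real"
  assumes x: "x \<in> space E" and [measurable]: "f \<in> borel_measurable E"
  shows "(\<integral>y. f y \<partial>M x) = (\<integral>y. H x y * f y \<partial>lam)"
  using H_pos[OF x] x sets_eq_imp_space_eq[OF sets_lam] unfolding M_density[OF x]
  by (subst integral_density) (auto intro!: AE_I2 less_imp_le)

lemma integrable_H_mult:
  fixes f :: "'a \<Rightarrow> real"
  assumes x: "x \<in> space E" and [measurable]: "f \<in> borel_measurable E"
    and "\<And>y. y \<in> space E \<Longrightarrow> \<bar>f y\<bar> \<le> C"
  shows "integrable lam (\<lambda>y. H x y * f y)"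
proof -
  have "integrable (M x) f"
    using M_simps[OF x] assms(3) by (intro integrable_prob_bounded[where C = C]) (auto cong: measurable_cong_sets)
  then show ?thesis
    using H_pos[OF x] x sets_eq_imp_space_eq[OF sets_lam] unfolding M_density[OF x]
    by (subst (asm) integrable_density) (auto intro!: AE_I2 less_imp_le)
qed

lemma integral_M_measurable[measurable (raw)]:
  assumes "f \<in> A \<rightarrow>\<^sub>M E" "(\<lambda>(x, y). g x y) \<in> borel_measurable (A \<Otimes>\<^sub>M E)"
  shows "(\<lambda>x. \<integral>y. (g x y :: real) \<partial>M (f x)) \<in> borel_measurable A"
  by (rule integral_kernel_measurable[OF assms(2) measurable_compose[OF assms(1) M]])

lemma abs_integral_M_le:
  fixes f :: "'a \<Rightarrow> real"
  assumes "x \<in> space E" "f \<in> borel_measurable E" "\<And>y. y \<in> space E \<Longrightarrow> \<bar>f y\<bar> \<le> C"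
  shows "\<bar>\<integral>y. f y \<partial>M x\<bar> \<le> C"
  using M_simps[OF assms(1)] assms(2,3)
  by (intro abs_integral_prob_le) (auto cong: measurable_cong_sets)

lemma sum_G_pos:
  fixes N :: nat
  assumes "0 < N" "\<And>j. j < N \<Longrightarrow> x j \<in> space E"
  shows "0 < (\<Sum>j<N. G (x j))"
  using assms G_range by (intro sum_pos) (auto simp: lessThan_empty_iff)

lemma sum_GH_pos:
  fixes N :: nat
  assumes "0 < N" "\<And>j. j < N \<Longrightarrow> x j \<in> space E" "y \<in> space E"
  shows "0 < (\<Sum>j<N. G (x j) * H (x j) y)"
  using assms G_range H_pos by (intro sum_pos mult_pos_pos) (auto simp: lessThan_empty_iff)

lemma
  assumes N: "0 < N" and x: "\<And>j. j < N \<Longrightarrow> x j \<in> space E" and y: "y \<in> space E"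
  shows backward_kernel_in_prob_algebra:
      "backward_kernel G H (empirical E N x) y \<in> space (prob_algebra E)"
    and integral_backward_kernel: "f \<in> borel_measurable E \<Longrightarrow>
      (\<integral>z. f z \<partial>backward_kernel G H (empirical E N x) y) =
      (\<Sum>j<N. G (x j) * H (x j) y * f (x j)) / (\<Sum>j<N. G (x j) * H (x j) y)"
proof -
  let ?c = "(\<Sum>j<N. G (x j) * H (x j) y) / N"
  have c: "0 < ?c" using sum_GH_pos[OF N x y] N by simp
  have [measurable]: "(\<lambda>z. H z y) \<in> borel_measurable E" using y by measurable
  have GH: "0 \<le> G z * H z y" if "z \<in> space E" for z
    using that G_range H_pos[OF that y] by (simp add: less_imp_le)
  have sets_emp[measurable_cong]: "sets (empirical E N x) = sets E" by (simp add: empirical_def)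
  have space_emp[simp]: "space (empirical E N x) = space E" by (simp add: empirical_def)
  \<comment> \<open>The definition divides extended nonnegative numbers; positivity of
    \<open>?c\<close> turns this into a real quotient.\<close>
  have eq: "backward_kernel G H (empirical E N x) y
      = density (empirical E N x) (\<lambda>z. ennreal (G z * H z y / ?c))"
    unfolding backward_kernel_def using c GH
    by (intro density_cong) (auto intro!: AE_I2 simp: nn_integral_empirical[OF x] divide_ennreal)
  have GH_meas: "(\<lambda>z. G z * H z y) \<in> borel_measurable E" by measurable
  have S: "0 < (\<Sum>j<N. G (x j) * H (x j) y)" by (rule sum_GH_pos[OF N x y])
  show "backward_kernel G H (empirical E N x) y \<in> space (prob_algebra E)"
    unfolding eq by (rule density_empirical_in_prob_algebra[OF N _ GH_meas _ S]; fact)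
  show "(\<integral>z. f z \<partial>backward_kernel G H (empirical E N x) y) =
      (\<Sum>j<N. G (x j) * H (x j) y * f (x j)) / (\<Sum>j<N. G (x j) * H (x j) y)"
    if "f \<in> borel_measurable E" unfolding eq by (rule integral_density_empirical[OF N _ GH_meas _ S that]; fact)
qed

lemma measurable_backward_kernel:
  assumes N: "0 < N" and x: "\<And>j. j < N \<Longrightarrow> x j \<in> space E"
  shows "backward_kernel G H (empirical E N x) \<in> E \<rightarrow>\<^sub>M prob_algebra E"
proof (rule measurable_prob_algebra_integral)
  fix B assume [measurable]: "B \<in> sets E"
  have [measurable]: "(\<lambda>y. H (x j) y) \<in> borel_measurable E" if "j < N" for j using x[OF that] by measurable
  show "(\<lambda>y. \<integral>z. indicator B z \<partial>backward_kernel G H (empirical E N x) y :: real) \<in> borel_measurable E"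
    by (subst measurable_cong[OF integral_backward_kernel[OF N x]]) auto
qed (rule backward_kernel_in_prob_algebra[OF N x])

lemma measurable_backward_path:
  assumes N: "0 < N" and x: "\<And>p j. p < n \<Longrightarrow> j < N \<Longrightarrow> x p j \<in> space E"
  shows "backward_path E G H (\<lambda>p. empirical E N (x p)) n \<in> E \<rightarrow>\<^sub>M prob_algebra (PiM {..n} (\<lambda>_. E))"
  using x
proof (induction n)
  case 0
  have "(\<lambda>y. return (PiM {..0} (\<lambda>_. E)) (\<lambda>i\<in>{..0}. y)) \<in> E \<rightarrow>\<^sub>M prob_algebra (PiM {..0::nat} (\<lambda>_. E))"
    by (rule measurable_compose[OF _ measurable_return_prob_space]) measurable
  then show ?case by simp
next
  case (Suc n)
  then have IH: "backward_path E G H (\<lambda>p. empirical E N (x p)) n \<in> E \<rightarrow>\<^sub>M prob_algebra (PiM {..n} (\<lambda>_. E))"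
    by simp
  have "(\<lambda>y. backward_kernel G H (empirical E N (x n)) y \<bind> (\<lambda>u.
      distr (backward_path E G H (\<lambda>p. empirical E N (x p)) n u) (PiM {..Suc n} (\<lambda>_. E)) (\<lambda>z. z(Suc n := y))))
    \<in> E \<rightarrow>\<^sub>M prob_algebra (PiM {..Suc n} (\<lambda>_. E))"
  proof (rule measurable_bind_prob_space2[OF measurable_backward_kernel[OF N]])
    show "x n j \<in> space E" if "j < N" for j using Suc.prems that by simp
    have "(\<lambda>w. distr (backward_path E G H (\<lambda>p. empirical E N (x p)) n (snd w)) (PiM {..Suc n} (\<lambda>_. E))
        (\<lambda>z. z(Suc n := fst w))) \<in> E \<Otimes>\<^sub>M E \<rightarrow>\<^sub>M prob_algebra (PiM {..Suc n} (\<lambda>_. E))"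
      unfolding split_beta
      by (rule measurable_distr_prob_space2[OF measurable_compose[OF measurable_snd IH]],
          unfold split_beta, rule measurable_path_fun_upd) measurable
    then show "(\<lambda>(y, u). distr (backward_path E G H (\<lambda>p. empirical E N (x p)) n u) (PiM {..Suc n} (\<lambda>_. E))
        (\<lambda>z. z(Suc n := y))) \<in> E \<Otimes>\<^sub>M E \<rightarrow>\<^sub>M prob_algebra (PiM {..Suc n} (\<lambda>_. E))"
      by (simp add: split_beta)
  qed
  then show ?case by simp
qed

text \<open>One parameter \<open>a\<close> drives the array, the test function and the end point
  together. The recursion inserts \<open>y a\<close> into \<open>F\<close>, so \<open>F\<close> must
  be allowed to depend on \<open>a\<close>. Later uses let the array be random, the end point vary,
  or an integration variable enter through \<open>F\<close>.\<close>

lemma backward_sum_measurable: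
  assumes "\<And>p j. p < n \<Longrightarrow> j < N \<Longrightarrow> (\<lambda>a. x a p j) \<in> A \<rightarrow>\<^sub>M E" "y \<in> A \<rightarrow>\<^sub>M E"
    and "(\<lambda>(a, z). F a z) \<in> borel_measurable (A \<Otimes>\<^sub>M PiM {..n} (\<lambda>_. E))"
  shows "(\<lambda>a. backward_sum G H N (x a) n (F a) (y a)) \<in> borel_measurable A"
  using assms
proof (induction n arbitrary: F y)
  case 0
  note [measurable] = 0(2)
  have "(\<lambda>a. (a, \<lambda>i\<in>{..0}. y a)) \<in> A \<rightarrow>\<^sub>M A \<Otimes>\<^sub>M PiM {..0} (\<lambda>_. E)" by measurable
  from measurable_compose[OF this 0(3)] show ?case by simp
next
  case (Suc n)
  note y[measurable] = Suc.prems(2)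
  have [measurable]: "(\<lambda>a. x a n j) \<in> A \<rightarrow>\<^sub>M E" if "j < N" for j using Suc.prems(1) that by simp
  have "(\<lambda>w. (fst w, (snd w)(Suc n := y (fst w)))) \<in> A \<Otimes>\<^sub>M PiM {..n} (\<lambda>_. E) \<rightarrow>\<^sub>M A \<Otimes>\<^sub>M PiM {..Suc n} (\<lambda>_. E)"
    by (intro measurable_Pair measurable_path_fun_upd) measurable
  from measurable_compose[OF this Suc.prems(3)]
  have "(\<lambda>(a, z). F a (z(Suc n := y a))) \<in> borel_measurable (A \<Otimes>\<^sub>M PiM {..n} (\<lambda>_. E))"
    by (simp add: split_beta)
  then have [measurable]:
    "(\<lambda>a. backward_sum G H N (x a) n (\<lambda>z. F a (z(Suc n := y a))) (x a n j)) \<in> borel_measurable A" if "j < N" for j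
    using Suc.prems(1) that by (intro Suc.IH) (auto simp del: fun_upd_apply simp: fun_upd_def)
  have [measurable]: "(\<lambda>a. H (x a n j) (y a)) \<in> borel_measurable A" if "j < N" for j
    using measurable_compose[OF measurable_Pair[of "\<lambda>a. x a n j" A E y E] H_meas] that by simp
  show ?case by simp
qed

lemma abs_weighted_average_le:
  fixes w f :: "nat \<Rightarrow> real"
  assumes "0 < (\<Sum>j<N. w j)" "\<And>j. j < N \<Longrightarrow> 0 \<le> w j" "\<And>j. j < N \<Longrightarrow> \<bar>f j\<bar> \<le> c"
  shows "\<bar>(\<Sum>j<N. w j * f j) / (\<Sum>j<N. w j)\<bar> \<le> c"
proof -
  have "\<bar>\<Sum>j<N. w j * f j\<bar> \<le> (\<Sum>j<N. \<bar>w j * f j\<bar>)" by (rule sum_abs)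
  also have "\<dots> \<le> (\<Sum>j<N. w j * c)"
    using assms(2,3) by (intro sum_mono) (auto simp: abs_mult intro: mult_left_mono)
  also have "\<dots> = (\<Sum>j<N. w j) * c" by (simp add: sum_distrib_right)
  finally show ?thesis using assms(1) by (simp add: divide_le_eq abs_divide mult.commute)
qed

text \<open>Backward averaging leaves the end point untouched, so a bound that depends only on the
  end point passes through the average.\<close>

lemma backward_sum_abs_le:
  assumes "0 < N" "\<And>p j. p < n \<Longrightarrow> j < N \<Longrightarrow> x p j \<in> space E" "y \<in> space E"
    and "\<And>z. z \<in> space (PiM {..n} (\<lambda>_. E)) \<Longrightarrow> \<bar>F z\<bar> \<le> f (z n)"
  shows "\<bar>backward_sum G H N x n F y\<bar> \<le> f y"
  using assms(2-)
proof (induction n arbitrary: F y f)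
  case 0
  have "(\<lambda>i\<in>{..0}. y) \<in> space (PiM {..0::nat} (\<lambda>_. E))" using 0(2) by (auto simp: space_PiM)
  from 0(3)[OF this] show ?case by (simp only: backward_sum.simps restrict_apply' atMost_iff le_refl)
next
  case (Suc n)
  have x: "x n j \<in> space E" if "j < N" for j using Suc.prems(1) that by simp
  \<comment> \<open>Once the end point is frozen at \<open>y\<close>, the bound no longer depends on
    the shorter path: the induction hypothesis is used with the constant function with value
    \<open>f y\<close>.\<close>
  have "\<bar>backward_sum G H N x n (\<lambda>z. F (z(Suc n := y))) (x n j)\<bar> \<le> f y" if "j < N" for j
  proof (rule Suc.IH)
    show "\<bar>F (z(Suc n := y))\<bar> \<le> f y" if "z \<in> space (PiM {..n} (\<lambda>_. E))" for z
      using Suc.prems(3)[OF space_PiM_fun_upd[OF that Suc.prems(2)]] by (simp only: fun_upd_same)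
  qed (use Suc.prems x that in auto)
  then show ?case
    using sum_GH_pos[OF assms(1) x Suc.prems(2)] G_range[OF x] H_pos[OF x Suc.prems(2)]
    unfolding backward_sum.simps by (intro abs_weighted_average_le) (auto intro: less_imp_le)
qed

text \<open>The end point is fixed throughout the averaging. In the step \<open>g\<close> becomes
  the constant \<open>g y\<close>, which is the reason for generalising over
  \<open>g\<close>.\<close>

lemma backward_sum_mult_last:
  "backward_sum G H N x n (\<lambda>z. g (z n) * F z) y = g y * backward_sum G H N x n F y"
proof (induction n arbitrary: F y g)
  case (Suc n)
  have "backward_sum G H N x n (\<lambda>z. g y * F (z(Suc n := y))) (x n j)
      = g y * backward_sum G H N x n (\<lambda>z. F (z(Suc n := y))) (x n j)" for j
    by (rule Suc.IH)
  then show ?case by (simp add: sum_distrib_left mult_ac)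
qed simp

lemma backward_sum_one:
  assumes "0 < N" "\<And>p j. p < n \<Longrightarrow> j < N \<Longrightarrow> x p j \<in> space E" "y \<in> space E"
  shows "backward_sum G H N x n (\<lambda>z. 1) y = 1"
  using assms(2-)
proof (induction n arbitrary: y)
  case (Suc n)
  have x: "x n j \<in> space E" if "j < N" for j using Suc.prems(1) that by simp
  have "backward_sum G H N x n (\<lambda>z. 1) (x n j) = 1" if "j < N" for j
    by (rule Suc.IH) (use Suc.prems x that in auto)
  moreover have "0 < (\<Sum>j<N. G (x n j) * H (x n j) y)"
    by (rule sum_GH_pos[OF assms(1) x Suc.prems(2)])
  ultimately show ?case by simp
qed simp

lemma backward_sum_last:
  assumes "0 < N" "\<And>p j. p < n \<Longrightarrow> j < N \<Longrightarrow> x p j \<in> space E" "y \<in> space E"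
  shows "backward_sum G H N x n (\<lambda>z. g (z n)) y = g y"
  using backward_sum_mult_last[of N x n g "\<lambda>z. 1" y] backward_sum_one[OF assms] by simp

text \<open>Used with \<open>\<mu>\<close> a transition \<open>M (x n j)\<close>: averaging over a
  new state commutes with averaging over the ancestors of its parent.\<close>

lemma integral_backward_sum:
  assumes N: "0 < N" and "\<And>p j. p < n \<Longrightarrow> j < N \<Longrightarrow> x p j \<in> space E" "y \<in> space E"
    and \<mu>: "prob_space \<mu>"
    and "(\<lambda>(a, z). F a z) \<in> borel_measurable (\<mu> \<Otimes>\<^sub>M PiM {..n} (\<lambda>_. E))"
    and "\<And>a z. a \<in> space \<mu> \<Longrightarrow> z \<in> space (PiM {..n} (\<lambda>_. E)) \<Longrightarrow> \<bar>F a z\<bar> \<le> C"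
  shows "(\<integral>a. backward_sum G H N x n (F a) y \<partial>\<mu>) = backward_sum G H N x n (\<lambda>z. \<integral>a. F a z \<partial>\<mu>) y"
  using assms(2,3,5,6)
proof (induction n arbitrary: F y)
  case (Suc n)
  note y[measurable] = Suc.prems(2)
  have x: "x n j \<in> space E" if "j < N" for j using Suc.prems(1) that by simp
  have "(\<lambda>w. (fst w, (snd w)(Suc n := y))) \<in> \<mu> \<Otimes>\<^sub>M PiM {..n} (\<lambda>_. E) \<rightarrow>\<^sub>M \<mu> \<Otimes>\<^sub>M PiM {..Suc n} (\<lambda>_. E)"
    using y by (intro measurable_Pair measurable_path_fun_upd) measurable
  from measurable_compose[OF this Suc.prems(3)]
  have F': "(\<lambda>(a, z). F a (z(Suc n := y))) \<in> borel_measurable (\<mu> \<Otimes>\<^sub>M PiM {..n} (\<lambda>_. E))"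
    by (simp add: split_beta)
  have bound: "\<bar>F a (z(Suc n := y))\<bar> \<le> C" if "a \<in> space \<mu>" "z \<in> space (PiM {..n} (\<lambda>_. E))" for a z
    by (rule Suc.prems(4)[OF that(1) space_PiM_fun_upd[OF that(2) y]])
  have int: "integrable \<mu> (\<lambda>a. backward_sum G H N x n (\<lambda>z. F a (z(Suc n := y))) (x n j))" if "j < N" for j
  proof (rule integrable_prob_bounded[OF \<mu>, where C = C])
    show "(\<lambda>a. backward_sum G H N x n (\<lambda>z. F a (z(Suc n := y))) (x n j)) \<in> borel_measurable \<mu>"
      by (rule backward_sum_measurable[where x = "\<lambda>_. x" and y = "\<lambda>_. x n j", OF _ _ F'])
        (use Suc.prems(1) x that in auto)
    show "\<bar>backward_sum G H N x n (\<lambda>z. F a (z(Suc n := y))) (x n j)\<bar> \<le> C" if "a \<in> space \<mu>" for a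
      using Suc.prems(1) x[OF \<open>j < N\<close>] bound[OF that] by (intro backward_sum_abs_le[OF N]) auto
  qed
  have IH: "(\<integral>a. backward_sum G H N x n (\<lambda>z. F a (z(Suc n := y))) (x n j) \<partial>\<mu>)
      = backward_sum G H N x n (\<lambda>z. \<integral>a. F a (z(Suc n := y)) \<partial>\<mu>) (x n j)" if "j < N" for j
    using Suc.prems(1) x[OF that] bound[unfolded fun_upd_def] F'[unfolded fun_upd_def]
    unfolding fun_upd_def by (intro Suc.IH) auto
  show ?case
    unfolding backward_sum.simps using int by (simp add: IH)
qed simp

text \<open>The bridge from the measures of the model to finite sums; the \<open>bind\<close> in the
  recursion of \<open>backward_path\<close> becomes the weighted average of
  \<open>backward_sum\<close>.\<close>

lemma integral_backward_path:
  assumes N: "0 < N" and "\<And>p j. p < n \<Longrightarrow> j < N \<Longrightarrow> x p j \<in> space E" "y \<in> space E"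
    and "F \<in> borel_measurable (PiM {..n} (\<lambda>_. E))"
    and "\<And>z. z \<in> space (PiM {..n} (\<lambda>_. E)) \<Longrightarrow> \<bar>F z\<bar> \<le> C"
  shows "(\<integral>z. F z \<partial>backward_path E G H (\<lambda>p. empirical E N (x p)) n y) = backward_sum G H N x n F y"
  using assms(2-)
proof (induction n arbitrary: F y)
  case 0
  have "(\<lambda>i\<in>{..0}. y) \<in> space (PiM {..0::nat} (\<lambda>_. E))" using 0(2) by (auto simp: space_PiM)
  then show ?case using 0(3) by (simp add: integral_return)
next
  case (Suc n)
  note y = Suc.prems(2) and F[measurable] = Suc.prems(3)
  have x: "x n j \<in> space E" if "j < N" for j using Suc.prems(1) that by simp
  let ?P = "\<lambda>n. PiM {..n::nat} (\<lambda>_. E)" and ?B = "backward_path E G H (\<lambda>p. empirical E N (x p)) n"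
  let ?K = "backward_kernel G H (empirical E N (x n)) y"
  have B: "?B \<in> E \<rightarrow>\<^sub>M prob_algebra (?P n)"
    using Suc.prems(1) by (intro measurable_backward_path[OF N]) auto
  have K: "?K \<in> space (prob_algebra E)" by (rule backward_kernel_in_prob_algebra[OF N x y])
  then have [measurable_cong]: "sets ?K = sets E" and "prob_space ?K" and [simp]: "space ?K = space E"
    using sets_eq_imp_space_eq by (auto simp: space_prob_algebra)
  have upd[measurable]: "(\<lambda>z. z(Suc n := y)) \<in> ?P n \<rightarrow>\<^sub>M ?P (Suc n)"
    using y by (intro measurable_path_fun_upd) auto
  have L: "(\<lambda>u. distr (?B u) (?P (Suc n)) (\<lambda>z. z(Suc n := y))) \<in> ?K \<rightarrow>\<^sub>M prob_algebra (?P (Suc n))"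
    using measurable_compose[OF B measurable_distr_prob_space[OF upd]] by simp
  have F': "(\<lambda>z. F (z(Suc n := y))) \<in> borel_measurable (?P n)" by measurable
  have bound: "\<bar>F (z(Suc n := y))\<bar> \<le> C" if "z \<in> space (?P n)" for z
    by (rule Suc.prems(4)[OF space_PiM_fun_upd[OF that y]])
  have F'': "(\<lambda>u. backward_sum G H N x n (\<lambda>z. F (z(Suc n := y))) u) \<in> borel_measurable E"
    by (rule backward_sum_measurable[where x = "\<lambda>_. x" and F = "\<lambda>_ z. F (z(Suc n := y))"])
      (use Suc.prems(1) in auto)
  have "(\<integral>z. F z \<partial>backward_path E G H (\<lambda>p. empirical E N (x p)) (Suc n) y)
      = (\<integral>u. \<integral>z. F z \<partial>distr (?B u) (?P (Suc n)) (\<lambda>z. z(Suc n := y)) \<partial>?K)"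
    using Suc.prems(4) by (simp add: integral_bind_prob[OF \<open>prob_space ?K\<close> L F, where C = C])
  also have "\<dots> = (\<integral>u. backward_sum G H N x n (\<lambda>z. F (z(Suc n := y))) u \<partial>?K)"
  proof (rule Bochner_Integration.integral_cong[OF refl])
    fix u assume "u \<in> space ?K"
    then have u: "u \<in> space E" by simp
    have "(\<integral>z. F z \<partial>distr (?B u) (?P (Suc n)) (\<lambda>z. z(Suc n := y))) = (\<integral>z. F (z(Suc n := y)) \<partial>?B u)"
      using upd F prob_algebra_kernelD(2)[OF B u] by (intro integral_distr) (auto cong: measurable_cong_sets)
    also have "\<dots> = backward_sum G H N x n (\<lambda>z. F (z(Suc n := y))) u"
      using Suc.prems(1) u F'[unfolded fun_upd_def] bound[unfolded fun_upd_def]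
      unfolding fun_upd_def by (intro Suc.IH) auto
    finally show "(\<integral>z. F z \<partial>distr (?B u) (?P (Suc n)) (\<lambda>z. z(Suc n := y)))
      = backward_sum G H N x n (\<lambda>z. F (z(Suc n := y))) u" .
  qed
  also have "\<dots> = backward_sum G H N x (Suc n) F y"
    using F'' by (subst integral_backward_kernel[OF N x y]) auto
  finally show ?case .
qed

end

text \<open>In both clauses of the recursion \<open>F\<close> is evaluated only at paths that end in
  \<open>y\<close>, so a case distinction is enough. It allows a point of the array to be exchanged
  for the end point \<open>z n\<close> inside a test function.\<close>

lemma backward_sum_cong_last:
  assumes "\<And>z. z n = y \<Longrightarrow> F z = F' z"
  shows "backward_sum G H N x n F y = backward_sum G H N x n F' y"
  by (cases n) (simp_all add: assms)

context fk_model
begin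

lemma
  assumes N: "0 < N" and x: "\<And>j. j < N \<Longrightarrow> x j \<in> space E"
  shows fk_map_in_prob_algebra: "fk_map G M (empirical E N x) \<in> space (prob_algebra E)"
    and integral_fk_map: "f \<in> borel_measurable E \<Longrightarrow> (\<And>z. z \<in> space E \<Longrightarrow> \<bar>f z\<bar> \<le> C) \<Longrightarrow>
      (\<integral>z. f z \<partial>fk_map G M (empirical E N x)) =
      (\<Sum>j<N. G (x j) * (\<integral>z. f z \<partial>M (x j))) / (\<Sum>j<N. G (x j))"
proof -
  have G: "0 \<le> G z" if "z \<in> space E" for z using G_range[OF that] by simp
  have eq: "boltzmann_gibbs G (empirical E N x)
      = density (empirical E N x) (\<lambda>z. ennreal (G z / ((\<Sum>j<N. G (x j)) / N)))"
    by (simp add: boltzmann_gibbs_def integral_empirical[OF x])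
  have S: "0 < (\<Sum>j<N. G (x j))" by (rule sum_G_pos[OF N x])
  have bg: "boltzmann_gibbs G (empirical E N x) \<in> space (prob_algebra E)"
    unfolding eq by (rule density_empirical_in_prob_algebra[OF N _ G_meas _ S]; fact)
  show "fk_map G M (empirical E N x) \<in> space (prob_algebra E)"
    using prob_space_bind'[OF bg M] sets_bind'[OF bg M] by (simp add: fk_map_def space_prob_algebra)
  assume f[measurable]: "f \<in> borel_measurable E" and bound: "\<And>z. z \<in> space E \<Longrightarrow> \<bar>f z\<bar> \<le> C"
  have "prob_space (boltzmann_gibbs G (empirical E N x))"
    and "M \<in> boltzmann_gibbs G (empirical E N x) \<rightarrow>\<^sub>M prob_algebra E"
    using bg M by (auto simp: space_prob_algebra cong: measurable_cong_sets)
  from integral_bind_prob[OF this f bound]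
  have "(\<integral>z. f z \<partial>fk_map G M (empirical E N x)) = (\<integral>u. \<integral>z. f z \<partial>M u \<partial>boltzmann_gibbs G (empirical E N x))"
    by (simp add: fk_map_def)
  also have "\<dots> = (\<Sum>j<N. G (x j) * (\<integral>z. f z \<partial>M (x j))) / (\<Sum>j<N. G (x j))"
  proof -
    have Mf: "(\<lambda>u. \<integral>z. f z \<partial>M u) \<in> borel_measurable E" by measurable
    show ?thesis unfolding eq by (rule integral_density_empirical[OF N _ G_meas _ S Mf]; fact)
  qed
  finally show "(\<integral>z. f z \<partial>fk_map G M (empirical E N x)) =
      (\<Sum>j<N. G (x j) * (\<integral>z. f z \<partial>M (x j))) / (\<Sum>j<N. G (x j))" .
qed

lemma integral_particle_path_measure:
  assumes N: "0 < N" and x: "\<And>p j. p \<le> n \<Longrightarrow> j < N \<Longrightarrow> x p j \<in> space E"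
    and F: "F \<in> borel_measurable (PiM {..n} (\<lambda>_. E))"
    and bound: "\<And>z. z \<in> space (PiM {..n} (\<lambda>_. E)) \<Longrightarrow> \<bar>F z\<bar> \<le> C"
  shows "(\<integral>z. F z \<partial>particle_path_measure E G H N x n) = (\<Sum>j<N. backward_sum G H N x n F (x n j)) / N"
proof -
  let ?B = "backward_path E G H (\<lambda>p. empirical E N (x p)) n"
  have B: "?B \<in> E \<rightarrow>\<^sub>M prob_algebra (PiM {..n} (\<lambda>_. E))"
    using x by (intro measurable_backward_path[OF N]) auto
  have emp: "empirical E N (x n) \<in> space (prob_algebra E)"
    using x by (intro empirical_in_prob_algebra[OF N]) auto
  then have "prob_space (empirical E N (x n))"
    and "?B \<in> empirical E N (x n) \<rightarrow>\<^sub>M prob_algebra (PiM {..n} (\<lambda>_. E))"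
    using B by (auto simp: space_prob_algebra cong: measurable_cong_sets)
  from integral_bind_prob[OF this F bound]
  have "(\<integral>z. F z \<partial>particle_path_measure E G H N x n) = (\<integral>u. \<integral>z. F z \<partial>?B u \<partial>empirical E N (x n))"
    by (simp add: particle_path_measure_def)
  also have "\<dots> = (\<integral>u. backward_sum G H N x n F u \<partial>empirical E N (x n))"
    using x by (intro Bochner_Integration.integral_cong integral_backward_path[OF N _ _ F bound])
      (auto simp: empirical_def)
  also have "\<dots> = (\<Sum>j<N. backward_sum G H N x n F (x n j)) / N"
  proof (rule integral_empirical)
    show "backward_sum G H N x n F \<in> borel_measurable E"
      by (rule backward_sum_measurable[where x = "\<lambda>_. x" and F = "\<lambda>_. F"]) (use F x in auto)
  qed (use x in auto)
  finally show ?thesis .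
qed

lemma particle_gamma_eq:
  assumes "\<And>p j. p < n \<Longrightarrow> j < N \<Longrightarrow> x p j \<in> space E"
  shows "particle_gamma E G N x n = (\<Prod>p<n. (\<Sum>j<N. G (x p j)) / N)"
  unfolding particle_gamma_def using assms by (intro prod.cong refl integral_empirical) auto

section \<open>The one-step Feynman-Kac operator and the weights\<close>

text \<open>The potential is evaluated at the old end point, in accordance with the product over
  \<open>p < n\<close>, which leaves out the terminal time.\<close>

definition fk_step :: "nat \<Rightarrow> ((nat \<Rightarrow> 'a) \<Rightarrow> real) \<Rightarrow> (nat \<Rightarrow> 'a) \<Rightarrow> real" where
  "fk_step n F z = G (z n) * (\<integral>y. F (z(Suc n := y)) \<partial>M (z n))"

primrec fk_weight :: "nat \<Rightarrow> 'a \<Rightarrow> real" where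
  "fk_weight 0 x = 1"
| "fk_weight (Suc k) x = G x * (\<integral>y. fk_weight k y \<partial>M x)"

lemma fk_step_measurable:
  assumes "F \<in> borel_measurable (PiM {..Suc n} (\<lambda>_. E))"
  shows "fk_step n F \<in> borel_measurable (PiM {..n} (\<lambda>_. E))"
proof -
  have "(\<lambda>w. (fst w)(Suc n := snd w)) \<in> PiM {..n} (\<lambda>_. E) \<Otimes>\<^sub>M E \<rightarrow>\<^sub>M PiM {..Suc n} (\<lambda>_. E)"
    by (intro measurable_path_fun_upd) measurable
  from measurable_compose[OF this assms]
  have [measurable]: "(\<lambda>(z, y). F (z(Suc n := y))) \<in> borel_measurable (PiM {..n} (\<lambda>_. E) \<Otimes>\<^sub>M E)"
    by (simp add: split_beta)
  show ?thesis unfolding fk_step_def by measurable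
qed

lemma fk_weight_measurable[measurable]: "fk_weight k \<in> borel_measurable E"
  by (induction k) simp_all

lemma fk_weight_bounds:
  assumes "x \<in> space E"
  shows "0 \<le> fk_weight k x" "fk_weight k x \<le> 1"
proof -
  have "0 \<le> fk_weight k x \<and> fk_weight k x \<le> 1"
    using assms
  proof (induction k arbitrary: x)
    case (Suc k)
    have "\<bar>\<integral>y. fk_weight k y \<partial>M x\<bar> \<le> 1"
      using Suc by (intro abs_integral_M_le) auto
    moreover have "0 \<le> (\<integral>y. fk_weight k y \<partial>M x)"
      using Suc M_simps[OF Suc.prems] by (intro integral_nonneg_AE AE_I2) auto
    ultimately show ?case using G_range[OF Suc.prems] by (auto intro!: mult_le_one)
  qed simp
  then show "0 \<le> fk_weight k x" "fk_weight k x \<le> 1" by auto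
qed

text \<open>The domination reproduces itself: one step back in time raises \<open>k\<close> by one.
  This is what makes it a usable induction hypothesis.\<close>

lemma fk_step_abs_le_weight:
  assumes F[measurable]: "F \<in> borel_measurable (PiM {..Suc n} (\<lambda>_. E))"
    and bound: "\<And>z. z \<in> space (PiM {..Suc n} (\<lambda>_. E)) \<Longrightarrow> \<bar>F z\<bar> \<le> fk_weight k (z (Suc n))"
    and z: "z \<in> space (PiM {..n} (\<lambda>_. E))"
  shows "\<bar>fk_step n F z\<bar> \<le> fk_weight (Suc k) (z n)"
proof -
  have zn: "z n \<in> space E" using z by (auto simp: space_PiM)
  note M' = M_simps[OF zn]
  have [measurable]: "(\<lambda>y. F (z(Suc n := y))) \<in> borel_measurable E"
    by (rule measurable_compose[OF measurable_path_fun_upd F]) (use z in auto)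
  have le: "\<bar>F (z(Suc n := y))\<bar> \<le> fk_weight k y" if "y \<in> space E" for y
    using bound[OF space_PiM_fun_upd[OF z that]] by (simp only: fun_upd_same)
  have le1: "\<bar>F (z(Suc n := y))\<bar> \<le> 1" if "y \<in> space E" for y
    using le[OF that] fk_weight_bounds(2)[OF that, of k] by linarith
  have "\<bar>\<integral>y. F (z(Suc n := y)) \<partial>M (z n)\<bar> \<le> (\<integral>y. \<bar>F (z(Suc n := y))\<bar> \<partial>M (z n))"
    by (rule integral_abs_bound)
  also have "\<dots> \<le> (\<integral>y. fk_weight k y \<partial>M (z n))"
    using M' le le1 fk_weight_bounds
    by (intro integral_mono integrable_prob_bounded[OF M'(1), where C = 1]) (auto cong: measurable_cong_sets)
  finally show ?thesis
    using G_range[OF zn] by (simp add: fk_step_def abs_mult mult_left_mono)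
qed

end

section \<open>One transition of the particle system\<close>

locale fk_particle_model = fk_model +
  fixes \<epsilon> :: "nat \<Rightarrow> real" and N :: nat
  assumes N_pos: "0 < N"
    and \<epsilon>_nonneg: "\<And>k. 0 \<le> \<epsilon> k"
    and \<epsilon>_le: "\<And>k x. x \<in> space E \<Longrightarrow> \<epsilon> k * G x \<le> 1"
begin

lemma
  assumes x: "\<And>j. j < N \<Longrightarrow> x j \<in> space E" and i: "i < N"
  shows particle_kernel_in_prob_algebra:
      "particle_kernel G M (\<epsilon> n) (empirical E N x) (x i) \<in> space (prob_algebra E)"
    and integral_particle_kernel: "f \<in> borel_measurable E \<Longrightarrow> (\<And>z. z \<in> space E \<Longrightarrow> \<bar>f z\<bar> \<le> C) \<Longrightarrow>
      (\<integral>z. f z \<partial>particle_kernel G M (\<epsilon> n) (empirical E N x) (x i)) =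
      \<epsilon> n * G (x i) * (\<integral>z. f z \<partial>M (x i)) +
      (1 - \<epsilon> n * G (x i)) * ((\<Sum>j<N. G (x j) * (\<integral>z. f z \<partial>M (x j))) / (\<Sum>j<N. G (x j)))"
proof -
  have p: "0 \<le> \<epsilon> n * G (x i)" "\<epsilon> n * G (x i) \<le> 1"
    using \<epsilon>_nonneg \<epsilon>_le G_range x i by (auto simp: less_imp_le)
  have fk: "fk_map G M (empirical E N x) \<in> space (prob_algebra E)"
    by (rule fk_map_in_prob_algebra[OF N_pos x])
  have Mx: "M (x i) \<in> space (prob_algebra E)" by (rule measurable_space[OF M x[OF i]])
  show "particle_kernel G M (\<epsilon> n) (empirical E N x) (x i) \<in> space (prob_algebra E)"
    unfolding particle_kernel_def by (rule mixture_in_prob_algebra[OF p Mx fk])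
  assume f: "f \<in> borel_measurable E" "\<And>z. z \<in> space E \<Longrightarrow> \<bar>f z\<bar> \<le> C"
  have "(\<integral>z. f z \<partial>fk_map G M (empirical E N x)) =
      (\<Sum>j<N. G (x j) * (\<integral>z. f z \<partial>M (x j))) / (\<Sum>j<N. G (x j))"
    by (rule integral_fk_map[OF N_pos]; fact)
  then show "(\<integral>z. f z \<partial>particle_kernel G M (\<epsilon> n) (empirical E N x) (x i)) =
      \<epsilon> n * G (x i) * (\<integral>z. f z \<partial>M (x i)) +
      (1 - \<epsilon> n * G (x i)) * ((\<Sum>j<N. G (x j) * (\<integral>z. f z \<partial>M (x j))) / (\<Sum>j<N. G (x j)))"
    unfolding particle_kernel_def by (subst integral_mixture[OF p Mx fk, where C = C]) (use f in auto)
qed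

lemma measurable_particle_transition:
  "particle_transition E G M \<epsilon> N n \<in> PiM {..<N} (\<lambda>_. E) \<rightarrow>\<^sub>M prob_algebra (PiM {..<N} (\<lambda>_. E))"
proof -
  have sp: "x j \<in> space E" if "x \<in> space (PiM {..<N} (\<lambda>_. E))" "j < N" for x j
    using that by (auto simp: space_PiM)
  have "(\<lambda>x. PiM {..<N} (\<lambda>i. particle_kernel G M (\<epsilon> n) (empirical E N x) (x i)))
    \<in> PiM {..<N} (\<lambda>_. E) \<rightarrow>\<^sub>M prob_algebra (PiM {..<N} (\<lambda>_. E))"
  proof (rule measurable_PiM_prob_algebra)
    fix i assume "i \<in> {..<N}"
    then have i: "i < N" by simp
    show "(\<lambda>x. particle_kernel G M (\<epsilon> n) (empirical E N x) (x i)) \<in> PiM {..<N} (\<lambda>_. E) \<rightarrow>\<^sub>M prob_algebra E"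
    proof (rule measurable_prob_algebra_integral)
      fix B assume [measurable]: "B \<in> sets E"
      have [measurable]: "(\<lambda>x. \<integral>z. indicator B z \<partial>M (x j) :: real) \<in> borel_measurable (PiM {..<N} (\<lambda>_. E))"
        if "j < N" for j
        using that by (intro integral_M_measurable) measurable
      have "(\<lambda>x. \<epsilon> n * G (x i) * (\<integral>z. indicator B z \<partial>M (x i)) + (1 - \<epsilon> n * G (x i)) *
          ((\<Sum>j<N. G (x j) * (\<integral>z. indicator B z \<partial>M (x j))) / (\<Sum>j<N. G (x j))))
          \<in> borel_measurable (PiM {..<N} (\<lambda>_. E))"
        using i by (intro borel_measurable_add borel_measurable_times borel_measurable_diff
          borel_measurable_divide borel_measurable_sum measurable_const) measurable
      then show "(\<lambda>x. \<integral>z. indicator B z \<partial>particle_kernel G M (\<epsilon> n) (empirical E N x) (x i) :: real)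
          \<in> borel_measurable (PiM {..<N} (\<lambda>_. E))"
        by (rule measurable_cong[THEN iffD2, rotated])
          (rule integral_particle_kernel[OF sp i, where C = 1], auto simp: indicator_def)
    qed (rule particle_kernel_in_prob_algebra[OF sp i])
  qed simp
  then show ?thesis by (simp add: particle_transition_def[abs_def])
qed

text \<open>The parameter \<open>\<epsilon> n\<close> disappears on average. Particle
  \<open>i\<close> moves by \<open>M\<close> with weight \<open>\<epsilon> n * G (x i)\<close> and
  is otherwise redrawn with mean \<open>\<Phi> g\<close>. As \<open>\<Phi> g\<close> is the
  \<open>G\<close>-weighted mean of the integrals against \<open>M (x i)\<close>, the first
  contributions add up to \<open>\<epsilon> n\<close> times the sum of \<open>G\<close>, times
  \<open>\<Phi> g\<close>, which is exactly what the redrawn part is short of. The same cancellation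
  for the square of \<open>f\<close> gives the second moment.\<close>

lemma
  fixes f :: "'a \<Rightarrow> real"
  assumes x: "\<And>j. j < N \<Longrightarrow> x j \<in> space E"
    and f: "f \<in> borel_measurable E" "\<And>z. z \<in> space E \<Longrightarrow> \<bar>f z\<bar> \<le> C"
  defines "\<Phi> \<equiv> \<lambda>g. (\<Sum>j<N. G (x j) * (\<integral>z. g z \<partial>M (x j))) / (\<Sum>j<N. G (x j))"
  shows integral_particle_transition:
      "(\<integral>y. (\<Sum>j<N. f (y j)) / N \<partial>particle_transition E G M \<epsilon> N n x) = \<Phi> f"
    and second_moment_particle_transition:
      "(\<integral>y. ((\<Sum>j<N. f (y j)) / N)\<^sup>2 \<partial>particle_transition E G M \<epsilon> N n x)
        \<le> (\<Phi> f)\<^sup>2 + \<Phi> (\<lambda>z. (f z)\<^sup>2) / N"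
proof -
  \<comment> \<open>Indices outside the range are sent to particle 0, because
    \<open>product_prob_space\<close> asks for a probability measure at every index.\<close>
  define K where "K = (\<lambda>i. particle_kernel G M (\<epsilon> n) (empirical E N x) (x (if i < N then i else 0)))"
  have K_alg: "K i \<in> space (prob_algebra E)" for i
    unfolding K_def using N_pos by (intro particle_kernel_in_prob_algebra x) auto
  have K: "prob_space (K i)" and K_sets[measurable_cong]: "sets (K i) = sets E"
    and K_space: "space (K i) = space E" for i
    using K_alg[of i] sets_eq_imp_space_eq by (auto simp: space_prob_algebra)
  have trans_eq: "particle_transition E G M \<epsilon> N n x = PiM {..<N} K"
    unfolding particle_transition_def by (rule PiM_cong) (auto simp: K_def)
  have S: "0 < (\<Sum>j<N. G (x j))" by (rule sum_G_pos[OF N_pos x])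
  have avg: "(\<Sum>i<N. \<integral>z. g z \<partial>K i) = N * \<Phi> g"
    if g: "g \<in> borel_measurable E" "\<And>z. z \<in> space E \<Longrightarrow> \<bar>g z\<bar> \<le> D" for g D
  proof -
    have "(\<Sum>i<N. \<integral>z. g z \<partial>K i)
      = (\<Sum>i<N. \<epsilon> n * (G (x i) * (\<integral>z. g z \<partial>M (x i))) + (1 - \<epsilon> n * G (x i)) * \<Phi> g)"
      using integral_particle_kernel[OF x _ g] by (intro sum.cong) (auto simp: K_def \<Phi>_def mult.assoc)
    also have "\<dots> = \<epsilon> n * (\<Sum>i<N. G (x i) * (\<integral>z. g z \<partial>M (x i))) + (N - \<epsilon> n * (\<Sum>i<N. G (x i))) * \<Phi> g"
      by (simp add: sum.distrib sum_distrib_left[symmetric] sum_distrib_right[symmetric] sum_subtractf)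
    also have "(\<Sum>i<N. G (x i) * (\<integral>z. g z \<partial>M (x i))) = (\<Sum>i<N. G (x i)) * \<Phi> g"
      using S by (simp add: \<Phi>_def)
    finally show ?thesis by (simp add: algebra_simps)
  qed
  have avg1: "(\<Sum>i<N. \<integral>z. f z \<partial>K i) = N * \<Phi> f" by (rule avg; fact)
  interpret product_prob_space K "{..<N}" by (rule product_prob_spaceI) (rule K)
  have fK: "f \<in> borel_measurable (K i)" for i using f(1) by measurable
  have int: "integrable (PiM {..<N} K) (\<lambda>y. f (y i))" if "i < N" for i
  proof (rule integrable_prob_bounded[OF P.prob_space_axioms, where C = C])
    show "(\<lambda>y. f (y i)) \<in> borel_measurable (PiM {..<N} K)"       using that fK[of i] by (intro measurable_compose[of "\<lambda>y. y i" _ "K i" f]) auto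
    show "\<bar>f (y i)\<bar> \<le> C" if "y \<in> space (PiM {..<N} K)" for y
      using that \<open>i < N\<close> K_space by (intro f(2)) (auto simp: space_PiM)
  qed
  have "(\<integral>y. (\<Sum>j<N. f (y j)) / N \<partial>PiM {..<N} K) = (\<Sum>i<N. \<integral>z. f z \<partial>K i) / N"
    using int by (simp add: integral_PiM_component[OF K _ _ fK])
  also have "\<dots> = \<Phi> f" using avg1 N_pos by simp
  finally show "(\<integral>y. (\<Sum>j<N. f (y j)) / N \<partial>particle_transition E G M \<epsilon> N n x) = \<Phi> f"
    unfolding trans_eq .
  have "(\<lambda>z. (f z)\<^sup>2) \<in> borel_measurable E" using f(1) by measurable
  moreover have "\<bar>(f z)\<^sup>2\<bar> \<le> C\<^sup>2" if "z \<in> space E" for z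
    using power_mono[OF f(2)[OF that], of 2] by simp
  ultimately have avg2: "(\<Sum>i<N. \<integral>z. (f z)\<^sup>2 \<partial>K i) = N * \<Phi> (\<lambda>z. (f z)\<^sup>2)" by (rule avg)
  have "(\<integral>y. ((\<Sum>j<N. f (y j)) / N)\<^sup>2 \<partial>PiM {..<N} K) = (\<integral>y. (\<Sum>j<N. f (y j))\<^sup>2 \<partial>PiM {..<N} K) / N\<^sup>2"
    by (simp add: power_divide)
  also have "\<dots> \<le> ((\<Sum>i<N. \<integral>z. f z \<partial>K i)\<^sup>2 + (\<Sum>i<N. \<integral>z. (f z)\<^sup>2 \<partial>K i)) / N\<^sup>2"
    using f(2) K_space by (intro divide_right_mono second_moment_sum_PiM[OF K _ fK]) auto
  also have "\<dots> = (\<Phi> f)\<^sup>2 + \<Phi> (\<lambda>z. (f z)\<^sup>2) / N"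
    using N_pos unfolding avg1 avg2 by (simp add: field_simps power2_eq_square)
  finally show "(\<integral>y. ((\<Sum>j<N. f (y j)) / N)\<^sup>2 \<partial>particle_transition E G M \<epsilon> N n x)
        \<le> (\<Phi> f)\<^sup>2 + \<Phi> (\<lambda>z. (f z)\<^sup>2) / N" unfolding trans_eq .
qed

end

section \<open>Conditional moments of the unnormalized particle functional\<close>

context fk_particle_model
begin

lemma backward_sum_measurable_last:
  assumes "\<And>p j. p < n \<Longrightarrow> j < N \<Longrightarrow> x p j \<in> space E" "F \<in> borel_measurable (PiM {..n} (\<lambda>_. E))"
  shows "backward_sum G H N x n F \<in> borel_measurable E"
  by (rule backward_sum_measurable[where x = "\<lambda>_. x" and F = "\<lambda>_. F"]) (use assms in auto)

lemma particle_sum_measurable: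
  assumes x: "\<And>p j. p \<le> n \<Longrightarrow> j < N \<Longrightarrow> (\<lambda>a. x a p j) \<in> A \<rightarrow>\<^sub>M E"
    and F: "F \<in> borel_measurable (PiM {..n} (\<lambda>_. E))"
  shows "(\<lambda>a. particle_sum G H N (x a) n F) \<in> borel_measurable A"
proof -
  have [measurable]: "(\<lambda>a. x a p j) \<in> A \<rightarrow>\<^sub>M E" if "p \<le> n" "j < N" for p j using x that by simp
  have [measurable]: "(\<lambda>a. backward_sum G H N (x a) n F (x a n j)) \<in> borel_measurable A" if "j < N" for j
    using x F that by (intro backward_sum_measurable) auto
  show ?thesis unfolding particle_sum_def
    by (intro borel_measurable_times borel_measurable_prod borel_measurable_divide
        borel_measurable_sum measurable_const) auto
qed

lemma mean_G_bounds:
  assumes "\<And>j. j < N \<Longrightarrow> x j \<in> space E"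
  shows "0 < (\<Sum>j<N. G (x j)) / N" "(\<Sum>j<N. G (x j)) / N \<le> 1"
proof -
  have "(\<Sum>j<N. G (x j)) \<le> (\<Sum>j<N. 1)" using assms G_range by (intro sum_mono) auto
  then show "(\<Sum>j<N. G (x j)) / N \<le> 1" using N_pos by simp
  show "0 < (\<Sum>j<N. G (x j)) / N" using sum_G_pos[OF N_pos assms] N_pos by simp
qed

lemma mean_backward_sum_abs_le:
  assumes x: "\<And>p j. p \<le> n \<Longrightarrow> j < N \<Longrightarrow> x p j \<in> space E"
    and bound: "\<And>z. z \<in> space (PiM {..n} (\<lambda>_. E)) \<Longrightarrow> \<bar>F z\<bar> \<le> 1"
  shows "\<bar>(\<Sum>j<N. backward_sum G H N x n F (x n j)) / N\<bar> \<le> 1"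
proof -
  have "\<bar>\<Sum>j<N. backward_sum G H N x n F (x n j)\<bar> \<le> (\<Sum>j<N. \<bar>backward_sum G H N x n F (x n j)\<bar>)"
    by (rule sum_abs)
  also have "\<dots> \<le> (\<Sum>j<N. 1)"
    using x bound by (intro sum_mono backward_sum_abs_le[OF N_pos, where f = "\<lambda>_. 1"]) auto
  finally show ?thesis using N_pos by (simp add: abs_divide)
qed

lemma particle_sum_abs_le:
  assumes x: "\<And>p j. p \<le> n \<Longrightarrow> j < N \<Longrightarrow> x p j \<in> space E"
    and bound: "\<And>z. z \<in> space (PiM {..n} (\<lambda>_. E)) \<Longrightarrow> \<bar>F z\<bar> \<le> 1"
  shows "\<bar>particle_sum G H N x n F\<bar> \<le> 1"
proof -
  have P: "0 < (\<Sum>j<N. G (x p j)) / N" "(\<Sum>j<N. G (x p j)) / N \<le> 1" if "p < n" for p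
    by (intro mean_G_bounds x; use that in simp)+
  have "0 \<le> (\<Prod>p<n. (\<Sum>j<N. G (x p j)) / N)"
    by (intro prod_nonneg ballI less_imp_le P(1)) simp
  moreover have "(\<Prod>p<n. (\<Sum>j<N. G (x p j)) / N) \<le> 1"
    using P less_imp_le[OF P(1)] by (intro prod_le_1) auto
  ultimately show ?thesis
    unfolding particle_sum_def abs_mult
    using mean_backward_sum_abs_le[OF x bound] by (intro mult_le_one) auto
qed

lemma particle_sum_last:
  assumes "\<And>p j. p \<le> n \<Longrightarrow> j < N \<Longrightarrow> x p j \<in> space E"
  shows "particle_sum G H N x n (\<lambda>z. g (z n)) =
    (\<Prod>p<n. (\<Sum>j<N. G (x p j)) / N) * ((\<Sum>j<N. g (x n j)) / N)"
proof -
  have "backward_sum G H N x n (\<lambda>z. g (z n)) (x n j) = g (x n j)" if "j < N" for j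
    using assms that by (intro backward_sum_last[OF N_pos]) auto
  then show ?thesis by (simp add: particle_sum_def)
qed

text \<open>The denominators of the backward kernels cancel against the density of
  \<^term>\<open>fk_map G M\<close> at the empirical measure.\<close>

lemma sum_G_integral_backward_sum:
  assumes x: "\<And>p j. p \<le> n \<Longrightarrow> j < N \<Longrightarrow> x p j \<in> space E"
    and F[measurable]: "F \<in> borel_measurable (PiM {..Suc n} (\<lambda>_. E))"
    and bound: "\<And>z. z \<in> space (PiM {..Suc n} (\<lambda>_. E)) \<Longrightarrow> \<bar>F z\<bar> \<le> C"
  shows "(\<Sum>j<N. G (x n j) * (\<integral>y. backward_sum G H N x (Suc n) F y \<partial>M (x n j)))
    = (\<Sum>j<N. backward_sum G H N x n (fk_step n F) (x n j))"
proof -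
  let ?g = "backward_sum G H N x (Suc n) F"
  let ?b = "\<lambda>j y. backward_sum G H N x n (\<lambda>z. F (z(Suc n := y))) (x n j)"
  have xn: "x n j \<in> space E" if "j < N" for j using x that by simp
  have F': "(\<lambda>(y, z). F (z(Suc n := y))) \<in> borel_measurable (E \<Otimes>\<^sub>M PiM {..n} (\<lambda>_. E))"
  proof -
    have "(\<lambda>w. (snd w)(Suc n := fst w)) \<in> E \<Otimes>\<^sub>M PiM {..n} (\<lambda>_. E) \<rightarrow>\<^sub>M PiM {..Suc n} (\<lambda>_. E)"
      by (intro measurable_path_fun_upd) measurable
    from measurable_compose[OF this F] show ?thesis by (simp add: split_beta)
  qed
  have bound': "\<bar>F (z(Suc n := y))\<bar> \<le> C" if "z \<in> space (PiM {..n} (\<lambda>_. E))" "y \<in> space E" for z y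
    by (rule bound[OF space_PiM_fun_upd[OF that]])
  have g[measurable]: "?g \<in> borel_measurable E"
    using x by (intro backward_sum_measurable_last F) auto
  have g_le: "\<bar>?g y\<bar> \<le> C" if "y \<in> space E" for y
    using x bound that by (intro backward_sum_abs_le[OF N_pos, where f = "\<lambda>_. C"]) auto
  have b[measurable]: "?b j \<in> borel_measurable E" if "j < N" for j
    using x xn[OF that] by (intro backward_sum_measurable[where x = "\<lambda>_. x" and y = "\<lambda>_. x n j", OF _ _ F']) auto
  have b_le: "\<bar>?b j y\<bar> \<le> C" if "j < N" "y \<in> space E" for j y
    by (rule backward_sum_abs_le[OF N_pos, where f = "\<lambda>_. C"])
      (use x that bound'[OF _ that(2)] in auto)
  have int_g: "integrable lam (\<lambda>y. H (x n j) y * ?g y)" if "j < N" for j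
    using g_le by (intro integrable_H_mult[OF xn[OF that] g]) auto
  have int_b: "integrable lam (\<lambda>y. H (x n j) y * ?b j y)" if "j < N" for j
    using b_le[OF that] by (intro integrable_H_mult[OF xn[OF that] b[OF that]]) auto
  have "(\<Sum>j<N. G (x n j) * (\<integral>y. ?g y \<partial>M (x n j))) = (\<Sum>j<N. G (x n j) * (\<integral>y. H (x n j) y * ?g y \<partial>lam))"
    using integral_M[OF xn g] by (simp del: backward_sum.simps)
  \<comment> \<open>Over the common reference measure \<open>lam\<close> the sum over
    \<open>j\<close> moves under the integral. There \<open>?g y\<close> does not depend on
    \<open>j\<close>, and its coefficient is exactly the denominator in the definition of
    \<open>?g y\<close>.\<close>
  also have "\<dots> = (\<integral>y. (\<Sum>j<N. G (x n j) * (H (x n j) y * ?g y)) \<partial>lam)"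
    using int_g by (simp del: backward_sum.simps)
  also have "\<dots> = (\<integral>y. (\<Sum>j<N. G (x n j) * (H (x n j) y * ?b j y)) \<partial>lam)"
  proof (rule Bochner_Integration.integral_cong[OF refl])
    fix y assume "y \<in> space lam"
    then have y: "y \<in> space E" using sets_eq_imp_space_eq[OF sets_lam] by simp
    have "(\<Sum>j<N. G (x n j) * (H (x n j) y * ?g y)) = (\<Sum>j<N. G (x n j) * H (x n j) y) * ?g y"
      by (simp only: sum_distrib_right mult.assoc)
    also have "\<dots> = (\<Sum>j<N. G (x n j) * H (x n j) y * ?b j y)"
    proof -
      have "0 < (\<Sum>j<N. G (x n j) * H (x n j) y)" by (rule sum_GH_pos[OF N_pos xn y])
      then show ?thesis by simp
    qed
    finally show "(\<Sum>j<N. G (x n j) * (H (x n j) y * ?g y)) = (\<Sum>j<N. G (x n j) * (H (x n j) y * ?b j y))"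
      by (simp only: mult.assoc)
  qed
  also have "\<dots> = (\<Sum>j<N. G (x n j) * (\<integral>y. H (x n j) y * ?b j y \<partial>lam))"
    using int_b by simp
  also have "\<dots> = (\<Sum>j<N. backward_sum G H N x n (fk_step n F) (x n j))"
  proof (rule sum.cong[OF refl])
    fix j assume "j \<in> {..<N}"
    then have j: "j < N" by simp
    note M' = M_simps[OF xn[OF j]]
    have "(\<integral>y. H (x n j) y * ?b j y \<partial>lam) = (\<integral>y. ?b j y \<partial>M (x n j))"
      by (rule integral_M[OF xn[OF j] b[OF j], symmetric])
    also have "\<dots> = backward_sum G H N x n (\<lambda>z. \<integral>y. F (z(Suc n := y)) \<partial>M (x n j)) (x n j)"
    proof (rule integral_backward_sum[OF N_pos _ xn[OF j] M'(1)])
      show "(\<lambda>(y, z). F (z(Suc n := y))) \<in> borel_measurable (M (x n j) \<Otimes>\<^sub>M PiM {..n} (\<lambda>_. E))"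
        using F' M'(2) by (simp cong: measurable_cong_sets sets_pair_measure_cong)
      show "\<bar>F (z(Suc n := y))\<bar> \<le> C" if "y \<in> space (M (x n j))" "z \<in> space (PiM {..n} (\<lambda>_. E))" for y z
        using bound'[OF that(2)] that(1) M'(3) by simp
    qed (use x in auto)
    \<comment> \<open>The potential at \<open>x n j\<close> is absorbed into the test function as
      \<open>G (z n)\<close>; all paths concerned end in \<open>x n j\<close>, so
      \<open>M (x n j)\<close> may likewise be read as \<open>M (z n)\<close>.\<close>
    finally have "G (x n j) * (\<integral>y. H (x n j) y * ?b j y \<partial>lam)
      = backward_sum G H N x n (\<lambda>z. G (z n) * (\<integral>y. F (z(Suc n := y)) \<partial>M (x n j))) (x n j)"
      by (simp only: backward_sum_mult_last[where g = G])
    also have "\<dots> = backward_sum G H N x n (fk_step n F) (x n j)"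
      by (rule backward_sum_cong_last) (simp add: fk_step_def)
    finally show "G (x n j) * (\<integral>y. H (x n j) y * ?b j y \<partial>lam)
      = backward_sum G H N x n (fk_step n F) (x n j)" .
  qed
  finally show ?thesis .
qed

text \<open>Given the past, \<open>particle_sum\<close> at the next time is a known factor times the
  empirical mean of one function \<open>g\<close> over the new particles, since the backward average
  of a new particle looks only at the past. Both claims are then the moments of one transition,
  applied to \<open>g\<close>.\<close>

lemma
  assumes x: "\<And>p j. p \<le> n \<Longrightarrow> j < N \<Longrightarrow> x p j \<in> space E"
    and F[measurable]: "F \<in> borel_measurable (PiM {..Suc n} (\<lambda>_. E))"
    and bound: "\<And>z. z \<in> space (PiM {..Suc n} (\<lambda>_. E)) \<Longrightarrow> \<bar>F z\<bar> \<le> fk_weight k (z (Suc n))"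
  defines "P \<equiv> particle_transition E G M \<epsilon> N n (x n)"
  shows integral_particle_sum_step:
      "(\<integral>y. particle_sum G H N (x(Suc n := y)) (Suc n) F \<partial>P) = particle_sum G H N x n (fk_step n F)"
    and second_moment_particle_sum_step: "(\<And>z. z \<in> space E \<Longrightarrow> fk_weight k z \<le> c) \<Longrightarrow>
      (\<integral>y. (particle_sum G H N (x(Suc n := y)) (Suc n) F)\<^sup>2 \<partial>P)
        \<le> (particle_sum G H N x n (fk_step n F))\<^sup>2 + c / N *
          (particle_sum G H N x n (\<lambda>z. fk_weight 1 (z n)) *
           particle_sum G H N x n (\<lambda>z. fk_weight (Suc k) (z n)))"
proof -
  define g where "g = backward_sum G H N x (Suc n) F"
  define \<Phi> where "\<Phi> = (\<lambda>g. (\<Sum>j<N. G (x n j) * (\<integral>z. g z \<partial>M (x n j))) / (\<Sum>j<N. G (x n j)))"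
  define q where "q = (\<Prod>p<n. (\<Sum>j<N. G (x p j)) / N)"
  define S where "S = (\<Sum>j<N. G (x n j))"
  have xn: "x n j \<in> space E" if "j < N" for j using x that by simp
  have S: "0 < S" unfolding S_def by (rule sum_G_pos[OF N_pos xn])
  have q: "0 \<le> q" unfolding q_def using x
    by (intro prod_nonneg ballI less_imp_le mean_G_bounds(1)) auto
  have bound1: "\<bar>F z\<bar> \<le> 1" if "z \<in> space (PiM {..Suc n} (\<lambda>_. E))" for z
  proof -
    have "z (Suc n) \<in> space E" using that by (auto simp: space_PiM)
    then show ?thesis using bound[OF that] fk_weight_bounds(2)[of "z (Suc n)" k] by linarith
  qed
  have g[measurable]: "g \<in> borel_measurable E"
    unfolding g_def using x by (intro backward_sum_measurable_last F) auto
  have g_le: "\<bar>g y\<bar> \<le> fk_weight k y" if "y \<in> space E" for y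
    unfolding g_def using x bound that by (intro backward_sum_abs_le[OF N_pos]) auto
  have g_le1: "\<bar>g y\<bar> \<le> 1" if "y \<in> space E" for y
    using g_le[OF that] fk_weight_bounds(2)[OF that, of k] by linarith
  have psum: "particle_sum G H N (x(Suc n := y)) (Suc n) F = q * (S / N) * ((\<Sum>j<N. g (y j)) / N)" for y
  proof -
    have "backward_sum G H N (x(Suc n := y)) (Suc n) F = g"
      unfolding g_def by (intro ext backward_sum_cong) auto
    moreover have "(\<Prod>p<Suc n. (\<Sum>j<N. G ((x(Suc n := y)) p j)) / N) = q * (S / N)"
      by (simp add: q_def S_def)
    ultimately show ?thesis unfolding particle_sum_def by (simp only: fun_upd_same)
  qed
  \<comment> \<open>The known factor is itself a \<open>particle_sum\<close> of a weight, as is its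
    product with \<open>\<Phi> (fk_weight k)\<close>. In this form the variance term can be
    estimated by an induction over time.\<close>
  have weight1: "particle_sum G H N x n (\<lambda>z. fk_weight 1 (z n)) = q * (S / N)"
  proof -
    have "fk_weight 1 (x n j) = G (x n j)" if "j < N" for j
      using prob_space.prob_space[OF M_simps(1)[OF xn[OF that]]] by simp
    then have "(\<Sum>j<N. fk_weight 1 (x n j)) = S"
      unfolding S_def by (intro sum.cong refl) (simp only: lessThan_iff)
    moreover have "particle_sum G H N x n (\<lambda>z. fk_weight 1 (z n)) = q * ((\<Sum>j<N. fk_weight 1 (x n j)) / N)"
      unfolding q_def by (rule particle_sum_last) (rule x)
    ultimately show ?thesis by (simp only:)
  qed
  have weightSuc: "particle_sum G H N x n (\<lambda>z. fk_weight (Suc k) (z n)) = q * (S / N * \<Phi> (fk_weight k))"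
    using S by (subst particle_sum_last[OF x]) (simp_all add: q_def \<Phi>_def S_def[symmetric])
  have step: "particle_sum G H N x n (fk_step n F) = q * (S / N) * \<Phi> g"
  proof -
    have "(\<Sum>j<N. backward_sum G H N x n (fk_step n F) (x n j)) = (\<Sum>j<N. G (x n j) * (\<integral>y. g y \<partial>M (x n j)))"
      unfolding g_def by (rule sum_G_integral_backward_sum[OF x F bound1, symmetric])
    also have "\<dots> = S * \<Phi> g" using S by (simp add: \<Phi>_def S_def)
    finally show ?thesis by (simp add: particle_sum_def q_def)
  qed
  show "(\<integral>y. particle_sum G H N (x(Suc n := y)) (Suc n) F \<partial>P) = particle_sum G H N x n (fk_step n F)"
  proof -
    have "(\<integral>y. (\<Sum>j<N. g (y j)) / N \<partial>P) = \<Phi> g"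
      unfolding P_def \<Phi>_def by (rule integral_particle_transition[OF xn g g_le1])
    then show ?thesis unfolding psum step integral_mult_right_zero by (simp only:)
  qed
  assume c: "\<And>z. z \<in> space E \<Longrightarrow> fk_weight k z \<le> c"
  have "(\<integral>y. (q * (S / N) * ((\<Sum>j<N. g (y j)) / N))\<^sup>2 \<partial>P)
      = (q * (S / N))\<^sup>2 * (\<integral>y. ((\<Sum>j<N. g (y j)) / N)\<^sup>2 \<partial>P)"
    by (simp only: power_mult_distrib) simp
  also have "\<dots> \<le> (q * (S / N))\<^sup>2 * ((\<Phi> g)\<^sup>2 + \<Phi> (\<lambda>z. (g z)\<^sup>2) / N)"
    unfolding P_def \<Phi>_def
    by (intro mult_left_mono second_moment_particle_transition[OF xn g g_le1]) auto
  also have "\<dots> = (q * (S / N) * \<Phi> g)\<^sup>2 + (q * (S / N))\<^sup>2 / N * \<Phi> (\<lambda>z. (g z)\<^sup>2)"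
    by (simp add: power2_eq_square algebra_simps)
  \<comment> \<open>Of the two factors \<open>fk_weight k z\<close> dominating
    \<open>(g z)\<^sup>2\<close>, one is bounded by \<open>c\<close>. The other is kept, and becomes
    the weight of index \<open>Suc k\<close> one time earlier.\<close>
  also have "\<dots> \<le> (q * (S / N) * \<Phi> g)\<^sup>2 + (q * (S / N))\<^sup>2 / N * (c * \<Phi> (fk_weight k))"
  proof (intro add_left_mono mult_left_mono)
    have "\<Phi> (\<lambda>z. (g z)\<^sup>2) \<le> \<Phi> (\<lambda>z. c * fk_weight k z)"
      unfolding \<Phi>_def
    proof (intro divide_right_mono sum_mono mult_left_mono)
      fix j assume "j \<in> {..<N}"
      then have j: "x n j \<in> space E" using xn by simp
      note M' = M_simps[OF j]
      show "0 \<le> G (x n j)" using G_range[OF j] by simp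
      show "(\<integral>z. (g z)\<^sup>2 \<partial>M (x n j)) \<le> (\<integral>z. c * fk_weight k z \<partial>M (x n j))"
      proof (rule integral_mono)
        show "integrable (M (x n j)) (\<lambda>z. (g z)\<^sup>2)"
          using M' g_le1 by (intro integrable_prob_bounded[OF M'(1), where C = 1])
            (auto cong: measurable_cong_sets simp: abs_square_le_1)
        have "\<bar>fk_weight k z\<bar> \<le> 1" if "z \<in> space E" for z
          using fk_weight_bounds[OF that, of k] by simp
        then show "integrable (M (x n j)) (\<lambda>z. c * fk_weight k z)"
          using M' by (intro integrable_mult_right integrable_prob_bounded[OF M'(1), where C = 1])
            (auto cong: measurable_cong_sets)
        fix z assume "z \<in> space (M (x n j))"
        then have z: "z \<in> space E" using M' by simp
        have "(g z)\<^sup>2 \<le> (fk_weight k z)\<^sup>2"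
          using power_mono[OF g_le[OF z], of 2] by simp
        also have "\<dots> \<le> c * fk_weight k z"
          using c[OF z] fk_weight_bounds[OF z, of k] by (simp add: power2_eq_square mult_right_mono)
        finally show "(g z)\<^sup>2 \<le> c * fk_weight k z" .
      qed
    qed (use S in \<open>simp add: S_def\<close>)
    also have "\<dots> = c * \<Phi> (fk_weight k)"
      by (simp add: \<Phi>_def sum_distrib_left mult.left_commute)
    finally show "\<Phi> (\<lambda>z. (g z)\<^sup>2) \<le> c * \<Phi> (fk_weight k)" .
  qed simp
  also have "(q * (S / N))\<^sup>2 / N * (c * \<Phi> (fk_weight k))
    = c / N * (q * (S / N) * (q * (S / N * \<Phi> (fk_weight k))))"
    by (simp add: power2_eq_square mult_ac)
  finally show "(\<integral>y. (particle_sum G H N (x(Suc n := y)) (Suc n) F)\<^sup>2 \<partial>P)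
        \<le> (particle_sum G H N x n (fk_step n F))\<^sup>2 + c / N *
          (particle_sum G H N x n (\<lambda>z. fk_weight 1 (z n)) *
           particle_sum G H N x n (\<lambda>z. fk_weight (Suc k) (z n)))"
    by (simp only: psum step weight1 weightSuc)
qed

end

section \<open>The exact functionals and the mixing condition\<close>

context fk_model
begin

text \<open>The exact unnormalized path functional, obtained by integrating out the last coordinate
  until the initial law is reached. It mentions no process, so the reference chain and the particle
  system, which live on different spaces, can each be compared with it.\<close>

primrec fk_functional :: "'a measure \<Rightarrow> nat \<Rightarrow> ((nat \<Rightarrow> 'a) \<Rightarrow> real) \<Rightarrow> real" where
  "fk_functional \<eta> 0 F = (\<integral>x. F (\<lambda>i\<in>{..0}. x) \<partial>\<eta>)"
| "fk_functional \<eta> (Suc n) F = fk_functional \<eta> n (fk_step n F)"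

definition fk_mass :: "'a measure \<Rightarrow> nat \<Rightarrow> real" where
  "fk_mass \<eta> n = (\<integral>x. fk_weight n x \<partial>\<eta>)"

text \<open>A weight of index \<open>k\<close> at time \<open>n\<close> stands for the potentials of
  the next \<open>k\<close> times, so the total horizon is \<open>n + k\<close>.\<close>

lemma fk_functional_weight: "fk_functional \<eta> n (\<lambda>z. fk_weight k (z n)) = fk_mass \<eta> (n + k)"
proof (induction n arbitrary: k)
  case (Suc n)
  have "fk_step n (\<lambda>z. fk_weight k (z (Suc n))) = (\<lambda>z. fk_weight (Suc k) (z n))"
    by (simp add: fk_step_def fun_eq_iff)
  then show ?case using Suc[of "Suc k"] by simp
qed (simp add: fk_mass_def)

lemma fk_weight_pos: "x \<in> space E \<Longrightarrow> 0 < fk_weight k x"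
proof (induction k arbitrary: x)
  case (Suc k)
  note M' = M_simps[OF Suc.prems]
  interpret prob_space "M x" by (rule M')
  have "\<bar>fk_weight k y\<bar> \<le> 1" if "y \<in> space E" for y using fk_weight_bounds[OF that, of k] by simp
  then have int: "integrable (M x) (fk_weight k)"
    using M' by (intro integrable_prob_bounded[OF M'(1), where C = 1]) (auto cong: measurable_cong_sets)
  have "0 < (\<integral>y. fk_weight k y \<partial>M x)"
    using Suc.IH M' by (intro expectation_greater[OF int]) auto
  then show ?case using G_range[OF Suc.prems] by simp
qed simp

lemma fk_mass_pos:
  assumes "\<eta> \<in> space (prob_algebra E)"
  shows "0 < fk_mass \<eta> k"
proof -
  have [measurable_cong]: "sets \<eta> = sets E" and sp: "space \<eta> = space E"
    using assms sets_eq_imp_space_eq by (auto simp: space_prob_algebra)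
  interpret prob_space \<eta> using assms by (simp add: space_prob_algebra)
  have "\<bar>fk_weight k y\<bar> \<le> 1" if "y \<in> space E" for y using fk_weight_bounds[OF that, of k] by simp
  then have int: "integrable \<eta> (fk_weight k)"
    using sp by (intro integrable_prob_bounded[OF prob_space_axioms, where C = 1]) auto
  show ?thesis unfolding fk_mass_def
    using fk_weight_pos sp by (intro expectation_greater[OF int]) auto
qed

lemma fk_weight_abs_le: "x \<in> space E \<Longrightarrow> \<bar>fk_weight k x\<bar> \<le> 1"
  using fk_weight_bounds[of x k] by simp

text \<open>After \<open>n\<close> steps from \<open>x\<close> the remaining weight is that of the
  point reached, which is at least \<open>fk_weight k x' / r\<close> wherever it lies.\<close>

lemma fk_weight_mult_le:
  assumes r: "\<And>x x' k. x \<in> space E \<Longrightarrow> x' \<in> space E \<Longrightarrow> fk_weight k x \<le> r * fk_weight k x'"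
    and x: "x \<in> space E" "x' \<in> space E"
  shows "fk_weight n x * fk_weight k x' \<le> r * fk_weight (n + k) x"
  using x(1)
proof (induction n arbitrary: x)
  case 0
  then show ?case using r x(2) by simp
next
  case (Suc n)
  note M' = M_simps[OF Suc.prems]
  have int: "integrable (M x) (fk_weight k)" for k
    using M' fk_weight_abs_le
    by (intro integrable_prob_bounded[OF M'(1), where C = 1]) (auto cong: measurable_cong_sets)
  have "(\<integral>y. fk_weight n y * fk_weight k x' \<partial>M x) \<le> (\<integral>y. r * fk_weight (n + k) y \<partial>M x)"
    using int Suc.IH M' by (intro integral_mono) auto
  then have "G x * ((\<integral>y. fk_weight n y \<partial>M x) * fk_weight k x') \<le> G x * (r * (\<integral>y. fk_weight (n + k) y \<partial>M x))"
    using G_range[OF Suc.prems] by (intro mult_left_mono) auto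
  then show ?case by (simp add: mult_ac)
qed

text \<open>The preceding inequality integrated over the starting point. It bounds a weight
  uniformly by a ratio of masses, the form in which the masses of the variance recursion
  cancel.\<close>

lemma fk_weight_le_mass_ratio:
  assumes r: "\<And>x x' k. x \<in> space E \<Longrightarrow> x' \<in> space E \<Longrightarrow> fk_weight k x \<le> r * fk_weight k x'"
    and \<eta>: "\<eta> \<in> space (prob_algebra E)" and x: "x \<in> space E"
  shows "fk_weight k x \<le> r * fk_mass \<eta> (n + k) / fk_mass \<eta> n"
proof -
  have [measurable_cong]: "sets \<eta> = sets E" and sp: "space \<eta> = space E"
    using \<eta> sets_eq_imp_space_eq by (auto simp: space_prob_algebra)
  interpret prob_space \<eta> using \<eta> by (simp add: space_prob_algebra)
  have int: "integrable \<eta> (fk_weight k)" for k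
    using sp fk_weight_abs_le by (intro integrable_prob_bounded[OF prob_space_axioms, where C = 1]) auto
  have "(\<integral>y. fk_weight n y * fk_weight k x \<partial>\<eta>) \<le> (\<integral>y. r * fk_weight (n + k) y \<partial>\<eta>)"
    using int fk_weight_mult_le[OF r _ x] sp by (intro integral_mono) auto
  then have "fk_mass \<eta> n * fk_weight k x \<le> r * fk_mass \<eta> (n + k)" by (simp add: fk_mass_def)
  then show ?thesis using fk_mass_pos[OF \<eta>, of n] by (simp add: pos_le_divide_eq mult.commute)
qed

lemma kernel_iterate_measurable: "kernel_iterate E M k \<in> E \<rightarrow>\<^sub>M prob_algebra E"
proof (induction k)
  case (Suc k)
  then show ?case using measurable_bind_prob_space[OF M Suc] by (simp add: kernel_iterate.simps[abs_def])
qed (simp add: kernel_iterate.simps[abs_def])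

lemma integral_kernel_iterate_Suc:
  fixes f :: "'a \<Rightarrow> real"
  assumes "x \<in> space E" "f \<in> borel_measurable E" "\<And>y. y \<in> space E \<Longrightarrow> \<bar>f y\<bar> \<le> C"
  shows "(\<integral>y. f y \<partial>kernel_iterate E M (Suc k) x) = (\<integral>u. \<integral>y. f y \<partial>kernel_iterate E M k u \<partial>M x)"
  unfolding kernel_iterate.simps
  using assms kernel_iterate_measurable M_simps[OF assms(1)]
  by (intro integral_bind_prob[where C = C]) (auto cong: measurable_cong_sets)

text \<open>The first \<open>m\<close> potentials are replaced by their bounds, which leaves
  \<open>m\<close> free moves of the chain before the remaining weight.\<close>

lemma fk_weight_add_bounds:
  assumes G: "\<And>x. x \<in> space E \<Longrightarrow> a \<le> G x" "\<And>x. x \<in> space E \<Longrightarrow> G x \<le> b" and a: "0 \<le> a"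
    and x: "x \<in> space E"
  shows "a ^ m * (\<integral>y. fk_weight k y \<partial>kernel_iterate E M m x) \<le> fk_weight (m + k) x"
    and "fk_weight (m + k) x \<le> b ^ m * (\<integral>y. fk_weight k y \<partial>kernel_iterate E M m x)"
proof -
  have "a ^ m * (\<integral>y. fk_weight k y \<partial>kernel_iterate E M m x) \<le> fk_weight (m + k) x
    \<and> fk_weight (m + k) x \<le> b ^ m * (\<integral>y. fk_weight k y \<partial>kernel_iterate E M m x)"
    using x
  proof (induction m arbitrary: x)
    case 0
    then show ?case by (simp add: integral_return)
  next
    case (Suc m)
    note M' = M_simps[OF Suc.prems]
    let ?I = "\<lambda>u. \<integral>y. fk_weight k y \<partial>kernel_iterate E M m u"
    note K = prob_algebra_kernelD[OF kernel_iterate_measurable[of m]]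
    have I_meas[measurable]: "?I \<in> borel_measurable E"
      by (rule integral_kernel_measurable[OF _ kernel_iterate_measurable]) measurable
    have I_le: "\<bar>?I u\<bar> \<le> 1" if "u \<in> space E" for u
      using K[OF that] fk_weight_abs_le by (intro abs_integral_prob_le) (auto cong: measurable_cong_sets)
    have int: "integrable (M x) ?I" "integrable (M x) (fk_weight j)" for j
      using M' I_le fk_weight_abs_le
      by (intro integrable_prob_bounded[OF M'(1), where C = 1]; auto cong: measurable_cong_sets)+
    have I: "(\<integral>y. fk_weight k y \<partial>kernel_iterate E M (Suc m) x) = (\<integral>u. ?I u \<partial>M x)"
      using fk_weight_abs_le by (intro integral_kernel_iterate_Suc[OF Suc.prems, where C = 1]) auto
    have "(\<integral>u. a ^ m * ?I u \<partial>M x) \<le> (\<integral>u. fk_weight (m + k) u \<partial>M x)"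
      using int Suc.IH M' by (intro integral_mono) auto
    then have "a ^ m * (\<integral>u. ?I u \<partial>M x) \<le> (\<integral>u. fk_weight (m + k) u \<partial>M x)" by simp
    moreover have I_nonneg: "0 \<le> (\<integral>u. ?I u \<partial>M x)"
      using M' K fk_weight_bounds by (intro integral_nonneg_AE AE_I2) auto
    ultimately have "a * (a ^ m * (\<integral>u. ?I u \<partial>M x)) \<le> G x * (\<integral>u. fk_weight (m + k) u \<partial>M x)"
      using G(1)[OF Suc.prems] G_range[OF Suc.prems] a by (intro mult_mono) auto
    moreover have "(\<integral>u. fk_weight (m + k) u \<partial>M x) \<le> (\<integral>u. b ^ m * ?I u \<partial>M x)"
      using int Suc.IH M' by (intro integral_mono) auto
    then have "(\<integral>u. fk_weight (m + k) u \<partial>M x) \<le> b ^ m * (\<integral>u. ?I u \<partial>M x)" by simp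
    then have "G x * (\<integral>u. fk_weight (m + k) u \<partial>M x) \<le> b * (b ^ m * (\<integral>u. ?I u \<partial>M x))"
      using G(2)[OF Suc.prems] G_range[OF Suc.prems] I_nonneg fk_weight_bounds M'
      by (intro mult_mono integral_nonneg_AE AE_I2) auto
    ultimately show ?case unfolding I by (simp add: mult.assoc)
  qed
  then show "a ^ m * (\<integral>y. fk_weight k y \<partial>kernel_iterate E M m x) \<le> fk_weight (m + k) x"
    and "fk_weight (m + k) x \<le> b ^ m * (\<integral>y. fk_weight k y \<partial>kernel_iterate E M m x)" by auto
qed

text \<open>For \<open>m \<le> k\<close> the first \<open>m\<close> potentials cost
  \<open>\<delta> ^ m\<close> and the comparison of the \<open>m\<close>-step transitions costs
  \<open>\<rho>\<close>. For smaller \<open>k\<close> there are too few moves to mix, but then all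
  \<open>k\<close> potentials together cost only \<open>\<delta> ^ k\<close>.\<close>

lemma fk_weight_ratio_le:
  assumes \<delta>: "1 \<le> \<delta>" and \<rho>: "1 \<le> \<rho>"
    and G_mix: "\<And>x x'. x \<in> space E \<Longrightarrow> x' \<in> space E \<Longrightarrow> G x \<le> \<delta> * G x'"
    and M_mix: "\<And>x x' A. x \<in> space E \<Longrightarrow> x' \<in> space E \<Longrightarrow> A \<in> sets E \<Longrightarrow>
      emeasure (kernel_iterate E M m x) A \<le> ennreal \<rho> * emeasure (kernel_iterate E M m x') A"
    and x: "x \<in> space E" "x' \<in> space E"
  shows "fk_weight k x \<le> \<rho> * \<delta> ^ m * fk_weight k x'"
proof -
  \<comment> \<open>The supremum gives two-sided bounds \<open>b / \<delta>\<close> and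
    \<open>b\<close> on \<open>G\<close> whose ratio is exactly \<open>\<delta>\<close>.\<close>
  define b where "b = (SUP y\<in>space E. G y)"
  have bdd: "bdd_above (G ` space E)" using G_range by (intro bdd_aboveI[of _ 1]) auto
  have Gb: "G y \<le> b" if "y \<in> space E" for y
    unfolding b_def using that by (intro cSUP_upper bdd)
  have Ga: "b / \<delta> \<le> G y" if "y \<in> space E" for y
  proof -
    have "b \<le> \<delta> * G y" unfolding b_def using x(1) that by (intro cSUP_least G_mix) auto
    then show ?thesis using \<delta> by (simp add: divide_le_eq mult.commute)
  qed
  have b: "0 < b" using Gb[OF x(1)] G_range[OF x(1)] by linarith
  have "0 \<le> b / \<delta>" using b \<delta> by simp
  note bounds = fk_weight_add_bounds[OF Ga Gb this]
  have ba: "b ^ j = \<delta> ^ j * (b / \<delta>) ^ j" for j using \<delta> by (simp add: power_divide)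
  show ?thesis
  proof (cases "m \<le> k")
    case True
    then obtain j where k: "k = m + j" using le_Suc_ex by blast
    let ?I = "\<lambda>x. \<integral>y. fk_weight j y \<partial>kernel_iterate E M m x"
    note K = prob_algebra_kernelD[OF kernel_iterate_measurable[of m]]
    have nn: "(\<integral>\<^sup>+y. ennreal (fk_weight j y) \<partial>kernel_iterate E M m u) = ennreal (?I u)" if u: "u \<in> space E" for u
      using fk_weight_abs_le fk_weight_bounds K[OF u]
      by (intro nn_integral_eq_integral integrable_prob_bounded[OF K(1)[OF u], where C = 1] AE_I2)
        (auto cong: measurable_cong_sets)
    \<comment> \<open>The mixing condition compares masses of sets. Read as an inequality with the
      rescaled measure, it passes to integrals of nonnegative functions.\<close>
    have "(\<integral>\<^sup>+y. ennreal (fk_weight j y) \<partial>kernel_iterate E M m x)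
        \<le> (\<integral>\<^sup>+y. ennreal (fk_weight j y) \<partial>scale_measure (ennreal \<rho>) (kernel_iterate E M m x'))"
    proof (rule nn_integral_mono_measure)
      show "sets (kernel_iterate E M m x) = sets (scale_measure (ennreal \<rho>) (kernel_iterate E M m x'))"
        using K(2)[OF x(1)] K(2)[OF x(2)] by simp
      then show "kernel_iterate E M m x \<le> scale_measure (ennreal \<rho>) (kernel_iterate E M m x')"
        using M_mix[OF x] K(2)[OF x(1)]
        by (subst le_measure) (auto simp: le_fun_def emeasure_notin_sets K(2)[OF x(2)])
    qed
    also have "\<dots> = ennreal \<rho> * (\<integral>\<^sup>+y. ennreal (fk_weight j y) \<partial>kernel_iterate E M m x')"
      using K(2)[OF x(2)] by (intro nn_integral_scale_measure) (auto cong: measurable_cong_sets)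
    finally have "ennreal (?I x) \<le> ennreal (\<rho> * ?I x')"
      using \<rho> by (simp add: nn[OF x(1)] nn[OF x(2)] ennreal_mult')
    moreover have "0 \<le> ?I x'"
      using K(3)[OF x(2)] fk_weight_bounds by (intro integral_nonneg_AE AE_I2) auto
    ultimately have I: "?I x \<le> \<rho> * ?I x'" using \<rho> by (simp add: ennreal_le_iff)
    have "fk_weight k x \<le> b ^ m * ?I x" unfolding k by (rule bounds(2)[OF _ _ x(1)])
    also have "\<dots> \<le> b ^ m * (\<rho> * ?I x')" using I b by (intro mult_left_mono) auto
    also have "\<dots> = \<rho> * \<delta> ^ m * ((b / \<delta>) ^ m * ?I x')" by (simp add: ba[of m])
    also have "\<dots> \<le> \<rho> * \<delta> ^ m * fk_weight k x'"
      unfolding k using \<delta> \<rho> by (intro mult_left_mono bounds(1)[OF _ _ x(2)]) auto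
    finally show ?thesis .
  next
    case False
    have one: "(\<integral>y. fk_weight 0 y \<partial>kernel_iterate E M k u) = 1" if "u \<in> space E" for u
      using prob_space.prob_space[OF prob_algebra_kernelD(1)[OF kernel_iterate_measurable that]] by simp
    have "fk_weight k x \<le> b ^ k" using bounds(2)[of x k 0, OF _ _ x(1)] one[OF x(1)] by simp
    also have "\<dots> = \<delta> ^ k * (b / \<delta>) ^ k" by (rule ba)
    also have "\<dots> \<le> (\<rho> * \<delta> ^ m) * fk_weight k x'"
    proof (rule mult_mono)
      have "1 * \<delta> ^ k \<le> \<rho> * \<delta> ^ m"
        using False \<delta> \<rho> by (intro mult_mono power_increasing) auto
      then show "\<delta> ^ k \<le> \<rho> * \<delta> ^ m" by simp
      show "(b / \<delta>) ^ k \<le> fk_weight k x'" using bounds(1)[of x' k 0, OF _ _ x(2)] one[OF x(2)] by simp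
    qed (use b \<delta> \<rho> in auto)
    finally show ?thesis .
  qed
qed

text \<open>All potentials in the product are already known at time \<open>n\<close>, so
  conditioning on the past only averages \<open>F\<close> over the last state. Together with the
  potential at time \<open>n\<close> this average is \<open>fk_step n F\<close>, and the product
  loses its last factor.\<close>

lemma markov_chain_fk_functional:
  assumes X: "markov_chain \<Omega> E \<eta> (\<lambda>_. M) X"
    and "F \<in> borel_measurable (PiM {..n} (\<lambda>_. E))"
    and "\<And>z. z \<in> space (PiM {..n} (\<lambda>_. E)) \<Longrightarrow> \<bar>F z\<bar> \<le> 1"
  shows "(\<integral>\<omega>. F (\<lambda>i\<in>{..n}. X i \<omega>) * (\<Prod>p<n. G (X p \<omega>)) \<partial>\<Omega>) = fk_functional \<eta> n F"
  using assms(2-)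
proof (induction n arbitrary: F)
  case 0
  have X0: "X 0 \<in> \<Omega> \<rightarrow>\<^sub>M E" "distr \<Omega> E (X 0) = \<eta>" using X by (auto simp: markov_chain_def)
  have "(\<lambda>x. F (\<lambda>i\<in>{..0}. x)) \<in> borel_measurable E"
    by (rule measurable_compose[OF _ 0(1)]) measurable
  from integral_distr[OF X0(1) this] show ?case using X0(2) by (simp add: restrict_def cong: if_cong)
next
  case (Suc n)
  note F = Suc.prems(1)
  have X_meas: "X k \<in> \<Omega> \<rightarrow>\<^sub>M E" for k using X by (auto simp: markov_chain_def)
  define h where "h = (\<lambda>z y. F (z(Suc n := y)) * (\<Prod>p<Suc n. G (z p)))"
  have upd: "(\<lambda>w. (fst w)(Suc n := snd w)) \<in> PiM {..n} (\<lambda>_. E) \<Otimes>\<^sub>M E \<rightarrow>\<^sub>M PiM {..Suc n} (\<lambda>_. E)"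
    by (intro measurable_path_fun_upd) measurable
  have h: "(\<lambda>(z, y). h z y) \<in> borel_measurable (PiM {..n} (\<lambda>_. E) \<Otimes>\<^sub>M E)"
    unfolding h_def split_beta
    by (intro borel_measurable_times borel_measurable_prod measurable_compose[OF upd F]) measurable
  have h_le: "\<bar>h z y\<bar> \<le> 1" if z: "z \<in> space (PiM {..n} (\<lambda>_. E))" and y: "y \<in> space E" for z y
  proof -
    have "z p \<in> space E" if "p < Suc n" for p using z that by (auto simp: space_PiM)
    then have "0 \<le> (\<Prod>p<Suc n. G (z p))" "(\<Prod>p<Suc n. G (z p)) \<le> 1"
      using G_range by (intro prod_nonneg prod_le_1; force intro: less_imp_le)+
    then show ?thesis
      unfolding h_def abs_mult using Suc.prems(2)[OF space_PiM_fun_upd[OF z y]]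
      by (intro mult_le_one) (auto simp del: prod.lessThan_Suc fun_upd_apply)
  qed
  have "(\<integral>\<omega>. F (\<lambda>i\<in>{..Suc n}. X i \<omega>) * (\<Prod>p<Suc n. G (X p \<omega>)) \<partial>\<Omega>)
      = (\<integral>\<omega>. h (\<lambda>i\<in>{..n}. X i \<omega>) (X (Suc n) \<omega>) \<partial>\<Omega>)"
  proof (rule Bochner_Integration.integral_cong[OF refl])
    fix \<omega>
    have "(\<lambda>i\<in>{..n}. X i \<omega>)(Suc n := X (Suc n) \<omega>) = (\<lambda>i\<in>{..Suc n}. X i \<omega>)" by (auto simp: fun_eq_iff)
    then show "F (\<lambda>i\<in>{..Suc n}. X i \<omega>) * (\<Prod>p<Suc n. G (X p \<omega>)) = h (\<lambda>i\<in>{..n}. X i \<omega>) (X (Suc n) \<omega>)"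
      by (simp add: h_def)
  qed
  also have "\<dots> = (\<integral>\<omega>. (\<integral>y. h (\<lambda>i\<in>{..n}. X i \<omega>) y \<partial>M (X n \<omega>)) \<partial>\<Omega>)"
    by (rule markov_chain_integral[OF X M h h_le])
  also have "\<dots> = (\<integral>\<omega>. fk_step n F (\<lambda>i\<in>{..n}. X i \<omega>) * (\<Prod>p<n. G (X p \<omega>)) \<partial>\<Omega>)"
    by (simp add: h_def fk_step_def mult_ac)
  also have "\<dots> = fk_functional \<eta> n (fk_step n F)"
  proof (rule Suc.IH[OF fk_step_measurable[OF F]])
    fix z assume z: "z \<in> space (PiM {..n} (\<lambda>_. E))"
    then have "z n \<in> space E" by (auto simp: space_PiM)
    then show "\<bar>fk_step n F z\<bar> \<le> 1"
      using fk_step_abs_le_weight[OF F _ z, of 0] Suc.prems(2) fk_weight_bounds(2)[of "z n" "Suc 0"] by force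
  qed
  finally show ?case by (simp only: fk_functional.simps)
qed

end

text \<open>The quadratic bound for \<open>exp\<close> holds on the unit interval; the threshold on
  \<open>N\<close> places \<open>(n + 1) * r / N\<close> there.\<close>

lemma power_one_plus_le:
  fixes s :: real
  assumes "0 \<le> s" "real k * s \<le> 1"
  shows "(1 + s) ^ k \<le> 1 + real k * s + (real k * s)\<^sup>2"
proof -
  have "(1 + s) ^ k \<le> exp s ^ k" using assms by (intro power_mono exp_ge_add_one_self_aux) auto
  also have "\<dots> = exp (real k * s)" by (simp add: exp_of_nat_mult)
  also have "\<dots> \<le> 1 + real k * s + (real k * s)\<^sup>2" using assms by (intro exp_bound) auto
  finally show ?thesis .
qed

section \<open>First and second moments of the unnormalized particle functional\<close>

context fk_particle_model
begin

lemma particle_systemD: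
  assumes "particle_system \<Omega> E \<eta>0 G M \<epsilon> N \<xi>"
  shows "prob_space \<Omega>" "\<xi> p \<in> \<Omega> \<rightarrow>\<^sub>M PiM {..<N} (\<lambda>_. E)"
    "distr \<Omega> (PiM {..<N} (\<lambda>_. E)) (\<xi> 0) = PiM {..<N} (\<lambda>_. \<eta>0)"
  using assms by (auto simp: particle_system_def markov_chain_def)

lemma particle_in_space:
  assumes "particle_system \<Omega> E \<eta>0 G M \<epsilon> N \<xi>" "\<omega> \<in> space \<Omega>" "j < N"
  shows "\<xi> p \<omega> j \<in> space E"
  using measurable_space[OF particle_systemD(2)[OF assms(1)] assms(2), of p] assms(3)
  by (auto simp: space_PiM)

lemma particle_measurable:
  assumes "particle_system \<Omega> E \<eta>0 G M \<epsilon> N \<xi>" "j < N"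
  shows "(\<lambda>\<omega>. \<xi> p \<omega> j) \<in> \<Omega> \<rightarrow>\<^sub>M E"
  using measurable_compose[OF particle_systemD(2)[OF assms(1)] measurable_component_singleton] assms(2)
  by simp

lemma random_particle_sum:
  assumes \<xi>: "particle_system \<Omega> E \<eta>0 G M \<epsilon> N \<xi>"
    and F: "F \<in> borel_measurable (PiM {..n} (\<lambda>_. E))"
    and bound: "\<And>z. z \<in> space (PiM {..n} (\<lambda>_. E)) \<Longrightarrow> \<bar>F z\<bar> \<le> 1"
  shows "(\<lambda>\<omega>. particle_sum G H N (\<lambda>p. \<xi> p \<omega>) n F) \<in> borel_measurable \<Omega>"
    and "\<And>\<omega>. \<omega> \<in> space \<Omega> \<Longrightarrow> \<bar>particle_sum G H N (\<lambda>p. \<xi> p \<omega>) n F\<bar> \<le> 1"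
proof -
  show "(\<lambda>\<omega>. particle_sum G H N (\<lambda>p. \<xi> p \<omega>) n F) \<in> borel_measurable \<Omega>"
    by (rule particle_sum_measurable[OF _ F]) (rule particle_measurable[OF \<xi>])
  show "\<bar>particle_sum G H N (\<lambda>p. \<xi> p \<omega>) n F\<bar> \<le> 1" if "\<omega> \<in> space \<Omega>" for \<omega>
    by (rule particle_sum_abs_le[OF _ bound]) (rule particle_in_space[OF \<xi> that])
qed

text \<open>Conditioning on the past amounts to resampling the newest row. The exponent
  \<open>l\<close> covers the mean and the second moment at once.\<close>

lemma particle_system_integral_Suc:
  assumes \<xi>: "particle_system \<Omega> E \<eta>0 G M \<epsilon> N \<xi>"
    and F: "F \<in> borel_measurable (PiM {..Suc n} (\<lambda>_. E))"
    and bound: "\<And>z. z \<in> space (PiM {..Suc n} (\<lambda>_. E)) \<Longrightarrow> \<bar>F z\<bar> \<le> 1"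
  shows "(\<integral>\<omega>. (particle_sum G H N (\<lambda>p. \<xi> p \<omega>) (Suc n) F) ^ l \<partial>\<Omega>) =
    (\<integral>\<omega>. (\<integral>y. (particle_sum G H N ((\<lambda>p. \<xi> p \<omega>)(Suc n := y)) (Suc n) F) ^ l
      \<partial>particle_transition E G M \<epsilon> N n (\<xi> n \<omega>)) \<partial>\<Omega>)"
proof -
  let ?S = "PiM {..<N} (\<lambda>_. E)"
  define h where "h = (\<lambda>z y. (particle_sum G H N (z(Suc n := y)) (Suc n) F) ^ l)"
  have chain: "markov_chain \<Omega> ?S (PiM {..<N} (\<lambda>_. \<eta>0)) (particle_transition E G M \<epsilon> N) \<xi>"
    using \<xi> by (simp add: particle_system_def)
  have upd: "(\<lambda>w. (fst w)(Suc n := snd w)) \<in> PiM {..n} (\<lambda>_. ?S) \<Otimes>\<^sub>M ?S \<rightarrow>\<^sub>M PiM {..Suc n} (\<lambda>_. ?S)"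
    by (intro measurable_path_fun_upd) measurable
  have comp: "(\<lambda>w. ((fst w)(Suc n := snd w)) p j) \<in> PiM {..n} (\<lambda>_. ?S) \<Otimes>\<^sub>M ?S \<rightarrow>\<^sub>M E"
    if "p \<le> Suc n" "j < N" for p j
  proof -
    have "(\<lambda>z. z p) \<in> PiM {..Suc n} (\<lambda>_. ?S) \<rightarrow>\<^sub>M ?S" using that by simp
    moreover have "(\<lambda>y. y j) \<in> ?S \<rightarrow>\<^sub>M E" using that by simp
    ultimately show ?thesis using measurable_compose[OF measurable_compose[OF upd]] by blast
  qed
  have h: "(\<lambda>(z, y). h z y) \<in> borel_measurable (PiM {..n} (\<lambda>_. ?S) \<Otimes>\<^sub>M ?S)"
    unfolding h_def split_beta by (intro borel_measurable_power particle_sum_measurable F comp)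
  have h_le: "\<bar>h z y\<bar> \<le> 1" if z: "z \<in> space (PiM {..n} (\<lambda>_. ?S))" and y: "y \<in> space ?S" for z y
  proof -
    have "z(Suc n := y) \<in> space (PiM {..Suc n} (\<lambda>_. ?S))" by (rule space_PiM_fun_upd[OF z y])
    then have "(z(Suc n := y)) p j \<in> space E" if "p \<le> Suc n" "j < N" for p j
      using that by (auto simp del: fun_upd_apply simp: space_PiM PiE_iff)
    then have "\<bar>particle_sum G H N (z(Suc n := y)) (Suc n) F\<bar> \<le> 1" by (rule particle_sum_abs_le[OF _ bound])
    then show ?thesis unfolding h_def power_abs by (intro power_le_one) auto
  qed
  \<comment> \<open>The Markov property provides the past as a restricted function; rows after
    \<open>Suc n\<close> do not enter \<open>particle_sum\<close>, so the full trajectory may stand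
    in its place.\<close>
  have h_eq: "h (\<lambda>i\<in>{..n}. \<xi> i \<omega>) y = (particle_sum G H N ((\<lambda>p. \<xi> p \<omega>)(Suc n := y)) (Suc n) F) ^ l" for \<omega> y
    unfolding h_def by (intro arg_cong[where f = "\<lambda>a. a ^ l"] particle_sum_cong) auto
  have "(\<integral>\<omega>. h (\<lambda>i\<in>{..n}. \<xi> i \<omega>) (\<xi> (Suc n) \<omega>) \<partial>\<Omega>)
      = (\<integral>\<omega>. (\<integral>y. h (\<lambda>i\<in>{..n}. \<xi> i \<omega>) y \<partial>particle_transition E G M \<epsilon> N n (\<xi> n \<omega>)) \<partial>\<Omega>)"
    by (rule markov_chain_integral[where C = 1, OF chain measurable_particle_transition h h_le])
  moreover have "(\<lambda>p. \<xi> p \<omega>)(Suc n := \<xi> (Suc n) \<omega>) = (\<lambda>p. \<xi> p \<omega>)" for \<omega> by auto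
  ultimately show ?thesis by (simp only: h_eq)
qed

lemma particle_system_integral_0:
  assumes \<xi>: "particle_system \<Omega> E \<eta>0 G M \<epsilon> N \<xi>"
    and F: "F \<in> borel_measurable (PiM {..0} (\<lambda>_. E))"
  shows "(\<integral>\<omega>. (particle_sum G H N (\<lambda>p. \<xi> p \<omega>) 0 F) ^ l \<partial>\<Omega>) =
    (\<integral>y. ((\<Sum>j<N. F (\<lambda>i\<in>{..0}. y j)) / N) ^ l \<partial>PiM {..<N} (\<lambda>_. \<eta>0))"
proof -
  have f: "(\<lambda>x. F (\<lambda>i\<in>{..0}. x)) \<in> borel_measurable E"
    by (rule measurable_compose[OF _ F]) measurable
  have "(\<lambda>y. F (\<lambda>i\<in>{..0}. y j)) \<in> borel_measurable (PiM {..<N} (\<lambda>_. E))" if "j \<in> {..<N}" for j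
    by (rule measurable_compose[OF _ f]) (use that in simp)
  then have "(\<lambda>y. ((\<Sum>j<N. F (\<lambda>i\<in>{..0}. y j)) / N) ^ l) \<in> borel_measurable (PiM {..<N} (\<lambda>_. E))"
    by (intro borel_measurable_power borel_measurable_divide borel_measurable_sum borel_measurable_const)
  from integral_distr[OF particle_systemD(2)[OF \<xi>, of 0] this]
  show ?thesis by (simp add: particle_systemD(3)[OF \<xi>] particle_sum_def)
qed

lemma bounded_by_weight:
  fixes n :: nat
  assumes "\<And>z. z \<in> space (PiM {..n} (\<lambda>_. E)) \<Longrightarrow> \<bar>F z\<bar> \<le> fk_weight k (z n)"
    and "z \<in> space (PiM {..n} (\<lambda>_. E))"
  shows "\<bar>F z\<bar> \<le> 1"
proof -
  have "z n \<in> space E" using assms(2) by (simp add: space_PiM PiE_iff)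
  then show ?thesis using assms(1)[OF assms(2)] fk_weight_bounds(2)[of "z n" k] by linarith
qed

lemma mean_particle_sum:
  assumes \<xi>: "particle_system \<Omega> E \<eta>0 G M \<epsilon> N \<xi>" and \<eta>0: "\<eta>0 \<in> space (prob_algebra E)"
    and F: "F \<in> borel_measurable (PiM {..n} (\<lambda>_. E))"
    and bound: "\<And>z. z \<in> space (PiM {..n} (\<lambda>_. E)) \<Longrightarrow> \<bar>F z\<bar> \<le> fk_weight k (z n)"
  shows "(\<integral>\<omega>. particle_sum G H N (\<lambda>p. \<xi> p \<omega>) n F \<partial>\<Omega>) = fk_functional \<eta>0 n F"
  using F bound
proof (induction n arbitrary: F k)
  case 0
  note F = 0(1)
  have \<eta>: "prob_space \<eta>0" and [measurable_cong]: "sets \<eta>0 = sets E" and sp: "space \<eta>0 = space E"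
    using \<eta>0 sets_eq_imp_space_eq by (auto simp: space_prob_algebra)
  interpret product_prob_space "\<lambda>_. \<eta>0" "{..<N}" by (rule product_prob_spaceI) (rule \<eta>)
  have f: "(\<lambda>x. F (\<lambda>i\<in>{..0}. x)) \<in> borel_measurable E"
    by (rule measurable_compose[OF _ F]) measurable
  then have f': "(\<lambda>x. F (\<lambda>i\<in>{..0}. x)) \<in> borel_measurable \<eta>0" by measurable
  have f_le: "\<bar>F (\<lambda>i\<in>{..0}. x)\<bar> \<le> 1" if "x \<in> space E" for x
    by (rule bounded_by_weight[where n = 0 and F = F and k = k])
      (use 0(2) that in \<open>simp_all add: space_PiM PiE_iff\<close>)
  have int: "integrable (PiM {..<N} (\<lambda>_. \<eta>0)) (\<lambda>y. F (\<lambda>i\<in>{..0}. y j))" if "j < N" for j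
  proof (rule integrable_prob_bounded[OF P.prob_space_axioms, where C = 1])
    show "(\<lambda>y. F (\<lambda>i\<in>{..0}. y j)) \<in> borel_measurable (PiM {..<N} (\<lambda>_. \<eta>0))"
      by (rule measurable_compose[OF _ f']) (use that in simp)
    show "\<bar>F (\<lambda>i\<in>{..0}. y j)\<bar> \<le> 1" if "y \<in> space (PiM {..<N} (\<lambda>_. \<eta>0))" for y
      by (rule f_le) (use that \<open>j < N\<close> sp in \<open>auto simp: space_PiM\<close>)
  qed
  have "(\<integral>\<omega>. particle_sum G H N (\<lambda>p. \<xi> p \<omega>) 0 F \<partial>\<Omega>)
      = (\<integral>y. (\<Sum>j<N. F (\<lambda>i\<in>{..0}. y j)) / N \<partial>PiM {..<N} (\<lambda>_. \<eta>0))"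
    using particle_system_integral_0[OF \<xi> F, of 1] by (simp only: power_one_right)
  also have "\<dots> = (\<Sum>j<N. \<integral>y. F (\<lambda>i\<in>{..0}. y j) \<partial>PiM {..<N} (\<lambda>_. \<eta>0)) / N"
    using int by (subst Bochner_Integration.integral_sum[symmetric]) auto
  also have "\<dots> = (\<Sum>j<N. fk_functional \<eta>0 0 F) / N"
    using integral_PiM_component[of "\<lambda>_. \<eta>0" "{..<N}" _ "\<lambda>x. F (\<lambda>i\<in>{..0}. x)"] \<eta> f' by simp
  finally show ?case using N_pos by simp
next
  case (Suc n)
  note F = Suc.prems(1) and bound = Suc.prems(2)
  have "(\<integral>\<omega>. particle_sum G H N (\<lambda>p. \<xi> p \<omega>) (Suc n) F \<partial>\<Omega>)
      = (\<integral>\<omega>. (\<integral>y. particle_sum G H N ((\<lambda>p. \<xi> p \<omega>)(Suc n := y)) (Suc n) F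
          \<partial>particle_transition E G M \<epsilon> N n (\<xi> n \<omega>)) \<partial>\<Omega>)"
    using particle_system_integral_Suc[OF \<xi> F bounded_by_weight[OF bound], of 1] by simp
  also have "\<dots> = (\<integral>\<omega>. particle_sum G H N (\<lambda>p. \<xi> p \<omega>) n (fk_step n F) \<partial>\<Omega>)"
    using particle_in_space[OF \<xi>]
    by (intro Bochner_Integration.integral_cong refl integral_particle_sum_step[OF _ F bound]) auto
  also have "\<dots> = fk_functional \<eta>0 n (fk_step n F)"
    by (rule Suc.IH[OF fk_step_measurable[OF F] fk_step_abs_le_weight[OF F bound]])
  finally show ?case by simp
qed

text \<open>For a weight the exact functional equals the mass, so the bound collapses to the factor
  \<open>(1 + r / N) ^ Suc n\<close> times the squared mass. This special case is what the
  conditional variance of a general \<open>F\<close> calls for, hence \<open>F\<close> and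
  \<open>k\<close> vary in the induction.\<close>

lemma second_moment_particle_sum:
  assumes \<xi>: "particle_system \<Omega> E \<eta>0 G M \<epsilon> N \<xi>" and \<eta>0: "\<eta>0 \<in> space (prob_algebra E)"
    and r: "\<And>x x' k. x \<in> space E \<Longrightarrow> x' \<in> space E \<Longrightarrow> fk_weight k x \<le> r * fk_weight k x'"
    and r_nonneg: "0 \<le> r"
    and F: "F \<in> borel_measurable (PiM {..n} (\<lambda>_. E))"
    and bound: "\<And>z. z \<in> space (PiM {..n} (\<lambda>_. E)) \<Longrightarrow> \<bar>F z\<bar> \<le> fk_weight k (z n)"
  shows "(\<integral>\<omega>. (particle_sum G H N (\<lambda>p. \<xi> p \<omega>) n F)\<^sup>2 \<partial>\<Omega>)
    \<le> (fk_functional \<eta>0 n F)\<^sup>2 + ((1 + r / N) ^ Suc n - 1) * (fk_mass \<eta>0 (n + k))\<^sup>2"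
  using F bound
proof (induction n arbitrary: F k)
  case 0
  note F = 0(1)
  have \<eta>: "prob_space \<eta>0" and [measurable_cong]: "sets \<eta>0 = sets E" and sp: "space \<eta>0 = space E"
    using \<eta>0 sets_eq_imp_space_eq by (auto simp: space_prob_algebra)
  define f where "f = (\<lambda>x. F (\<lambda>i\<in>{..0}. x))"
  have F_eq: "F (\<lambda>i\<in>{..0}. x) = f x" for x by (simp only: f_def)
  have f[measurable]: "f \<in> borel_measurable E"
    unfolding f_def by (rule measurable_compose[OF _ F]) measurable
  then have f': "f \<in> borel_measurable \<eta>0" by measurable
  have path: "(\<lambda>i\<in>{..0}. x) \<in> space (PiM {..0::nat} (\<lambda>_. E))" if "x \<in> space E" for x
    using that by (simp add: space_PiM PiE_iff)
  have f_le: "\<bar>f x\<bar> \<le> fk_weight k x" if "x \<in> space E" for x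
    using 0(2)[OF path[OF that]] by (simp only: F_eq restrict_apply' atMost_iff le_refl)
  have f_le1: "\<bar>f x\<bar> \<le> 1" if "x \<in> space E" for x
    unfolding f_def by (rule bounded_by_weight[where n = 0 and F = F and k = k, OF 0(2) path[OF that]])
  have int_f: "integrable \<eta>0 (\<lambda>x. (f x)\<^sup>2)"
    using f' f_le1 sp by (intro integrable_prob_bounded[OF \<eta>, where C = 1]) (auto simp: abs_square_le_1)
  have int_w: "integrable \<eta>0 (fk_weight k)"
    using sp fk_weight_abs_le by (intro integrable_prob_bounded[OF \<eta>, where C = 1]) auto
  have "(\<integral>x. (f x)\<^sup>2 \<partial>\<eta>0) \<le> (\<integral>x. r * fk_mass \<eta>0 k * fk_weight k x \<partial>\<eta>0)"
  proof (rule integral_mono[OF int_f integrable_mult_right[OF int_w]])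
    fix x assume "x \<in> space \<eta>0"
    then have x: "x \<in> space E" using sp by simp
    \<comment> \<open>At time 0 the denominator of the mass ratio is 1. The initial sample thus
      contributes its own term \<open>r / N\<close>, which explains the exponent
      \<open>Suc n\<close> instead of \<open>n\<close>.\<close>
    have "fk_mass \<eta>0 0 = 1" using prob_space.prob_space[OF \<eta>] by (simp add: fk_mass_def)
    then have "fk_weight k x \<le> r * fk_mass \<eta>0 k"
      using fk_weight_le_mass_ratio[where n = 0 and k = k, OF r \<eta>0 x] by simp
    then have "fk_weight k x * fk_weight k x \<le> r * fk_mass \<eta>0 k * fk_weight k x"
      using fk_weight_bounds(1)[OF x] by (intro mult_right_mono) auto
    moreover have "(f x)\<^sup>2 \<le> (fk_weight k x)\<^sup>2"
      using power_mono[OF f_le[OF x], of 2] by simp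
    ultimately show "(f x)\<^sup>2 \<le> r * fk_mass \<eta>0 k * fk_weight k x" by (simp add: power2_eq_square)
  qed
  also have "\<dots> = r * (fk_mass \<eta>0 k)\<^sup>2" by (simp add: fk_mass_def power2_eq_square)
  finally have second: "(\<integral>x. (f x)\<^sup>2 \<partial>\<eta>0) \<le> r * (fk_mass \<eta>0 k)\<^sup>2" .
  have "(\<integral>\<omega>. (particle_sum G H N (\<lambda>p. \<xi> p \<omega>) 0 F)\<^sup>2 \<partial>\<Omega>)
      = (\<integral>y. (\<Sum>j<N. f (y j))\<^sup>2 \<partial>PiM {..<N} (\<lambda>_. \<eta>0)) / N\<^sup>2"
    unfolding particle_system_integral_0[OF \<xi> F] F_eq power_divide by simp
  also have "\<dots> \<le> ((\<Sum>j<N. \<integral>x. f x \<partial>\<eta>0)\<^sup>2 + (\<Sum>j<N. \<integral>x. (f x)\<^sup>2 \<partial>\<eta>0)) / N\<^sup>2"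
    using f' f_le1 sp \<eta> by (intro divide_right_mono second_moment_sum_PiM[where C = 1]) auto
  also have "\<dots> = (fk_functional \<eta>0 0 F)\<^sup>2 + (\<integral>x. (f x)\<^sup>2 \<partial>\<eta>0) / N"
    unfolding fk_functional.simps F_eq using N_pos by (simp add: field_simps power2_eq_square)
  also have "\<dots> \<le> (fk_functional \<eta>0 0 F)\<^sup>2 + r * (fk_mass \<eta>0 k)\<^sup>2 / N"
    by (intro add_left_mono divide_right_mono second) simp
  finally show ?case by simp
next
  case (Suc n)
  note F = Suc.prems(1) and bound = Suc.prems(2)
  let ?ps = "\<lambda>\<omega> F. particle_sum G H N (\<lambda>p. \<xi> p \<omega>) n F"
  let ?w = "\<lambda>k (z :: nat \<Rightarrow> 'a). fk_weight k (z n)"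
  let ?m = "fk_mass \<eta>0"
  define q where "q = (1 + r / N) ^ Suc n"
  \<comment> \<open>The denominator cancels the mass \<open>?m (Suc n)\<close> in
    \<open>cross\<close>, and the numerator completes the other mass to a square.\<close>
  define c where "c = r * ?m (Suc n + k) / ?m (Suc n)"
  have \<Omega>: "prob_space \<Omega>" by (rule particle_systemD[OF \<xi>])
  have q: "0 \<le> q" using r_nonneg by (simp add: q_def)
  have m: "0 < ?m j" for j by (rule fk_mass_pos[OF \<eta>0])
  have w_meas: "?w j \<in> borel_measurable (PiM {..n} (\<lambda>_. E))" for j
    by (rule measurable_compose[OF _ fk_weight_measurable]) simp
  have w_le: "\<bar>?w j z\<bar> \<le> fk_weight j (z n)" if "z \<in> space (PiM {..n} (\<lambda>_. E))" for j z
  proof -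
    have "z n \<in> space E" using that by (simp add: space_PiM PiE_iff)
    then show ?thesis using fk_weight_bounds(1) by simp
  qed
  note step_meas = fk_step_measurable[OF F]
  have step_le: "\<bar>fk_step n F z\<bar> \<le> fk_weight (Suc k) (z n)" if "z \<in> space (PiM {..n} (\<lambda>_. E))" for z
    by (rule fk_step_abs_le_weight[OF F bound that])
  have last: "z n \<in> space E" if "z \<in> space (PiM {..n} (\<lambda>_. E))" for z
    using that by (simp add: space_PiM PiE_iff)
  have w_le1: "\<bar>?w j z\<bar> \<le> 1" if "z \<in> space (PiM {..n} (\<lambda>_. E))" for j z
    by (rule fk_weight_abs_le[OF last[OF that]])
  have step_le1: "\<bar>fk_step n F z\<bar> \<le> 1" if "z \<in> space (PiM {..n} (\<lambda>_. E))" for z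
    using step_le[OF that] fk_weight_bounds(2)[OF last[OF that], of "Suc k"] by linarith
  have ps_w: "(\<lambda>\<omega>. ?ps \<omega> (?w j)) \<in> borel_measurable \<Omega>"
    "\<And>\<omega>. \<omega> \<in> space \<Omega> \<Longrightarrow> \<bar>?ps \<omega> (?w j)\<bar> \<le> 1" for j
    by (rule random_particle_sum[OF \<xi>], rule w_meas, erule w_le1)
      (rule random_particle_sum(2)[OF \<xi>], rule w_meas, erule w_le1)
  have ps_step: "(\<lambda>\<omega>. ?ps \<omega> (fk_step n F)) \<in> borel_measurable \<Omega>"
    "\<And>\<omega>. \<omega> \<in> space \<Omega> \<Longrightarrow> \<bar>?ps \<omega> (fk_step n F)\<bar> \<le> 1"
    by (rule random_particle_sum[OF \<xi>], rule step_meas, erule step_le1)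
      (rule random_particle_sum(2)[OF \<xi>], rule step_meas, erule step_le1)
  have int_ww: "integrable \<Omega> (\<lambda>\<omega>. ?ps \<omega> (?w i) * ?ps \<omega> (?w j))" for i j
    using ps_w
    by (intro integrable_prob_bounded[OF \<Omega>, where C = 1] borel_measurable_times)
      (auto simp: abs_mult intro!: mult_le_one)
  have int_step: "integrable \<Omega> (\<lambda>\<omega>. (?ps \<omega> (fk_step n F))\<^sup>2)"
    using ps_step by (intro integrable_prob_bounded[OF \<Omega>, where C = 1] borel_measurable_power)
      (auto simp: abs_square_le_1)
  have w_moment: "(\<integral>\<omega>. (?ps \<omega> (?w j))\<^sup>2 \<partial>\<Omega>) \<le> q * (?m (n + j))\<^sup>2" for j
  proof -
    have "(\<integral>\<omega>. (?ps \<omega> (?w j))\<^sup>2 \<partial>\<Omega>)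
        \<le> (fk_functional \<eta>0 n (?w j))\<^sup>2 + ((1 + r / N) ^ Suc n - 1) * (?m (n + j))\<^sup>2"
      by (rule Suc.IH, rule w_meas, erule w_le)
    then show ?thesis unfolding fk_functional_weight q_def by (simp only: algebra_simps)
  qed
  have cross: "(\<integral>\<omega>. ?ps \<omega> (?w 1) * ?ps \<omega> (?w (Suc k)) \<partial>\<Omega>) \<le> q * ?m (Suc n) * ?m (Suc n + k)"
  proof (rule power2_le_imp_le)
    have "(\<integral>\<omega>. ?ps \<omega> (?w 1) * ?ps \<omega> (?w (Suc k)) \<partial>\<Omega>)\<^sup>2
        \<le> (\<integral>\<omega>. (?ps \<omega> (?w 1))\<^sup>2 \<partial>\<Omega>) * (\<integral>\<omega>. (?ps \<omega> (?w (Suc k)))\<^sup>2 \<partial>\<Omega>)"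
      using int_ww by (intro Cauchy_Schwarz_integral) (simp_all only: power2_eq_square)
    also have "\<dots> \<le> (q * (?m (n + 1))\<^sup>2) * (q * (?m (n + Suc k))\<^sup>2)"
      using q by (intro mult_mono w_moment) simp_all
    also have "\<dots> = (q * ?m (Suc n) * ?m (Suc n + k))\<^sup>2"
      by (simp add: power2_eq_square)
    finally show "(\<integral>\<omega>. ?ps \<omega> (?w 1) * ?ps \<omega> (?w (Suc k)) \<partial>\<Omega>)\<^sup>2 \<le> (q * ?m (Suc n) * ?m (Suc n + k))\<^sup>2" .
    show "0 \<le> q * ?m (Suc n) * ?m (Suc n + k)" using q m by (simp add: less_imp_le)
  qed
  have c: "fk_weight k x \<le> c" if "x \<in> space E" for x
    unfolding c_def by (rule fk_weight_le_mass_ratio[OF r \<eta>0 that])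
  have c_nonneg: "0 \<le> c" unfolding c_def using r_nonneg m by (simp add: less_imp_le)
  let ?T = "\<lambda>\<omega>. \<integral>y. (particle_sum G H N ((\<lambda>p. \<xi> p \<omega>)(Suc n := y)) (Suc n) F)\<^sup>2
          \<partial>particle_transition E G M \<epsilon> N n (\<xi> n \<omega>)"
  let ?R = "\<lambda>\<omega>. (?ps \<omega> (fk_step n F))\<^sup>2 + c / N * (?ps \<omega> (?w 1) * ?ps \<omega> (?w (Suc k)))"
  have T_le: "?T \<omega> \<le> ?R \<omega>" if "\<omega> \<in> space \<Omega>" for \<omega>
    by (rule second_moment_particle_sum_step[OF _ F bound c]) (rule particle_in_space[OF \<xi> that])
  have int_R: "integrable \<Omega> ?R"
    by (intro Bochner_Integration.integrable_add integrable_mult_right int_step int_ww)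
  have "(\<integral>\<omega>. (particle_sum G H N (\<lambda>p. \<xi> p \<omega>) (Suc n) F)\<^sup>2 \<partial>\<Omega>) = (\<integral>\<omega>. ?T \<omega> \<partial>\<Omega>)"
    by (rule particle_system_integral_Suc[OF \<xi> F bounded_by_weight[OF bound]])
  \<comment> \<open>This form of monotonicity asks for integrability of the nonnegative upper bound
    \<open>?R\<close> alone, so the conditional second moment \<open>?T\<close> need not be shown
    measurable.\<close>
  also have "\<dots> \<le> (\<integral>\<omega>. ?R \<omega> \<partial>\<Omega>)"
  proof (rule integral_mono_AE')
    show "integrable \<Omega> ?R" by (rule int_R)
    show "AE \<omega> in \<Omega>. ?T \<omega> \<le> ?R \<omega>" using T_le by (intro AE_I2)
    show "AE \<omega> in \<Omega>. 0 \<le> ?R \<omega>"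
      using T_le by (intro AE_I2 order_trans[OF _ T_le]) simp_all
  qed
  also have "\<dots> = (\<integral>\<omega>. (?ps \<omega> (fk_step n F))\<^sup>2 \<partial>\<Omega>)
      + c / N * (\<integral>\<omega>. ?ps \<omega> (?w 1) * ?ps \<omega> (?w (Suc k)) \<partial>\<Omega>)"
    by (subst Bochner_Integration.integral_add[OF int_step integrable_mult_right[OF int_ww]])
      (simp only: integral_mult_right_zero)
  also have "\<dots> \<le> ((fk_functional \<eta>0 n (fk_step n F))\<^sup>2 + (q - 1) * (?m (n + Suc k))\<^sup>2)
      + c / N * (q * ?m (Suc n) * ?m (Suc n + k))"
    unfolding q_def using c_nonneg
    by (intro add_mono mult_left_mono cross[unfolded q_def] Suc.IH[OF step_meas step_le]) auto
  also have "c / N * (q * ?m (Suc n) * ?m (Suc n + k)) = r / N * q * (?m (n + Suc k))\<^sup>2"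
    using m[of "Suc n"] by (simp add: c_def power2_eq_square)
  finally have le: "(\<integral>\<omega>. (particle_sum G H N (\<lambda>p. \<xi> p \<omega>) (Suc n) F)\<^sup>2 \<partial>\<Omega>)
      \<le> (fk_functional \<eta>0 n (fk_step n F))\<^sup>2 + (q - 1) * (?m (n + Suc k))\<^sup>2 + r / N * q * (?m (n + Suc k))\<^sup>2" .
  \<comment> \<open>The inherited error \<open>q - 1\<close> and the new error
    \<open>r / N * q\<close> add up to \<open>(1 + r / N) * q - 1\<close>.\<close>
  have "(1 + r / N) ^ Suc (Suc n) = (1 + r / N) * q" by (simp only: q_def power_Suc)
  then have "((1 + r / N) ^ Suc (Suc n) - 1) * (?m (Suc n + k))\<^sup>2
      = (q - 1) * (?m (n + Suc k))\<^sup>2 + r / N * q * (?m (n + Suc k))\<^sup>2"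
    by (simp only: add_Suc add_Suc_right) (simp only: algebra_simps mult_1_left)
  then show ?case using le by (simp only: fk_functional.simps add.assoc)
qed

end

section \<open>From moments of the unnormalized functional to the four estimates\<close>

theorem corollary5p3:
  fixes E :: "'a measure" and lam :: "'a measure" and \<eta>0 :: "'a measure"
    and G :: "'a \<Rightarrow> real" and H :: "'a \<Rightarrow> 'a \<Rightarrow> real" and M :: "'a \<Rightarrow> 'a measure"
    and \<Omega>' :: "'v measure" and X :: "nat \<Rightarrow> 'v \<Rightarrow> 'a"
    and \<Omega> :: "'w measure" and \<xi> :: "nat \<Rightarrow> 'w \<Rightarrow> (nat \<Rightarrow> 'a)"
    and \<epsilon> :: "nat \<Rightarrow> real" and \<delta> \<rho> :: real and m n N :: nat
    and F :: "(nat \<Rightarrow> 'a) \<Rightarrow> real"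
  assumes \<eta>0: "\<eta>0 \<in> space (prob_algebra E)"
    and G_meas: "G \<in> borel_measurable E"
    and G_range: "\<And>x. x \<in> space E \<Longrightarrow> 0 < G x \<and> G x \<le> 1"
    and lam: "sigma_finite_measure lam" "sets lam = sets E"
    and H_meas: "(\<lambda>(x, y). H x y) \<in> borel_measurable (E \<Otimes>\<^sub>M E)"
    and H_pos: "\<And>x y. x \<in> space E \<Longrightarrow> y \<in> space E \<Longrightarrow> 0 < H x y"
    and M: "M \<in> E \<rightarrow>\<^sub>M prob_algebra E"
    and M_density: "\<And>x. x \<in> space E \<Longrightarrow> M x = density lam (\<lambda>y. ennreal (H x y))"
    and X: "markov_chain \<Omega>' E \<eta>0 (\<lambda>_. M) X"
    and \<epsilon>_nonneg: "\<And>k. 0 \<le> \<epsilon> k"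
    and \<epsilon>_le: "\<And>k x. x \<in> space E \<Longrightarrow> \<epsilon> k * G x \<le> 1"
    and \<xi>: "particle_system \<Omega> E \<eta>0 G M \<epsilon> N \<xi>"
    and m: "1 \<le> m" and \<delta>: "1 \<le> \<delta>" and \<rho>: "1 \<le> \<rho>"
    and G_mix: "\<And>x x'. x \<in> space E \<Longrightarrow> x' \<in> space E \<Longrightarrow> G x \<le> \<delta> * G x'"
    and M_mix: "\<And>x x' A. x \<in> space E \<Longrightarrow> x' \<in> space E \<Longrightarrow> A \<in> sets E \<Longrightarrow>
      emeasure (kernel_iterate E M m x) A \<le> ennreal \<rho> * emeasure (kernel_iterate E M m x') A"
    and F_meas: "F \<in> borel_measurable (PiM {..n} (\<lambda>_. E))"
    and F_bound: "\<And>z. z \<in> space (PiM {..n} (\<lambda>_. E)) \<Longrightarrow> \<bar>F z\<bar> \<le> 1"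
    and N: "real N > (real n + 1) * \<rho> * \<delta> ^ m"
  shows "let Q = fk_path \<Omega>' X G n F;
             QN = (\<lambda>\<omega>. \<integral>z. F z \<partial>(particle_path_measure E G H N (\<lambda>p. \<xi> p \<omega>) n));
             W = (\<lambda>\<omega>. particle_fluctuation E G H N (\<lambda>p. \<xi> p \<omega>) n F (fk_gamma \<Omega>' X G n) Q)
         in (\<integral>\<omega>. W \<omega> \<partial>\<Omega>) = 0
          \<and> (\<integral>\<omega>. (W \<omega>)\<^sup>2 \<partial>\<Omega>)
              \<le> (\<delta> ^ m * \<rho>)\<^sup>2 * (real n + 1) * (1 + 2 / real N * \<rho> * \<delta> ^ m * (real n + 2))
          \<and> real N * (\<integral>\<omega>. (QN \<omega> - Q)\<^sup>2 \<partial>\<Omega>)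
              \<le> 2 * (real n + 1) * \<rho> * \<delta> ^ m
                  * (4 + \<rho> * \<delta> ^ m * (1 + 2 / real N * (real n + 2)))
          \<and> real N * \<bar>(\<integral>\<omega>. QN \<omega> \<partial>\<Omega>) - Q\<bar>
              \<le> 2 * sqrt 2 * (real n + 1) * \<rho> * \<delta> ^ m
                  * sqrt (4 + \<rho> * \<delta> ^ m * (1 + 2 / real N * (real n + 2)))"
proof -
  define s where "s = \<rho> * \<delta> ^ m / N"
  \<comment> \<open>This is \<open>(n + 1) * r / N\<close>, the number that the hypothesis on
    \<open>N\<close> keeps below 1.\<close>
  define y where "y = (real n + 1) * s"
  define r where "r = \<rho> * \<delta> ^ m"
  define \<gamma> where "\<gamma> = fk_gamma \<Omega>' X G n"
  define Q where "Q = fk_path \<Omega>' X G n F"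
  have r1: "1 \<le> r"
    unfolding r_def using mult_mono[of 1 \<rho> 1 "\<delta> ^ m"] \<rho> \<delta> by simp
  have Npos: "0 < real N"
  proof -
    have "0 \<le> (real n + 1) * \<rho> * \<delta> ^ m" using \<rho> \<delta> by simp
    then show ?thesis using N by linarith
  qed
  have sN: "real N * s = r" using Npos by (simp add: s_def r_def)
  have s0: "0 \<le> s" using r1 Npos by (simp add: s_def r_def[symmetric])
  have y0: "0 \<le> y" using s0 by (simp add: y_def)
  have y1: "y \<le> 1"
    using N Npos by (simp add: y_def s_def divide_le_eq mult.assoc)
  have Ny: "real N * y = (real n + 1) * r" unfolding y_def sN[symmetric] by (simp add: mult_ac)
  interpret fk_particle_model E lam G H M \<epsilon> N
    using G_meas G_range lam(2) H_meas H_pos M M_density Npos \<epsilon>_nonneg \<epsilon>_le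
    by unfold_locales auto
  let ?P = "PiM {..n} (\<lambda>_. E)"
  let ?A = "\<lambda>\<omega>. particle_sum G H N (\<lambda>p. \<xi> p \<omega>) n F"
  let ?B = "\<lambda>\<omega>. particle_sum G H N (\<lambda>p. \<xi> p \<omega>) n (\<lambda>_. 1)"
  define QN where "QN = (\<lambda>\<omega>. \<integral>z. F z \<partial>(particle_path_measure E G H N (\<lambda>p. \<xi> p \<omega>) n))"
  define W where "W = (\<lambda>\<omega>. particle_fluctuation E G H N (\<lambda>p. \<xi> p \<omega>) n F \<gamma> Q)"
  interpret \<Omega>: prob_space \<Omega> by (rule particle_systemD[OF \<xi>])

  have one_meas: "(\<lambda>_. 1 :: real) \<in> borel_measurable ?P" by simp
  have one_functional: "fk_functional \<eta>0 n (\<lambda>_. 1) = fk_mass \<eta>0 n"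
    using fk_functional_weight[of \<eta>0 n 0] by simp
  have \<gamma>: "\<gamma> = fk_mass \<eta>0 n"
    using markov_chain_fk_functional[OF X one_meas] by (simp add: \<gamma>_def fk_gamma_def one_functional)
  have \<gamma>_pos: "0 < \<gamma>" unfolding \<gamma> by (rule fk_mass_pos[OF \<eta>0])
  have F_functional: "fk_functional \<eta>0 n F = Q * \<gamma>"
    using markov_chain_fk_functional[OF X F_meas F_bound] \<gamma>_pos
    by (simp add: Q_def fk_path_def \<gamma>_def[symmetric])

  have weight_ratio: "fk_weight k x \<le> r * fk_weight k x'" if "x \<in> space E" "x' \<in> space E" for k x x'
    unfolding r_def by (rule fk_weight_ratio_le[OF \<delta> \<rho> G_mix M_mix that])
  \<comment> \<open>The sup norm bound is domination by the weight of index 0, for which the mass in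
    the second moment bound is \<open>\<gamma>\<close> itself.\<close>
  have F_le: "\<bar>F z\<bar> \<le> fk_weight 0 (z n)" if "z \<in> space ?P" for z
    using F_bound[OF that] by simp
  have r0: "0 \<le> r" using r1 by simp

  note A = random_particle_sum[OF \<xi> F_meas F_bound]
  have B: "?B \<in> borel_measurable \<Omega>" "\<And>\<omega>. \<omega> \<in> space \<Omega> \<Longrightarrow> \<bar>?B \<omega>\<bar> \<le> 1"
    using random_particle_sum[OF \<xi> one_meas] by auto
  have EA: "(\<integral>\<omega>. ?A \<omega> \<partial>\<Omega>) = Q * \<gamma>"
    unfolding F_functional[symmetric] by (rule mean_particle_sum[where k = 0 and n = n, OF \<xi> \<eta>0 F_meas F_le])
  have EB: "(\<integral>\<omega>. ?B \<omega> \<partial>\<Omega>) = \<gamma>"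
    unfolding \<gamma> one_functional[symmetric] by (rule mean_particle_sum[where k = 0, OF \<xi> \<eta>0]) simp_all
  \<comment> \<open>The common bound on the variances of \<open>?A\<close> and \<open>?B\<close>
    after division by \<open>\<gamma>\<close>.\<close>
  define \<kappa> where "\<kappa> = (1 + s) ^ Suc n - 1"
  have \<kappa>: "\<kappa> \<le> y + y\<^sup>2"
    using power_one_plus_le[OF s0, of "Suc n"] y1 by (simp add: \<kappa>_def y_def add.commute)
  have y_sq: "y\<^sup>2 \<le> y" using mult_left_mono[OF y1 y0] by (simp add: power2_eq_square)
  have EA2: "(\<integral>\<omega>. (?A \<omega>)\<^sup>2 \<partial>\<Omega>) \<le> (Q * \<gamma>)\<^sup>2 + \<kappa> * \<gamma>\<^sup>2"
  proof -
    have "(\<integral>\<omega>. (?A \<omega>)\<^sup>2 \<partial>\<Omega>)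
        \<le> (fk_functional \<eta>0 n F)\<^sup>2 + ((1 + r / N) ^ Suc n - 1) * (fk_mass \<eta>0 (n + 0))\<^sup>2"
      by (rule second_moment_particle_sum[OF \<xi> \<eta>0 weight_ratio r0 F_meas F_le])
    then show ?thesis unfolding F_functional \<kappa>_def s_def r_def[symmetric] \<gamma>[symmetric] add_0_right .
  qed
  have EB2: "(\<integral>\<omega>. (?B \<omega>)\<^sup>2 \<partial>\<Omega>) \<le> \<gamma>\<^sup>2 + \<kappa> * \<gamma>\<^sup>2"
  proof -
    have "(\<integral>\<omega>. (?B \<omega>)\<^sup>2 \<partial>\<Omega>)
        \<le> (fk_functional \<eta>0 n (\<lambda>_. 1))\<^sup>2 + ((1 + r / N) ^ Suc n - 1) * (fk_mass \<eta>0 (n + 0))\<^sup>2"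
      by (rule second_moment_particle_sum[where k = 0, OF \<xi> \<eta>0 weight_ratio r0]) simp_all
    then show ?thesis unfolding one_functional \<kappa>_def s_def r_def[symmetric] \<gamma>[symmetric] add_0_right .
  qed

  \<comment> \<open>\<open>a\<close> is the fluctuation without its factor \<open>sqrt N\<close>.
    The sign of \<open>b\<close> is chosen such that \<open>?A = ?B * QN\<close> yields the
    decomposition \<open>QN - Q = a + b * QN\<close>.\<close>
  define a where "a = (\<lambda>\<omega>. ?A \<omega> / \<gamma> - Q)"
  define b where "b = (\<lambda>\<omega>. 1 - ?B \<omega> / \<gamma>)"
  have int_A: "integrable \<Omega> ?A" "integrable \<Omega> (\<lambda>\<omega>. (?A \<omega>)\<^sup>2)"
    using A by (intro integrable_prob_bounded[OF \<Omega>.prob_space_axioms, where C = 1] borel_measurable_power;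
      simp add: abs_square_le_1)+
  have int_B: "integrable \<Omega> ?B" "integrable \<Omega> (\<lambda>\<omega>. (?B \<omega>)\<^sup>2)"
    using B by (intro integrable_prob_bounded[OF \<Omega>.prob_space_axioms, where C = 1] borel_measurable_power;
      simp add: abs_square_le_1)+
  have a_sq: "(\<lambda>\<omega>. (a \<omega>)\<^sup>2) = (\<lambda>\<omega>. (?A \<omega>)\<^sup>2 / \<gamma>\<^sup>2 - 2 * Q / \<gamma> * ?A \<omega> + Q\<^sup>2)"
    by (simp add: a_def fun_eq_iff power2_diff power_divide)
  have b_sq: "(\<lambda>\<omega>. (b \<omega>)\<^sup>2) = (\<lambda>\<omega>. (?B \<omega>)\<^sup>2 / \<gamma>\<^sup>2 - 2 / \<gamma> * ?B \<omega> + 1)"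
    by (simp add: b_def fun_eq_iff power2_diff power_divide)
  have int_a2: "integrable \<Omega> (\<lambda>\<omega>. (a \<omega>)\<^sup>2)" unfolding a_sq using int_A by simp
  have int_b2: "integrable \<Omega> (\<lambda>\<omega>. (b \<omega>)\<^sup>2)" unfolding b_sq using int_B by simp
  have Ea: "(\<integral>\<omega>. a \<omega> \<partial>\<Omega>) = 0"
    unfolding a_def using int_A EA \<gamma>_pos by (simp add: \<Omega>.prob_space)
  have Ea2: "(\<integral>\<omega>. (a \<omega>)\<^sup>2 \<partial>\<Omega>) \<le> \<kappa>"
  proof -
    have "(\<integral>\<omega>. (a \<omega>)\<^sup>2 \<partial>\<Omega>) = (\<integral>\<omega>. (?A \<omega>)\<^sup>2 \<partial>\<Omega>) / \<gamma>\<^sup>2 - 2 * Q / \<gamma> * (Q * \<gamma>) + Q\<^sup>2"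
      unfolding a_sq EA[symmetric] using int_A by (simp add: \<Omega>.prob_space)
    also have "\<dots> \<le> ((Q * \<gamma>)\<^sup>2 + \<kappa> * \<gamma>\<^sup>2) / \<gamma>\<^sup>2 - 2 * Q / \<gamma> * (Q * \<gamma>) + Q\<^sup>2"
      using EA2 by (intro add_right_mono diff_right_mono divide_right_mono) auto
    also have "\<dots> = \<kappa>" using \<gamma>_pos by (simp add: field_simps power2_eq_square)
    finally show ?thesis .
  qed
  have Eb2: "(\<integral>\<omega>. (b \<omega>)\<^sup>2 \<partial>\<Omega>) \<le> \<kappa>"
  proof -
    have "(\<integral>\<omega>. (b \<omega>)\<^sup>2 \<partial>\<Omega>) = (\<integral>\<omega>. (?B \<omega>)\<^sup>2 \<partial>\<Omega>) / \<gamma>\<^sup>2 - 2 / \<gamma> * \<gamma> + 1"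
      unfolding b_sq using int_B EB by (simp add: \<Omega>.prob_space)
    also have "\<dots> \<le> (\<gamma>\<^sup>2 + \<kappa> * \<gamma>\<^sup>2) / \<gamma>\<^sup>2 - 2 / \<gamma> * \<gamma> + 1"
      using EB2 by (intro add_right_mono diff_right_mono divide_right_mono) auto
    also have "\<dots> = \<kappa>" using \<gamma>_pos by (simp add: field_simps power2_eq_square)
    finally show ?thesis .
  qed
  have \<xi>_space: "\<xi> p \<omega> j \<in> space E" if "\<omega> \<in> space \<Omega>" "j < N" for p \<omega> j
    by (rule particle_in_space[OF \<xi> that])
  have QN_eq: "QN \<omega> = (\<Sum>j<N. backward_sum G H N (\<lambda>p. \<xi> p \<omega>) n F (\<xi> n \<omega> j)) / N" if "\<omega> \<in> space \<Omega>" for \<omega>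
    unfolding QN_def using \<xi>_space[OF that]
    by (intro integral_particle_path_measure[OF N_pos _ F_meas F_bound]) auto
  have B_prod: "?B \<omega> = (\<Prod>p<n. (\<Sum>j<N. G (\<xi> p \<omega> j)) / N)" if "\<omega> \<in> space \<Omega>" for \<omega>
    using \<xi>_space[OF that] Npos particle_sum_last[of n "\<lambda>p. \<xi> p \<omega>" "\<lambda>_. 1"] by simp
  have B_eq: "?B \<omega> = particle_gamma E G N (\<lambda>p. \<xi> p \<omega>) n" if "\<omega> \<in> space \<Omega>" for \<omega>
    unfolding B_prod[OF that] using \<xi>_space[OF that] by (subst particle_gamma_eq) auto
  have A_eq: "?A \<omega> = ?B \<omega> * QN \<omega>" if "\<omega> \<in> space \<Omega>" for \<omega>
    unfolding B_prod[OF that] QN_eq[OF that] by (simp only: particle_sum_def)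
  have W_eq: "W \<omega> = sqrt N * a \<omega>" if "\<omega> \<in> space \<Omega>" for \<omega>
    unfolding W_def particle_fluctuation_def a_def A_eq[OF that] B_eq[OF that] QN_def by simp
  have QN_meas: "QN \<in> borel_measurable \<Omega>"
  proof (subst measurable_cong[OF QN_eq])
    have "(\<lambda>\<omega>. backward_sum G H N (\<lambda>p. \<xi> p \<omega>) n F (\<xi> n \<omega> j)) \<in> borel_measurable \<Omega>" if "j \<in> {..<N}" for j
      using that F_meas particle_measurable[OF \<xi>]
      by (intro backward_sum_measurable[where F = "\<lambda>_. F"]) auto
    then show "(\<lambda>\<omega>. (\<Sum>j<N. backward_sum G H N (\<lambda>p. \<xi> p \<omega>) n F (\<xi> n \<omega> j)) / N) \<in> borel_measurable \<Omega>"
      by (intro borel_measurable_divide borel_measurable_sum borel_measurable_const)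
  qed
  have QN_le: "\<bar>QN \<omega>\<bar> \<le> 1" if "\<omega> \<in> space \<Omega>" for \<omega>
    unfolding QN_eq[OF that] using \<xi>_space[OF that] F_bound by (intro mean_backward_sum_abs_le) auto
  have int_QN: "integrable \<Omega> QN"
    by (rule integrable_prob_bounded[OF \<Omega>.prob_space_axioms QN_meas QN_le])
  define d where "d = (\<lambda>\<omega>. QN \<omega> - Q)"
  have d_meas: "d \<in> borel_measurable \<Omega>" unfolding d_def using QN_meas by measurable
  have d_eq: "d \<omega> = a \<omega> + b \<omega> * QN \<omega>" if "\<omega> \<in> space \<Omega>" for \<omega>
    unfolding d_def a_def b_def A_eq[OF that] by (simp add: algebra_simps)
  have d_le: "\<bar>d \<omega>\<bar> \<le> 1 + \<bar>Q\<bar>" if "\<omega> \<in> space \<Omega>" for \<omega>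
    unfolding d_def using QN_le[OF that] by linarith
  have int_d2: "integrable \<Omega> (\<lambda>\<omega>. (d \<omega>)\<^sup>2)"
  proof (rule integrable_prob_bounded[OF \<Omega>.prob_space_axioms, where C = "(1 + \<bar>Q\<bar>)\<^sup>2"])
    show "\<bar>(d \<omega>)\<^sup>2\<bar> \<le> (1 + \<bar>Q\<bar>)\<^sup>2" if "\<omega> \<in> space \<Omega>" for \<omega>
      using power_mono[OF d_le[OF that], of 2] by simp
  qed (use d_meas in measurable)
  have Ed2: "(\<integral>\<omega>. (d \<omega>)\<^sup>2 \<partial>\<Omega>) \<le> 4 * \<kappa>"
  proof -
    \<comment> \<open>No division by the random mass \<open>?B\<close> occurs: it is compared with
      \<open>\<gamma>\<close> through \<open>b\<close>, whose coefficient \<open>QN\<close> is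
      bounded by 1.\<close>
    have "(\<integral>\<omega>. (d \<omega>)\<^sup>2 \<partial>\<Omega>) \<le> (\<integral>\<omega>. 2 * (a \<omega>)\<^sup>2 + 2 * (b \<omega>)\<^sup>2 \<partial>\<Omega>)"
    proof (rule integral_mono[OF int_d2])
      fix \<omega> assume w: "\<omega> \<in> space \<Omega>"
      have "(QN \<omega>)\<^sup>2 \<le> 1" using QN_le[OF w] by (simp add: abs_square_le_1)
      then have "(b \<omega>)\<^sup>2 * (QN \<omega>)\<^sup>2 \<le> (b \<omega>)\<^sup>2 * 1" by (intro mult_left_mono) auto
      moreover have "(d \<omega>)\<^sup>2 \<le> 2 * (a \<omega>)\<^sup>2 + 2 * ((b \<omega>)\<^sup>2 * (QN \<omega>)\<^sup>2)"
        unfolding d_eq[OF w] using zero_le_power2[of "a \<omega> - b \<omega> * QN \<omega>"]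
        by (simp add: power2_eq_square algebra_simps)
      ultimately show "(d \<omega>)\<^sup>2 \<le> 2 * (a \<omega>)\<^sup>2 + 2 * (b \<omega>)\<^sup>2" by linarith
    qed (use int_a2 int_b2 in simp)
    also have "\<dots> = 2 * (\<integral>\<omega>. (a \<omega>)\<^sup>2 \<partial>\<Omega>) + 2 * (\<integral>\<omega>. (b \<omega>)\<^sup>2 \<partial>\<Omega>)"
      using int_a2 int_b2 by simp
    finally show ?thesis using Ea2 Eb2 by linarith
  qed
  have N\<kappa>: "real N * \<kappa> \<le> (real n + 1) * r * (1 + y)"
  proof -
    have "real N * \<kappa> \<le> real N * (y + y\<^sup>2)" using \<kappa> Npos by (intro mult_left_mono) auto
    also have "\<dots> = (real N * y) * (1 + y)" by (simp add: power2_eq_square algebra_simps)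
    finally show ?thesis by (simp only: Ny)
  qed
  have nr: "0 \<le> (real n + 1) * r" using r0 by simp

  have part1: "(\<integral>\<omega>. W \<omega> \<partial>\<Omega>) = 0"
  proof -
    have "(\<integral>\<omega>. W \<omega> \<partial>\<Omega>) = (\<integral>\<omega>. sqrt N * a \<omega> \<partial>\<Omega>)"
      by (intro Bochner_Integration.integral_cong refl W_eq)
    then show ?thesis using Ea by simp
  qed
  have part2: "(\<integral>\<omega>. (W \<omega>)\<^sup>2 \<partial>\<Omega>) \<le> (\<delta> ^ m * \<rho>)\<^sup>2 * (real n + 1) * (1 + 2 / real N * \<rho> * \<delta> ^ m * (real n + 2))"
  proof -
    have "(\<integral>\<omega>. (W \<omega>)\<^sup>2 \<partial>\<Omega>) = (\<integral>\<omega>. N * (a \<omega>)\<^sup>2 \<partial>\<Omega>)"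
      by (intro Bochner_Integration.integral_cong refl) (simp add: W_eq power_mult_distrib)
    also have "\<dots> = N * (\<integral>\<omega>. (a \<omega>)\<^sup>2 \<partial>\<Omega>)" by simp
    also have "\<dots> \<le> N * \<kappa>" using Ea2 Npos by (intro mult_left_mono) auto
    also have "\<dots> \<le> (real n + 1) * r * (1 + y)" by (rule N\<kappa>)
    \<comment> \<open>Passage to the stated shape: \<open>r \<le> r * r\<close> because
      \<open>1 \<le> r\<close>, and \<open>n + 1 \<le> 2 * (n + 2)\<close>.\<close>
    also have "\<dots> \<le> (real n + 1) * (r * r) * (1 + 2 * s * (real n + 2))"
    proof (intro mult_mono)
      show "r \<le> r * r" using mult_left_mono[OF r1 r0] by simp
      have "(real n + 1) * s \<le> (2 * (real n + 2)) * s" using s0 by (intro mult_right_mono) auto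
      then show "1 + y \<le> 1 + 2 * s * (real n + 2)" by (simp add: y_def mult_ac)
    qed (use r0 s0 y0 in auto)
    also have "\<dots> = (\<delta> ^ m * \<rho>)\<^sup>2 * (real n + 1) * (1 + 2 / real N * \<rho> * \<delta> ^ m * (real n + 2))"
      by (simp add: r_def s_def power2_eq_square mult_ac)
    finally show ?thesis .
  qed
  \<comment> \<open>The bracket of the last two claims. As \<open>1 + y \<le> 2\<close>, the mean
    square error times \<open>N\<close> is at most \<open>8 * (n + 1) * r\<close>, and
    \<open>4 \<le> Z\<close> turns this into the claimed bound.\<close>
  define Z where "Z = 4 + r * (1 + 2 / real N * (real n + 2))"
  have Z4: "4 \<le> Z" using r0 Npos by (simp add: Z_def)
  have Nd2: "real N * (\<integral>\<omega>. (d \<omega>)\<^sup>2 \<partial>\<Omega>) \<le> 2 * (real n + 1) * r * Z"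
  proof -
    have "real N * (\<integral>\<omega>. (d \<omega>)\<^sup>2 \<partial>\<Omega>) \<le> real N * (4 * \<kappa>)"
      using Ed2 Npos by (intro mult_left_mono) auto
    also have "\<dots> \<le> 4 * ((real n + 1) * r * (1 + y))" using N\<kappa> by simp
    also have "\<dots> \<le> 4 * ((real n + 1) * r * 2)"
      using nr y1 by (intro mult_left_mono) auto
    also have "\<dots> = 2 * ((real n + 1) * r) * 4" by simp
    also have "\<dots> \<le> 2 * ((real n + 1) * r) * Z"
      using nr Z4 by (intro mult_left_mono) auto
    finally show ?thesis by (simp only: mult.assoc)
  qed
  have part4: "real N * \<bar>(\<integral>\<omega>. QN \<omega> \<partial>\<Omega>) - Q\<bar> \<le> 2 * sqrt 2 * (real n + 1) * r * sqrt Z"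
  proof -
    have int_bd: "integrable \<Omega> (\<lambda>\<omega>. b \<omega> * d \<omega>)"
      and Ebd: "(\<integral>\<omega>. b \<omega> * d \<omega> \<partial>\<Omega>) = (\<integral>\<omega>. QN \<omega> \<partial>\<Omega>) - Q"
    proof -
      \<comment> \<open>Expanding with \<open>?A = ?B * QN\<close> leaves the error of
        \<open>QN\<close> plus \<open>- ?A / \<gamma> + Q * ?B / \<gamma>\<close>, whose mean
        vanishes by unbiasedness of both estimates. The bias is therefore the mean of a product of
        two errors, each of order \<open>1 / sqrt N\<close>.\<close>
      have eq: "b \<omega> * d \<omega> = QN \<omega> - Q - ?A \<omega> / \<gamma> + Q / \<gamma> * ?B \<omega>" if "\<omega> \<in> space \<Omega>" for \<omega>
        unfolding b_def d_def A_eq[OF that] by (simp add: algebra_simps diff_divide_distrib)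
      have "integrable \<Omega> (\<lambda>\<omega>. QN \<omega> - Q - ?A \<omega> / \<gamma> + Q / \<gamma> * ?B \<omega>)"
        using int_QN int_A int_B by simp
      then show "integrable \<Omega> (\<lambda>\<omega>. b \<omega> * d \<omega>)"
        by (rule Bochner_Integration.integrable_cong[THEN iffD1, rotated 2]) (simp_all add: eq)
      have "(\<integral>\<omega>. b \<omega> * d \<omega> \<partial>\<Omega>) = (\<integral>\<omega>. QN \<omega> - Q - ?A \<omega> / \<gamma> + Q / \<gamma> * ?B \<omega> \<partial>\<Omega>)"
        by (intro Bochner_Integration.integral_cong refl eq)
      also have "\<dots> = (\<integral>\<omega>. QN \<omega> \<partial>\<Omega>) - Q - (Q * \<gamma>) / \<gamma> + Q / \<gamma> * \<gamma>"
        using int_QN int_A int_B EA EB by (simp add: \<Omega>.prob_space)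
      finally show "(\<integral>\<omega>. b \<omega> * d \<omega> \<partial>\<Omega>) = (\<integral>\<omega>. QN \<omega> \<partial>\<Omega>) - Q" using \<gamma>_pos by simp
    qed
    have "(real N * \<bar>(\<integral>\<omega>. QN \<omega> \<partial>\<Omega>) - Q\<bar>)\<^sup>2 = (real N)\<^sup>2 * (\<integral>\<omega>. b \<omega> * d \<omega> \<partial>\<Omega>)\<^sup>2"
      by (simp add: Ebd power_mult_distrib)
    also have "\<dots> \<le> (real N)\<^sup>2 * ((\<integral>\<omega>. (b \<omega>)\<^sup>2 \<partial>\<Omega>) * (\<integral>\<omega>. (d \<omega>)\<^sup>2 \<partial>\<Omega>))"
      by (intro mult_left_mono Cauchy_Schwarz_integral int_b2 int_d2 int_bd) simp
    also have "\<dots> = (real N * (\<integral>\<omega>. (b \<omega>)\<^sup>2 \<partial>\<Omega>)) * (real N * (\<integral>\<omega>. (d \<omega>)\<^sup>2 \<partial>\<Omega>))"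
      by (simp add: power2_eq_square mult_ac)
    \<comment> \<open>The first constant is taken as 4 so that the product \<open>4 * 2\<close> is
      the square of the target constant \<open>2 * sqrt 2\<close>.\<close>
    also have "\<dots> \<le> (4 * (real n + 1) * r) * (2 * (real n + 1) * r * Z)"
    proof (rule mult_mono[OF _ Nd2])
      have "real N * (\<integral>\<omega>. (b \<omega>)\<^sup>2 \<partial>\<Omega>) \<le> real N * \<kappa>"
        using Eb2 Npos by (intro mult_left_mono) auto
      also have "\<dots> \<le> (real n + 1) * r * (1 + y)" by (rule N\<kappa>)
      also have "\<dots> \<le> (real n + 1) * r * 4" using nr y1 by (intro mult_left_mono) auto
      finally show "real N * (\<integral>\<omega>. (b \<omega>)\<^sup>2 \<partial>\<Omega>) \<le> 4 * (real n + 1) * r" by (simp add: mult_ac)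
    qed (use r0 in auto)
    also have "\<dots> = 8 * (real n + 1)\<^sup>2 * r\<^sup>2 * Z"
      by (simp add: power2_eq_square algebra_simps)
    also have "\<dots> = (2 * sqrt 2 * (real n + 1) * r * sqrt Z)\<^sup>2"
      using Z4 by (simp add: power_mult_distrib)
    finally show ?thesis
      by (rule power2_le_imp_le) (use r0 Z4 in simp)
  qed
  show ?thesis
    using part1 part2 Nd2 part4
    unfolding Let_def W_def d_def QN_def Z_def r_def Q_def \<gamma>_def
    by (simp only: mult.assoc simp_thms)
qed

end
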